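(* Consider the loss network with $s$ resources of capacities $\mathbf b\in\mathbf R_+^s$ and $m$ request classes with parameters $\lambda_i,\mu_i,r_i$ and allocation sets $\mathcal B_i=\{\mathbf b_{i1},\dots,\mathbf b_{il_i}\}\subset\mathbf R_+^s$, $\rho_i=\lambda_i/\mu_i$, controlled by the network penalty policy $\bar\pi$ with parameters $\varepsilon,\beta,(\mathbf C^0,\mathbf c^1)$ and initial fictitious load $\bar{\mathbf y}(0^-)$. Suppose $0<\varepsilon<\frac14$; let $(\alpha_{ij}^\varepsilon)$ be an optimal solution of the perturbed linear program $$\max_\alpha\ \sum_{i=1}^mr_i\rho_i\sum_{j=1}^{l_i}\alpha_{ij}\quad\text{s.t.}\quad\sum_{i=1}^m\rho_i\sum_{j=1}^{l_i}\mathbf b_{ij}\alpha_{ij}\le\frac{1}{1+4\varepsilon}\mathbf b,\quad\sum_{j=1}^{l_i}\alpha_{ij}\le1\ \forall i,\quad\alpha_{ij}\ge0\ \forall i,j;$$ set $\alpha_i^\varepsilon=\sum_{j=1}^{l_i}\alpha_{ij}^\varepsilon$ and let $$c_i^1=(1+4\varepsilon)(1-\alpha_i^\varepsilon)\rho_i,\qquad c_{ik}^0=(1+4\varepsilon)\nu_k\Big(\sum_{j=1}^{l_i}\alpha_{ij}^\varepsilon b_{ij}(k)\Big)\rho_i,\qquad\nu_k=\frac{\frac{1}{1+4\varepsilon}b(k)}{\sum_{i=1}^m\sum_{j=1}^{l_i}\alpha_{ij}^\varepsilon\rho_ib_{ij}(k)},$$ for $k=1,\dots,s$, $i=1,\dots,m$;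 let $\beta>0$ satisfy $$\beta\le\varepsilon\min\Big\{\min_{i,j,k:\,b_{ij}(k)>0}\frac{c_{ik}^0}{b_{ij}(k)},\ \min_{i:\,\alpha_i^\varepsilon<1}c_i^1\Big\};$$ and let $\bar y_i(0^-)=(1-\alpha_i^\varepsilon)\rho_i$, $i=1,\dots,m$. Then for all $t\ge0$ the reward rate $\bar R(t)=\sum_{i=1}^mr_i\sum_{j=1}^{l_i}\bar x_{ij}(t)$ of $\bar\pi$ satisfies $$\mathbf E[\bar R(t)]\ge\sum_{i=1}^m\alpha_i^\varepsilon r_i\rho_i(1-e^{-\mu_it})-\zeta\sum_{i=1}^m(1-\alpha_i^\varepsilon)r_i\rho_i-(s+1)^2e^{-\frac\varepsilon2(\beta-4)}\sum_{i=1}^mr_i\rho_i(1-e^{-\mu_it}),$$ where $\zeta=\big(\frac{\log(s+1)}{\beta}+1-\frac\varepsilon2\big)(1+4\varepsilon)-1$.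
   Context: Loss network. There are $s$ resources; resource $k$ has capacity $b(k)$, $\mathbf b=(b(1),\dots,b(s))$. Class $i=1,\dots,m$ requests arrive in independent Poisson streams of rate $\lambda_i>0$, have independent $\exp(\mu_i)$ service durations, accept any allocation $\mathbf b_{ij}\in\mathcal B_i$ (with components $b_{ij}(k)$), and pay $r_i\ge0$ per unit time while in service. There is no waiting room: each arriving request is immediately rejected or assigned an allocation, which it holds until departure. The system is initially empty. Standing assumption: all allocations $\mathbf b_{ij}$ with $\alpha_{ij}^*=0$ have been dropped, where $\alpha^*$ is an optimal solution of the displayed linear program with $\frac{1}{1+4\varepsilon}\mathbf b$ replaced by $\mathbf b$. Network penalty policy $\bar\pi$. The network is augmented by one fictitious infinite-capacity system. Let $\bar x_{ij}(t)$ be the number of class $i$ requests in the network at time $t$ assigned to $\mathbf b_{ij}$ and $\bar y_i(t)$ the number of class $i$ requests in the fictitious system. At time $0^-$ the network is empty and the fictitious system contains $\bar y_i(0^-)$ class $i$ requests with independent $\exp(\mu_i)$ service times. Put $$\Psi_{ik}(\mathbf x_i)=\exp\Big(\beta\frac{\sum_{j=1}^{l_i}x_{ij}b_{ij}(k)}{c_{ik}^0}\Big),\qquad\Psi_i(y_i)=\exp\Big(\beta\frac{y_i}{c_i^1}\Big).$$ A class $i$ request arriving in state $(\mathbf x_1,\dots,\mathbf x_m,\mathbf y)$ is conditionally accepted if $\min_{1\le j\le l_i}\sum_{k=1}^s\frac{\partial\Psi_{ik}}{\partial x_{ij}}\le\frac{\partial\Psi_i}{\partial y_i}$. A conditionally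 accepted request is assigned to $\mathbf b_{ij}$ for some $j\in\arg\min_{1\le j'\le l_i}\sum_{k=1}^s\frac{\partial\Psi_{ik}}{\partial x_{ij'}}$ provided there is adequate capacity, i.e. $\sum_{i'}\sum_{j'}\mathbf b_{i'j'}x_{i'j'}+\mathbf b_{ij}\le\mathbf b$. In all other cases the request is rejected, i.e. sent to the fictitious system with an independent $\exp(\mu_i)$ service time. Conventions: if $c_i^1=0$ (i.e. $\alpha_i^\varepsilon=1$) every arriving class $i$ request is conditionally accepted; if $b_{ij}(k)=0$ for all $j$ then $\Psi_{ik}\equiv1$ (and $c_{ik}^0=0$). *)

theory Defs
  imports "HOL-Probability.Probability"
begin

(* Resources, classes and allocations are numbered from 1, and a function of such a number is
   only meaningful on the respective range.  alloc N i j k is b_ij(k). *)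
record loss_network =
  n_resources :: nat
  n_classes :: nat
  capacity :: "nat \<Rightarrow> real"
  n_allocs :: "nat \<Rightarrow> nat"
  alloc :: "nat \<Rightarrow> nat \<Rightarrow> nat \<Rightarrow> real"
  arrival_rate :: "nat \<Rightarrow> real"
  service_rate :: "nat \<Rightarrow> real"
  reward :: "nat \<Rightarrow> real"

definition resources :: "loss_network \<Rightarrow> nat set" where
  "resources N = {1..n_resources N}"

definition classes :: "loss_network \<Rightarrow> nat set" where
  "classes N = {1..n_classes N}"

definition allocs :: "loss_network \<Rightarrow> nat \<Rightarrow> nat set" where
  "allocs N i = {1..n_allocs N i}"

definition is_loss_network :: "loss_network \<Rightarrow> bool" where
  "is_loss_network N \<longleftrightarrow>
     (\<forall>k\<in>resources N. 0 \<le> capacity N k) \<and>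
     (\<forall>i\<in>classes N. \<forall>j\<in>allocs N i. \<forall>k\<in>resources N. 0 \<le> alloc N i j k) \<and>
     (\<forall>i\<in>classes N. 0 < arrival_rate N i \<and> 0 < service_rate N i \<and> 0 \<le> reward N i)"

definition load :: "loss_network \<Rightarrow> nat \<Rightarrow> real" where
  "load N i = arrival_rate N i / service_rate N i"


subsection \<open>The linear program\<close>

definition lp_value :: "loss_network \<Rightarrow> (nat \<Rightarrow> nat \<Rightarrow> real) \<Rightarrow> real" where
  "lp_value N \<alpha> = (\<Sum>i\<in>classes N. reward N i * load N i * (\<Sum>j\<in>allocs N i. \<alpha> i j))"

definition lp_feasible ::
    "loss_network \<Rightarrow> (nat \<Rightarrow> real) \<Rightarrow> (nat \<Rightarrow> nat \<Rightarrow> real) \<Rightarrow> bool" where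
  "lp_feasible N rhs \<alpha> \<longleftrightarrow>
     (\<forall>k\<in>resources N.
        (\<Sum>i\<in>classes N. load N i * (\<Sum>j\<in>allocs N i. alloc N i j k * \<alpha> i j)) \<le> rhs k) \<and>
     (\<forall>i\<in>classes N. (\<Sum>j\<in>allocs N i. \<alpha> i j) \<le> 1) \<and>
     (\<forall>i\<in>classes N. \<forall>j\<in>allocs N i. 0 \<le> \<alpha> i j)"

definition lp_optimal ::
    "loss_network \<Rightarrow> (nat \<Rightarrow> real) \<Rightarrow> (nat \<Rightarrow> nat \<Rightarrow> real) \<Rightarrow> bool" where
  "lp_optimal N rhs \<alpha> \<longleftrightarrow>
     lp_feasible N rhs \<alpha> \<and> (\<forall>\<alpha>'. lp_feasible N rhs \<alpha>' \<longrightarrow> lp_value N \<alpha>' \<le> lp_value N \<alpha>)"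

definition class_fraction :: "loss_network \<Rightarrow> (nat \<Rightarrow> nat \<Rightarrow> real) \<Rightarrow> nat \<Rightarrow> real" where
  "class_fraction N \<alpha> i = (\<Sum>j\<in>allocs N i. \<alpha> i j)"


subsection \<open>Penalty parameters\<close>

(* If the denominator of nu is 0, the quotient is 0 by convention; all the c0 with that k
   are then 0 as well, whatever the value of the quotient. *)
definition nu :: "loss_network \<Rightarrow> real \<Rightarrow> (nat \<Rightarrow> nat \<Rightarrow> real) \<Rightarrow> nat \<Rightarrow> real" where
  "nu N \<epsilon> \<alpha> k = (1 / (1 + 4 * \<epsilon>) * capacity N k) /
     (\<Sum>i\<in>classes N. \<Sum>j\<in>allocs N i. \<alpha> i j * load N i * alloc N i j k)"

definition c0 :: "loss_network \<Rightarrow> real \<Rightarrow> (nat \<Rightarrow> nat \<Rightarrow> real) \<Rightarrow> nat \<Rightarrow> nat \<Rightarrow> real" where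
  "c0 N \<epsilon> \<alpha> i k =
     (1 + 4 * \<epsilon>) * nu N \<epsilon> \<alpha> k * (\<Sum>j\<in>allocs N i. \<alpha> i j * alloc N i j k) * load N i"

definition c1 :: "loss_network \<Rightarrow> real \<Rightarrow> (nat \<Rightarrow> nat \<Rightarrow> real) \<Rightarrow> nat \<Rightarrow> real" where
  "c1 N \<epsilon> \<alpha> i = (1 + 4 * \<epsilon>) * (1 - class_fraction N \<alpha> i) * load N i"


subsection \<open>The network penalty policy\<close>

definition net_penalty ::
    "loss_network \<Rightarrow> real \<Rightarrow> (nat \<Rightarrow> nat \<Rightarrow> real) \<Rightarrow> nat \<Rightarrow> nat \<Rightarrow> (nat \<Rightarrow> real) \<Rightarrow> real" where
  "net_penalty N \<beta> C0 i k v =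
     (if \<forall>j\<in>allocs N i. alloc N i j k = 0 then 1
      else exp (\<beta> * ((\<Sum>j\<in>allocs N i. v j * alloc N i j k) / C0 i k)))"

definition fict_penalty :: "real \<Rightarrow> (nat \<Rightarrow> real) \<Rightarrow> nat \<Rightarrow> real \<Rightarrow> real" where
  "fict_penalty \<beta> C1 i u = exp (\<beta> * (u / C1 i))"

definition net_price ::
    "loss_network \<Rightarrow> real \<Rightarrow> (nat \<Rightarrow> nat \<Rightarrow> real) \<Rightarrow> nat \<Rightarrow> nat \<Rightarrow> (nat \<Rightarrow> real) \<Rightarrow> real" where
  "net_price N \<beta> C0 i j v =
     (\<Sum>k\<in>resources N. deriv (\<lambda>u. net_penalty N \<beta> C0 i k (v(j := u))) (v j))"

definition fict_price :: "real \<Rightarrow> (nat \<Rightarrow> real) \<Rightarrow> nat \<Rightarrow> real \<Rightarrow> real" where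
  "fict_price \<beta> C1 i u = deriv (fict_penalty \<beta> C1 i) u"

(* The minimum over an empty set of allocations is infinite: a class without allocations is
   always rejected. *)
definition conditionally_accepted ::
    "loss_network \<Rightarrow> real \<Rightarrow> (nat \<Rightarrow> nat \<Rightarrow> real) \<Rightarrow> (nat \<Rightarrow> real) \<Rightarrow> nat \<Rightarrow>
     (nat \<Rightarrow> nat \<Rightarrow> nat) \<Rightarrow> (nat \<Rightarrow> nat) \<Rightarrow> bool" where
  "conditionally_accepted N \<beta> C0 C1 i x y \<longleftrightarrow>
     allocs N i \<noteq> {} \<and>
     (C1 i = 0 \<or>
      Min ((\<lambda>j. net_price N \<beta> C0 i j (\<lambda>j'. real (x i j'))) ` allocs N i)
        \<le> fict_price \<beta> C1 i (real (y i)))"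

definition adequate_capacity ::
    "loss_network \<Rightarrow> nat \<Rightarrow> nat \<Rightarrow> (nat \<Rightarrow> nat \<Rightarrow> nat) \<Rightarrow> bool" where
  "adequate_capacity N i j x \<longleftrightarrow>
     (\<forall>k\<in>resources N.
        (\<Sum>i'\<in>classes N. \<Sum>j'\<in>allocs N i'. alloc N i' j' k * real (x i' j')) + alloc N i j k
          \<le> capacity N k)"

(* A rule picking, for a class i request arriving in state (x, y), one of the minimisers. *)
definition tie_breaking ::
    "loss_network \<Rightarrow> real \<Rightarrow> (nat \<Rightarrow> nat \<Rightarrow> real) \<Rightarrow>
     (nat \<Rightarrow> (nat \<Rightarrow> nat \<Rightarrow> nat) \<Rightarrow> (nat \<Rightarrow> nat) \<Rightarrow> nat) \<Rightarrow> bool" where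
  "tie_breaking N \<beta> C0 sel \<longleftrightarrow>
     (\<forall>i\<in>classes N. \<forall>x y. allocs N i \<noteq> {} \<longrightarrow>
        is_arg_min (\<lambda>j. net_price N \<beta> C0 i j (\<lambda>j'. real (x i j'))) (\<lambda>j. j \<in> allocs N i)
          (sel i x y))"

(* Some j: use allocation j; None: reject, i.e. send to the fictitious system. *)
definition penalty_decision ::
    "loss_network \<Rightarrow> real \<Rightarrow> (nat \<Rightarrow> nat \<Rightarrow> real) \<Rightarrow> (nat \<Rightarrow> real) \<Rightarrow>
     (nat \<Rightarrow> (nat \<Rightarrow> nat \<Rightarrow> nat) \<Rightarrow> (nat \<Rightarrow> nat) \<Rightarrow> nat) \<Rightarrow>
     nat \<Rightarrow> (nat \<Rightarrow> nat \<Rightarrow> nat) \<Rightarrow> (nat \<Rightarrow> nat) \<Rightarrow> nat option" where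
  "penalty_decision N \<beta> C0 C1 sel i x y =
     (if conditionally_accepted N \<beta> C0 C1 i x y \<and> adequate_capacity N i (sel i x y) x
      then Some (sel i x y) else None)"


subsection \<open>The stochastic model\<close>

(* The primitive random variables.  Requests of a class are numbered from 0 in order of arrival.
   Interarrival i n: time between the (n-1)-st and the n-th class i arrival (time 0 if n = 0);
   Net_Service i n, Fict_Service i n: service time of the n-th class i arrival, if it is accepted
   resp. if it is sent to the fictitious system;
   Init_Service i n: service time of the n-th class i request which is in the fictitious system
   just before time 0. *)
datatype clock =
    Interarrival nat nat
  | Net_Service nat nat
  | Fict_Service nat nat
  | Init_Service nat nat

fun clock_rate :: "loss_network \<Rightarrow> clock \<Rightarrow> real" where
  "clock_rate N (Interarrival i n) = arrival_rate N i"
| "clock_rate N (Net_Service i n) = service_rate N i"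
| "clock_rate N (Fict_Service i n) = service_rate N i"
| "clock_rate N (Init_Service i n) = service_rate N i"

definition clocks :: "loss_network \<Rightarrow> (nat \<Rightarrow> nat) \<Rightarrow> clock set" where
  "clocks N y0 =
     (\<Union>i\<in>classes N. range (Interarrival i) \<union> range (Net_Service i) \<union> range (Fict_Service i)
        \<union> Init_Service i ` {..<y0 i})"

definition driving_clocks ::
    "'a measure \<Rightarrow> loss_network \<Rightarrow> (nat \<Rightarrow> nat) \<Rightarrow> (clock \<Rightarrow> 'a \<Rightarrow> real) \<Rightarrow> bool" where
  "driving_clocks M N y0 T \<longleftrightarrow>
     prob_space M \<and>
     prob_space.indep_vars M (\<lambda>_. borel) T (clocks N y0) \<and>
     (\<forall>c\<in>clocks N y0. distributed M lborel (T c) (exponential_density (clock_rate N c)))"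

definition arrival_time :: "(clock \<Rightarrow> 'a \<Rightarrow> real) \<Rightarrow> nat \<Rightarrow> nat \<Rightarrow> 'a \<Rightarrow> real" where
  "arrival_time T i n \<omega> = (\<Sum>p\<le>n. T (Interarrival i p) \<omega>)"

(* Presence at time t, and in the left limit at t, of a request which arrives at time a and has
   service time v. *)
definition present :: "real \<Rightarrow> real \<Rightarrow> real \<Rightarrow> bool" where
  "present t a v \<longleftrightarrow> a \<le> t \<and> t < a + v"

definition present_before :: "real \<Rightarrow> real \<Rightarrow> real \<Rightarrow> bool" where
  "present_before t a v \<longleftrightarrow> a < t \<and> t \<le> a + v"

(* D i n is the decision on the n-th class i arrival; P is present t or present_before t. *)
definition net_count ::
    "loss_network \<Rightarrow> (clock \<Rightarrow> 'a \<Rightarrow> real) \<Rightarrow> (nat \<Rightarrow> nat \<Rightarrow> 'a \<Rightarrow> nat option) \<Rightarrow>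
     (real \<Rightarrow> real \<Rightarrow> bool) \<Rightarrow> 'a \<Rightarrow> nat \<Rightarrow> nat \<Rightarrow> nat" where
  "net_count N T D P \<omega> i j =
     (if i \<in> classes N \<and> j \<in> allocs N i
      then card {n. D i n \<omega> = Some j \<and> P (arrival_time T i n \<omega>) (T (Net_Service i n) \<omega>)}
      else 0)"

definition fict_count ::
    "loss_network \<Rightarrow> (nat \<Rightarrow> nat) \<Rightarrow> (clock \<Rightarrow> 'a \<Rightarrow> real) \<Rightarrow>
     (nat \<Rightarrow> nat \<Rightarrow> 'a \<Rightarrow> nat option) \<Rightarrow> (real \<Rightarrow> real \<Rightarrow> bool) \<Rightarrow> 'a \<Rightarrow> nat \<Rightarrow> nat" where
  "fict_count N y0 T D P \<omega> i =
     (if i \<in> classes N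
      then card {n. D i n \<omega> = None \<and> P (arrival_time T i n \<omega>) (T (Fict_Service i n) \<omega>)}
         + card {n. n < y0 i \<and> P 0 (T (Init_Service i n) \<omega>)}
      else 0)"

(* The decisions D are those of the penalty policy: almost surely each request is decided upon
   according to the state just before its arrival.  Almost surely arrival times are distinct and
   each request has finitely many predecessors, so the condition determines D recursively. *)
definition follows_penalty_policy ::
    "'a measure \<Rightarrow> loss_network \<Rightarrow> (nat \<Rightarrow> nat) \<Rightarrow> real \<Rightarrow> (nat \<Rightarrow> nat \<Rightarrow> real) \<Rightarrow>
     (nat \<Rightarrow> real) \<Rightarrow> (nat \<Rightarrow> (nat \<Rightarrow> nat \<Rightarrow> nat) \<Rightarrow> (nat \<Rightarrow> nat) \<Rightarrow> nat) \<Rightarrow>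
     (clock \<Rightarrow> 'a \<Rightarrow> real) \<Rightarrow> (nat \<Rightarrow> nat \<Rightarrow> 'a \<Rightarrow> nat option) \<Rightarrow> bool" where
  "follows_penalty_policy M N y0 \<beta> C0 C1 sel T D \<longleftrightarrow>
     (\<forall>i\<in>classes N. \<forall>n. D i n \<in> measurable M (count_space UNIV)) \<and>
     (AE \<omega> in M. \<forall>i\<in>classes N. \<forall>n.
        let P = present_before (arrival_time T i n \<omega>)
        in D i n \<omega> = penalty_decision N \<beta> C0 C1 sel i
                        (net_count N T D P \<omega>) (fict_count N y0 T D P \<omega>))"

definition reward_rate ::
    "loss_network \<Rightarrow> (clock \<Rightarrow> 'a \<Rightarrow> real) \<Rightarrow> (nat \<Rightarrow> nat \<Rightarrow> 'a \<Rightarrow> nat option) \<Rightarrow>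
     real \<Rightarrow> 'a \<Rightarrow> real" where
  "reward_rate N T D t \<omega> =
     (\<Sum>i\<in>classes N. reward N i *
        (\<Sum>j\<in>allocs N i. real (net_count N T D (present t) \<omega> i j)))"

end

theory Submission
  imports Defs
begin

text \<open>
  For a class with network state $x$ and $y$ fictitious requests consider the total penalty
  $S(x) + \Psi(y)$, $S = \sum_k \Psi_k$. The policy increases it at an arrival by at most the
  $\alpha$-average of all possible increments, and departures decrease it by about
  $\mu \sum \Psi \log \Psi$; so its expectation stays below $(s+1) e^{\beta (1 - \varepsilon/2)}$.

  This breaks down when a conditionally accepted request is blocked for lack of capacity: $\Psi(y)$
  may then increase by an arbitrary amount, and later decisions are distorted as well. To repair it, split
  $y = v + d$ and let the $d$ requests act as phantoms, each of which multiplies $S$ by $e^\kappa$, about as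
  much as an acceptance does. The potential
  $h(x, y) = \min_{v + d = y} \, p d + q (S(x) e^{\kappa d} + \Psi(v))$
  has the same drift as before, up to a term $p$ for each blocked request: a blocked request either becomes a
  phantom or is added to $v$, and a request which is accepted although the price exceeds $\Psi'(v)$ replaces
  a phantom, which is added to $v$.

  For $p = 0$ this bounds the expected penalties regardless of blocking, and hence, by convexity of the
  exponential function and Markov's inequality, the probability of blocking. For $p = 1$ it then bounds the
  expected number of fictitious requests, while the total number of requests of a class has a known
  expectation.

  The drift is integrated by means of Dynkin's formula. To derive it, the decisions are expressed as a
  function of the values of the clocks, which are independent and exponentially distributed.
\<close>

text \<open>Apart from tie-breaking, the other classes influence a decision only through the
  capacity check. So the potential is built class by class, and blocking is the only coupling; it
  may be correlated with the state in any way, which is why the drift inequality has to hold state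
  by state. Arrivals raise the penalties at a rate linear in them, departures lower them at a rate
  exp(l) * l. The tangent of the latter at a level \<open>th\<close> leaves a linear relaxation
  towards multiples of exp \<open>th\<close>. This level is the same for all classes, since the
  parameters are scaled by the loads. Unit jumps instead of derivatives cost a factor (exp
  \<epsilon> - 1) / \<epsilon> for arrivals and 1 - \<epsilon>/2 for departures. The slack 1 + 4
  \<epsilon> of the linear program pays for both and for one more factor 1 - \<epsilon>/2, so
  \<open>th\<close> is at most \<beta> (1 - \<epsilon>/2). Blocking requires a penalty near exp
  \<beta>, hence has probability of order exp(-\<epsilon> \<beta> / 2). Finally ln((s + 1)
  exp(\<beta> (1 - \<epsilon>/2))), divided by the fictitious slope \<beta> / c1, is the level (1 +
  \<zeta>) (1 - \<alpha>) \<rho> of the fictitious system.\<close>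

section \<open>Elementary inequalities for the exponential function\<close>

text \<open>Convexity: the chord over [0, e] lies above the graph. It bounds the jump of a penalty
  at an arrival by a multiple of the derivative.\<close>

lemma exp_minus_one_le:
  fixes u e :: real
  assumes "0 \<le> u" "u \<le> e" "0 < e"
  shows "exp u - 1 \<le> (exp e - 1) / e * u"
proof -
  have "convex_on UNIV (exp :: real \<Rightarrow> real)"
    by (rule exp_convex)
  from convex_onD[OF this, of "u / e" 0 e] assms
  have "exp u \<le> (1 - u / e) + u / e * exp e"
    by simp
  then have "exp u - 1 \<le> u / e * (exp e - 1)" by (simp add: algebra_simps)
  then show ?thesis by (simp add: mult.commute)
qed

text \<open>The second-order Taylor bound for exp(-u). It shows that a departure removes at least
  the fraction 1 - e/2 of what the derivative predicts.\<close>

lemma one_minus_exp_ge: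
  fixes u e :: real
  assumes "0 \<le> u" "u \<le> e"
  shows "exp (- u) - 1 \<le> - (1 - e / 2) * u"
proof -
  have "exp (- u) \<le> 1 - u + u\<^sup>2 / 2"
  proof -
    define f where "f = (\<lambda>x::real. 1 - x + x\<^sup>2 / 2 - exp (- x))"
    have "f 0 \<le> f u"
    proof (rule DERIV_nonneg_imp_nondecreasing[OF assms(1)])
      fix x assume "0 \<le> x" "x \<le> u"
      have "(f has_real_derivative (- 1 + x + exp (- x))) (at x)"
        unfolding f_def by (auto intro!: derivative_eq_intros)
      moreover have "0 \<le> - 1 + x + exp (- x)"
        using exp_ge_add_one_self[of "- x"] by simp
      ultimately show "\<exists>y. (f has_real_derivative y) (at x) \<and> 0 \<le> y" by blast
    qed
    then show ?thesis by (simp add: f_def)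
  qed
  moreover have "u\<^sup>2 \<le> e * u"
    unfolding power2_eq_square by (intro mult_right_mono assms)
  ultimately show ?thesis by (simp add: algebra_simps)
qed

text \<open>The convex function y ln y lies above its tangent at y = exp \<open>th\<close>; here y =
  exp \<open>l\<close>. The slope 1 + \<open>th\<close> of this tangent can be tuned to the strength
  of the arrivals.\<close>

lemma entropy_tangent:
  fixes l th :: real
  shows "exp l * (1 + th) - exp th \<le> exp l * l"
proof -
  have "1 + (th - l) \<le> exp (th - l)" by (rule exp_ge_add_one_self)
  then have "exp l * (1 + (th - l)) \<le> exp l * exp (th - l)" by (intro mult_left_mono) auto
  also have "exp l * exp (th - l) = exp th" by (simp add: exp_add[symmetric])
  finally show ?thesis by (simp add: algebra_simps)
qed

section \<open>The potential of one class\<close>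

text \<open>
  \<^term>\<open>a j k\<close> is the logarithmic slope of the penalty $\Psi_{ik}$ in $x_{ij}$, \<^term>\<open>b1\<close> that of
  $\Psi_i$, and \<^term>\<open>A\<close> is the row of the optimal solution. \<^term>\<open>sg\<close> is false for a class with
  $c_i^1 = 0$, which has no fictitious penalty.
\<close>

locale class_potential =
  fixes J K :: "nat set" and a :: "nat \<Rightarrow> nat \<Rightarrow> real" and A :: "nat \<Rightarrow> real"
    and \<epsilon> \<beta>' b1 :: real and sg :: bool
  assumes finJ: "finite J" and finK: "finite K"
    and a_bounds: "\<And>j k. j \<in> J \<Longrightarrow> k \<in> K \<Longrightarrow> 0 \<le> a j k \<and> a j k \<le> \<epsilon>"
    and eps: "0 < \<epsilon>" "\<epsilon> < 1 / 4"
    and A_nonneg: "\<And>j. j \<in> J \<Longrightarrow> 0 \<le> A j"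
    and A_le: "sum A J \<le> 1"
    and mix: "\<And>k. k \<in> K \<Longrightarrow> (\<Sum>j\<in>J. A j * a j k) \<le> \<beta>'"
    and beta': "0 \<le> \<beta>'"
    and K_pos: "K \<noteq> {} \<Longrightarrow> 0 < sum A J"
    and b1_bounds: "0 \<le> b1" "b1 \<le> \<epsilon>"
    and b1_mix: "sg \<Longrightarrow> (1 - sum A J) * b1 \<le> \<beta>'"
    and sg_iff: "\<not> sg \<Longrightarrow> sum A J = 1"
begin

abbreviation "al \<equiv> sum A J"

definition "E1 = (exp \<epsilon> - 1) / \<epsilon>"
text \<open>An upper bound for the ratio of the minimal price to \<open>S\<close>. The minimum with
  \<epsilon> ensures \<kappa> \<le> \<epsilon>, so that the departure of a phantom obeys the same
  estimate as that of a request. For \<open>al = 0\<close> the quotient is 0 by convention, and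
  there are no resources to be priced.\<close>

definition "w = min \<epsilon> (\<beta>' / al)"
definition "\<kappa> = ln (1 + E1 * w)"

definition \<Psi> :: "(nat \<Rightarrow> nat) \<Rightarrow> nat \<Rightarrow> real" where
  "\<Psi> x k = exp (\<Sum>j\<in>J. real (x j) * a j k)"
definition S :: "(nat \<Rightarrow> nat) \<Rightarrow> real" where
  "S x = (\<Sum>k\<in>K. \<Psi> x k)"
definition price :: "(nat \<Rightarrow> nat) \<Rightarrow> nat \<Rightarrow> real" where
  "price x j = (\<Sum>k\<in>K. \<Psi> x k * a j k)"

text \<open>
  Of the \<^term>\<open>v + d\<close> fictitious requests, \<^term>\<open>d\<close> are phantoms. One phantom multiplies the network
  penalty by \<^term>\<open>exp \<kappa> = 1 + E1 * w\<close>, the largest factor by which an acceptance at minimal price can.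
\<close>

definition G :: "(nat \<Rightarrow> nat) \<Rightarrow> nat \<Rightarrow> nat \<Rightarrow> real" where
  "G x v d = S x * exp (\<kappa> * real d) + of_bool sg * exp (b1 * real v)"

definition V :: "real \<Rightarrow> real \<Rightarrow> (nat \<Rightarrow> nat) \<Rightarrow> nat \<Rightarrow> nat \<Rightarrow> real" where
  "V p q x v d = p * real d + q * G x v d"

text \<open>Without a fictitious penalty, an ordinary fictitious request would be free of charge;
  hence all of them have to be phantoms in that case.\<close>

definition splits :: "nat \<Rightarrow> nat set" where
  "splits y = (if sg then {0..y} else {y})"

definition h :: "real \<Rightarrow> real \<Rightarrow> (nat \<Rightarrow> nat) \<Rightarrow> nat \<Rightarrow> real" where
  "h p q x y = Min ((\<lambda>d. V p q x (y - d) d) ` splits y)"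

lemma finite_splits [simp]: "finite (splits y)" and splits_ne [simp]: "splits y \<noteq> {}"
  by (auto simp: splits_def)

lemma h_le: "d \<in> splits y \<Longrightarrow> h p q x y \<le> V p q x (y - d) d"
  unfolding h_def by (intro Min_le) auto

lemma h_eq: obtains d where "d \<in> splits y" "h p q x y = V p q x (y - d) d"
proof -
  have "h p q x y \<in> (\<lambda>d. V p q x (y - d) d) ` splits y"
    unfolding h_def by (intro Min_in) auto
  then show ?thesis using that by auto
qed

lemma E1_ge1: "1 \<le> E1"
  using exp_ge_add_one_self[of \<epsilon>] eps by (simp add: E1_def field_simps)

lemma al_nonneg: "0 \<le> al" by (intro sum_nonneg A_nonneg)

lemma w_bounds: "0 \<le> w" "w \<le> \<epsilon>" "al * w \<le> \<beta>'"
proof -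
  show "0 \<le> w" "w \<le> \<epsilon>" using eps beta' al_nonneg by (auto simp: w_def)
  show "al * w \<le> \<beta>'"
  proof (cases "al = 0")
    case False
    have "al * w \<le> al * (\<beta>' / al)" by (intro mult_left_mono al_nonneg) (simp add: w_def)
    then show ?thesis using False by simp
  qed (use beta' in simp)
qed

lemma mix_w: "k \<in> K \<Longrightarrow> (\<Sum>j\<in>J. A j * a j k) \<le> al * w"
proof -
  assume k: "k \<in> K"
  then have al: "0 < al" using K_pos by auto
  have "(\<Sum>j\<in>J. A j * a j k) \<le> (\<Sum>j\<in>J. A j * \<epsilon>)"
    using a_bounds k A_nonneg by (intro sum_mono mult_left_mono) auto
  then have 1: "(\<Sum>j\<in>J. A j * a j k) \<le> al * \<epsilon>" by (simp add: sum_distrib_right)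
  show ?thesis using 1 mix[OF k] al by (auto simp: w_def min_def)
qed

lemma exp_\<kappa>: "exp \<kappa> = 1 + E1 * w"
  using E1_ge1 w_bounds by (simp add: \<kappa>_def add_pos_nonneg)

lemma \<kappa>_bounds: "0 \<le> \<kappa>" "\<kappa> \<le> \<epsilon>"
proof -
  show "0 \<le> \<kappa>" using E1_ge1 w_bounds by (simp add: \<kappa>_def)
  have "E1 * w \<le> E1 * \<epsilon>" using E1_ge1 w_bounds by (intro mult_left_mono) auto
  also have "\<dots> = exp \<epsilon> - 1" using eps by (simp add: E1_def)
  finally have "exp \<kappa> \<le> exp \<epsilon>" by (simp add: exp_\<kappa>)
  then show "\<kappa> \<le> \<epsilon>" by simp
qed

lemma \<Psi>_pos [simp]: "0 < \<Psi> x k" by (simp add: \<Psi>_def)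
lemma S_nonneg [simp]: "0 \<le> S x" by (simp add: S_def sum_nonneg less_imp_le)
lemma S_exp_ge: "S x \<le> S x * exp (\<kappa> * real d)"
proof -
  have "S x * 1 \<le> S x * exp (\<kappa> * real d)" using \<kappa>_bounds by (intro mult_left_mono) auto
  then show ?thesis by simp
qed
lemma G_nonneg [simp]: "0 \<le> G x v d" by (simp add: G_def)

lemma \<Psi>_upd:
  assumes "j \<in> J"
  shows "\<Psi> (x(j := n)) k = \<Psi> x k * exp ((real n - real (x j)) * a j k)"
proof -
  have "(\<Sum>j'\<in>J. real ((x(j := n)) j') * a j' k) = real n * a j k + (\<Sum>j'\<in>J - {j}. real (x j') * a j' k)"
    using finJ assms by (subst sum.remove[of _ j]) (auto intro!: sum.cong)
  moreover have "(\<Sum>j'\<in>J. real (x j') * a j' k) = real (x j) * a j k + (\<Sum>j'\<in>J - {j}. real (x j') * a j' k)"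
    using finJ assms by (subst sum.remove[of _ j]) auto
  ultimately show ?thesis by (simp add: \<Psi>_def exp_add[symmetric] algebra_simps)
qed

lemma S_Suc:
  assumes "j \<in> J"
  shows "S (x(j := Suc (x j))) - S x \<le> E1 * price x j"
proof -
  have "S (x(j := Suc (x j))) - S x = (\<Sum>k\<in>K. \<Psi> x k * (exp (a j k) - 1))"
    by (simp add: S_def sum_subtractf[symmetric] \<Psi>_upd[OF assms] algebra_simps)
  also have "\<dots> \<le> (\<Sum>k\<in>K. \<Psi> x k * (E1 * a j k))"
    unfolding E1_def using a_bounds[OF assms] eps
    by (intro sum_mono mult_left_mono exp_minus_one_le) (auto intro: less_imp_le)
  finally show ?thesis by (simp add: price_def sum_distrib_left algebra_simps)
qed

text \<open>The minimal price is at most the \<open>A\<close>-average of the prices. After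
  exchanging the sums, each resource contributes at most \<open>al * w\<close> times its penalty,
  and \<open>al\<close> cancels.\<close>

lemma min_price_le:
  assumes j: "j \<in> J" and min: "\<And>j'. j' \<in> J \<Longrightarrow> price x j \<le> price x j'"
  shows "price x j \<le> w * S x"
proof (cases "K = {}")
  case True then show ?thesis unfolding price_def S_def by simp
next
  case False
  have "al * price x j = (\<Sum>j'\<in>J. A j' * price x j)" by (simp add: sum_distrib_right)
  also have "\<dots> \<le> (\<Sum>j'\<in>J. A j' * price x j')" using min A_nonneg by (intro sum_mono mult_left_mono)
  also have "\<dots> = (\<Sum>k\<in>K. \<Psi> x k * (\<Sum>j'\<in>J. A j' * a j' k))"
    unfolding price_def sum_distrib_left by (subst sum.swap) (simp add: algebra_simps)
  also have "\<dots> \<le> (\<Sum>k\<in>K. \<Psi> x k * (al * w))"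
    by (intro sum_mono mult_left_mono mix_w) (auto intro: less_imp_le)
  also have "\<dots> = al * (w * S x)" unfolding S_def sum_distrib_right[symmetric] by (simp add: mult_ac)
  finally show ?thesis using K_pos[OF False] by simp
qed

section \<open>Arrivals\<close>

text \<open>The benchmark given by the linear program: with weight \<open>al\<close> the bound for
  an acceptance or a new phantom, with weight \<open>1 - al\<close> the bound for an additional
  ordinary fictitious request.\<close>

definition arrival_bound :: "(nat \<Rightarrow> nat) \<Rightarrow> nat \<Rightarrow> nat \<Rightarrow> real" where
  "arrival_bound x v d = al * (E1 * w * (S x * exp (\<kappa> * real d)))
     + (1 - al) * (of_bool sg * (E1 * b1 * exp (b1 * real v)))"

text \<open>Both weighted slopes are at most \<beta>': \<open>al * w\<close> by the choice of
  \<open>w\<close>, and \<open>(1 - al) * b1\<close> by \<open>b1_mix\<close>.\<close>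

lemma arrival_bound_le: "arrival_bound x v d \<le> E1 * \<beta>' * G x v d"
proof -
  have "al * w * (E1 * (S x * exp (\<kappa> * real d))) \<le> \<beta>' * (E1 * (S x * exp (\<kappa> * real d)))"
    using w_bounds E1_ge1 by (intro mult_right_mono) auto
  moreover have "(1 - al) * (of_bool sg * (E1 * b1 * exp (b1 * real v)))
      \<le> \<beta>' * (E1 * (of_bool sg * exp (b1 * real v)))"
  proof (cases sg)
    case True
    have "(1 - al) * b1 * (E1 * exp (b1 * real v)) \<le> \<beta>' * (E1 * exp (b1 * real v))"
      using b1_mix[OF True] E1_ge1 by (intro mult_right_mono) auto
    then show ?thesis using True by (simp add: algebra_simps)
  qed (use beta' E1_ge1 in simp)
  ultimately show ?thesis by (simp add: arrival_bound_def G_def algebra_simps)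
qed

text \<open>Used to see that the cheaper of the two ways to charge an arrival costs no more than the
  average.\<close>

lemma convex_le:
  fixes X Y Z :: real
  assumes "Z \<le> X" "Z \<le> Y"
  shows "Z \<le> al * X + (1 - al) * Y"
proof -
  have "Z = al * Z + (1 - al) * Z" by (simp add: algebra_simps)
  also have "\<dots> \<le> al * X + (1 - al) * Y"
    using assms al_nonneg A_le by (intro add_mono mult_left_mono) auto
  finally show ?thesis .
qed

lemma exp_Suc_diff:
  assumes "0 \<le> q"
  shows "q * (exp (b1 * real (Suc v)) - exp (b1 * real v)) \<le> q * (E1 * b1 * exp (b1 * real v))"
proof -
  have "exp (b1 * real (Suc v)) - exp (b1 * real v) = exp (b1 * real v) * (exp b1 - 1)"
    by (simp add: exp_add[symmetric] algebra_simps)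
  also have "\<dots> \<le> exp (b1 * real v) * (E1 * b1)"
    unfolding E1_def using eps b1_bounds by (intro mult_left_mono exp_minus_one_le) auto
  finally show ?thesis using assms by (intro mult_left_mono) (auto simp: algebra_simps)
qed

lemma V_Suc_v:
  assumes "sg" "0 \<le> q" "arrival_bound x v d \<ge> E1 * b1 * exp (b1 * real v)"
  shows "V p q x (Suc v) d \<le> V p q x v d + q * arrival_bound x v d"
proof -
  have "V p q x (Suc v) d - V p q x v d = q * (exp (b1 * real (Suc v)) - exp (b1 * real v))"
    using assms(1) unfolding V_def G_def by (simp add: algebra_simps)
  also have "\<dots> \<le> q * (E1 * b1 * exp (b1 * real v))" by (rule exp_Suc_diff[OF assms(2)])
  also have "\<dots> \<le> q * arrival_bound x v d" using assms by (intro mult_left_mono)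
  finally show ?thesis by simp
qed

lemma V_accept:
  assumes j: "j \<in> J" and q: "0 \<le> q"
    and le: "price x j * exp (\<kappa> * real d) * E1 \<le> arrival_bound x v d"
  shows "V p q (x(j := Suc (x j))) v d \<le> V p q x v d + q * arrival_bound x v d"
proof -
  have "V p q (x(j := Suc (x j))) v d - V p q x v d = q * ((S (x(j := Suc (x j))) - S x) * exp (\<kappa> * real d))"
    by (simp add: V_def G_def algebra_simps)
  also have "\<dots> \<le> q * ((E1 * price x j) * exp (\<kappa> * real d))"
    using S_Suc[OF j] q by (intro mult_left_mono mult_right_mono) auto
  also have "\<dots> \<le> q * arrival_bound x v d" using le q by (intro mult_left_mono) (auto simp: algebra_simps)
  finally show ?thesis by simp
qed

text \<open>The inequalities that a decision of the policy guarantees for its own class. The flag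
  \<open>bl\<close> excuses a rejection of any kind; without it a class with \<open>sg\<close> false
  never rejects.\<close>

definition admissible :: "(nat \<Rightarrow> nat) \<Rightarrow> nat \<Rightarrow> bool \<Rightarrow> nat option \<Rightarrow> bool" where
  "admissible x y bl dl \<longleftrightarrow>
     (case dl of
        Some j \<Rightarrow> j \<in> J \<and> (\<forall>j'\<in>J. price x j \<le> price x j') \<and> (sg \<longrightarrow> price x j \<le> b1 * exp (b1 * real y))
      | None \<Rightarrow> bl \<or> (sg \<and> (\<forall>j\<in>J. b1 * exp (b1 * real y) < price x j)))"

text \<open>The request is added to \<open>v\<close> whenever this costs at most the average.
  Otherwise it must have been blocked; it becomes a phantom at the charge \<open>p\<close>, and then
  the phantom is the option below the average.\<close>

lemma arrival_reject:
  assumes q: "0 \<le> q" and p: "0 \<le> p" and d: "d \<in> splits y" and adm: "admissible x y bl None"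
  shows "h p q x (Suc y) \<le> V p q x (y - d) d + p * of_bool bl + q * arrival_bound x (y - d) d"
proof -
  have dy: "d \<le> y" using d by (auto simp: splits_def split: if_splits)
  have reject: ?thesis if sg: "sg" and le: "E1 * b1 * exp (b1 * real (y - d)) \<le> arrival_bound x (y - d) d"
  proof -
    have "h p q x (Suc y) \<le> V p q x (Suc y - d) d"
      using dy sg by (intro h_le) (unfold splits_def, auto)
    also have "\<dots> = V p q x (Suc (y - d)) d" using dy by (simp add: Suc_diff_le)
    also have "\<dots> \<le> V p q x (y - d) d + q * arrival_bound x (y - d) d" by (rule V_Suc_v[OF sg q le])
    finally show ?thesis using p by (auto simp: of_bool_def)
  qed
  show ?thesis
  proof (cases "sg \<and> E1 * b1 * exp (b1 * real (y - d)) \<le> arrival_bound x (y - d) d")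
    case True then show ?thesis using reject by blast
  next
    case False
    \<comment> \<open>In a regular rejection all prices exceed the fictitious price at
      \<open>y\<close>, which is at least the one at \<open>y - d\<close>, and phantoms only enlarge
      the network penalty. So adding to \<open>v\<close> would have been the cheaper option after
      all.\<close>
    have bl: bl
    proof (rule ccontr)
      assume "\<not> bl"
      then have sg: sg and cheap: "\<And>j. j \<in> J \<Longrightarrow> b1 * exp (b1 * real y) < price x j"
        using adm by (auto simp: admissible_def)
      have mono: "b1 * exp (b1 * real (y - d)) \<le> b1 * exp (b1 * real y)"
        using b1_bounds by (intro mult_left_mono) (auto intro!: mult_left_mono)
      have "E1 * b1 * exp (b1 * real (y - d)) \<le> arrival_bound x (y - d) d"
      \<comment> \<open>With no allocations, \<open>al\<close> is 0 and the average consists of its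
        second term.\<close>
      proof (cases "J = {}")
        case True then show ?thesis using sg unfolding arrival_bound_def by simp
      next
        case False
        then obtain j where j: "j \<in> J" "\<And>j'. j' \<in> J \<Longrightarrow> price x j \<le> price x j'"
          using finJ by (metis arg_min_if_finite(1) arg_min_least)
        have "b1 * exp (b1 * real (y - d)) \<le> price x j" using mono cheap[OF j(1)] by simp
        also have "\<dots> \<le> w * S x" by (rule min_price_le[OF j])
        also have "\<dots> \<le> w * (S x * exp (\<kappa> * real d))"
          by (intro mult_left_mono S_exp_ge w_bounds)
        finally have "E1 * (b1 * exp (b1 * real (y - d))) \<le> E1 * (w * (S x * exp (\<kappa> * real d)))"
          using E1_ge1 by (intro mult_left_mono) auto
        then show ?thesis unfolding arrival_bound_def using sg by (intro convex_le) (auto simp: algebra_simps)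
      qed
      then show False using False sg by simp
    qed
    have le: "E1 * w * (S x * exp (\<kappa> * real d)) \<le> arrival_bound x (y - d) d"
    proof (cases sg)
      case True
      have "E1 * w * (S x * exp (\<kappa> * real d)) \<le> E1 * b1 * exp (b1 * real (y - d))"
      proof (rule ccontr)
        assume "\<not> ?thesis"
        then have "E1 * b1 * exp (b1 * real (y - d)) \<le> arrival_bound x (y - d) d"
          unfolding arrival_bound_def using True by (intro convex_le) auto
        then show False using False True by simp
      qed
      then show ?thesis unfolding arrival_bound_def using True by (intro convex_le) auto
    qed (use sg_iff in \<open>unfold arrival_bound_def, simp\<close>)
    have "h p q x (Suc y) \<le> V p q x (Suc y - Suc d) (Suc d)"
      using d by (intro h_le) (auto simp: splits_def split: if_splits)
    also have "\<dots> = V p q x (y - d) d + p + q * (E1 * w * (S x * exp (\<kappa> * real d)))"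
      by (simp add: V_def G_def distrib_left exp_add exp_\<kappa> algebra_simps)
    also have "\<dots> \<le> V p q x (y - d) d + p + q * arrival_bound x (y - d) d"
      using le q by (intro add_mono mult_left_mono) auto
    finally show ?thesis using bl by simp
  qed
qed

text \<open>The policy compares with the fictitious price at \<open>y\<close>, whereas the potential
  sees only \<open>v = y - d\<close> and a penalty inflated by the phantoms; an acceptance can
  therefore look too expensive. In this case there is a phantom whose place in \<open>S\<close> the
  accepted request can take, and moving the phantom to \<open>v\<close> is the option below the
  average.\<close>

lemma arrival_accept:
  assumes q: "0 \<le> q" and p: "0 \<le> p" and d: "d \<in> splits y" and adm: "admissible x y bl (Some j)"
  shows "h p q (x(j := Suc (x j))) y \<le> V p q x (y - d) d + q * arrival_bound x (y - d) d"
proof -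
  have dy: "d \<le> y" using d by (auto simp: splits_def split: if_splits)
  have j: "j \<in> J" "\<And>j'. j' \<in> J \<Longrightarrow> price x j \<le> price x j'"
    and cheap: "sg \<Longrightarrow> price x j \<le> b1 * exp (b1 * real y)"
    using adm unfolding admissible_def by simp_all
  have pw: "price x j * exp (\<kappa> * real d) * E1 \<le> E1 * w * (S x * exp (\<kappa> * real d))"
    using mult_right_mono[OF min_price_le[OF j], of "exp (\<kappa> * real d) * E1"] E1_ge1
    by (simp add: algebra_simps)
  show ?thesis
  proof (cases "price x j * exp (\<kappa> * real d) * E1 \<le> arrival_bound x (y - d) d")
    case True
    then show ?thesis using V_accept[OF j(1) q True, of p] h_le[OF d] by (meson order_trans)
  next
    case False
    have sg: sg
    proof (rule ccontr)
      assume "\<not> sg" then show False using False pw sg_iff unfolding arrival_bound_def by simp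
    qed
    have gt: "E1 * b1 * exp (b1 * real (y - d)) < price x j * exp (\<kappa> * real d) * E1"
    proof (rule ccontr)
      assume "\<not> ?thesis"
      then have "price x j * exp (\<kappa> * real d) * E1 \<le> arrival_bound x (y - d) d"
        unfolding arrival_bound_def using pw sg by (intro convex_le) auto
      then show False using False by simp
    qed
    \<comment> \<open>Without phantoms the potential compares the same two prices as the policy, so
      the acceptance could not look too expensive.\<close>
    have d0: "0 < d"
    proof (rule ccontr)
      assume "\<not> 0 < d"
      then have "E1 * (b1 * exp (b1 * real y)) < E1 * price x j" using gt by (simp add: algebra_simps)
      then show False using cheap[OF sg] E1_ge1 by (simp add: mult_less_cancel_left)
    qed
    let ?x = "x(j := Suc (x j))" and ?v = "y - d"
    have le: "E1 * b1 * exp (b1 * real ?v) \<le> arrival_bound x ?v d"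
      unfolding arrival_bound_def using gt order_trans[OF less_imp_le[OF gt] pw] sg by (intro convex_le) auto
    \<comment> \<open>An acceptance at minimal price multiplies \<open>S\<close> by at most exp
      \<kappa>, exactly the factor which the removed phantom gives back. Phantoms act
      multiplicatively so that this holds in every state.\<close>
    have S: "S ?x * exp (\<kappa> * real (d - 1)) \<le> S x * exp (\<kappa> * real d)"
    proof -
      have "S ?x \<le> S x + E1 * price x j" using S_Suc[OF j(1)] by (simp add: algebra_simps)
      also have "\<dots> \<le> S x + E1 * (w * S x)"
        using min_price_le[OF j] E1_ge1 by (intro add_mono mult_left_mono) auto
      also have "\<dots> = S x * exp \<kappa>" by (simp add: exp_\<kappa> algebra_simps)
      finally have "S ?x * exp (\<kappa> * real (d - 1)) \<le> S x * exp \<kappa> * exp (\<kappa> * real (d - 1))"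
        by (intro mult_right_mono) auto
      also have "\<dots> = S x * exp (\<kappa> * real d)"
        using d0 by (simp add: exp_add[symmetric] algebra_simps of_nat_diff)
      finally show ?thesis .
    qed
    have "h p q ?x y \<le> V p q ?x (y - (d - 1)) (d - 1)"
      using dy sg by (intro h_le) (unfold splits_def, auto)
    also have "y - (d - 1) = Suc ?v" using d0 dy by simp
    also have "V p q ?x (Suc ?v) (d - 1) \<le> V p q x (Suc ?v) d"
    proof -
      have "p * real (d - 1) \<le> p * real d" using p by (intro mult_left_mono) auto
      then show ?thesis using mult_left_mono[OF S q] by (simp add: V_def G_def algebra_simps)
    qed
    also have "\<dots> \<le> V p q x ?v d + q * arrival_bound x ?v d" by (rule V_Suc_v[OF sg q le])
    finally show ?thesis .
  qed
qed

section \<open>Departures\<close>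

text \<open>The inner sum on the right is the logarithm of \<Psi>, so departures decrease
  \<open>S\<close> by the sum of \<Psi> ln \<Psi>, up to the factor 1 - \<epsilon>/2 from the
  second-order bound.\<close>

lemma S_depart:
  "(\<Sum>j\<in>J. real (x j) * (S (x(j := x j - 1)) - S x))
     \<le> - (1 - \<epsilon> / 2) * (\<Sum>k\<in>K. \<Psi> x k * (\<Sum>j\<in>J. real (x j) * a j k))"
proof -
  have "(\<Sum>j\<in>J. real (x j) * (S (x(j := x j - 1)) - S x))
     \<le> (\<Sum>j\<in>J. \<Sum>k\<in>K. real (x j) * (\<Psi> x k * (- (1 - \<epsilon> / 2) * a j k)))"
  proof (rule sum_mono)
    fix j assume j: "j \<in> J"
    show "real (x j) * (S (x(j := x j - 1)) - S x) \<le> (\<Sum>k\<in>K. real (x j) * (\<Psi> x k * (- (1 - \<epsilon> / 2) * a j k)))"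
    proof (cases "x j = 0")
      case False
      have "S (x(j := x j - 1)) - S x = (\<Sum>k\<in>K. \<Psi> x k * (exp (- a j k) - 1))"
        using False by (simp add: S_def sum_subtractf[symmetric] \<Psi>_upd[OF j] of_nat_diff algebra_simps)
      also have "\<dots> \<le> (\<Sum>k\<in>K. \<Psi> x k * (- (1 - \<epsilon> / 2) * a j k))"
        using a_bounds[OF j] by (intro sum_mono mult_left_mono one_minus_exp_ge) (auto intro: less_imp_le)
      finally show ?thesis unfolding sum_distrib_left[symmetric] by (intro mult_left_mono) auto
    qed simp
  qed
  also have "\<dots> = - (1 - \<epsilon> / 2) * (\<Sum>k\<in>K. \<Psi> x k * (\<Sum>j\<in>J. real (x j) * a j k))"
    unfolding sum_distrib_left by (subst sum.swap) (intro sum.cong, auto simp: algebra_simps)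
  finally show ?thesis .
qed

lemma exp_depart:
  assumes "0 \<le> c" "c \<le> \<epsilon>"
  shows "real n * (exp (c * real (n - 1)) - exp (c * real n)) \<le> - (1 - \<epsilon> / 2) * (exp (c * real n) * (c * real n))"
proof (cases n)
  case (Suc m)
  have "exp (c * real m) - exp (c * real n) = exp (c * real n) * (exp (- c) - 1)"
    using Suc by (simp add: exp_add[symmetric] algebra_simps)
  also have "\<dots> \<le> exp (c * real n) * (- (1 - \<epsilon> / 2) * c)"
    using assms by (intro mult_left_mono one_minus_exp_ge) auto
  finally have "real n * (exp (c * real m) - exp (c * real n)) \<le> real n * (exp (c * real n) * (- (1 - \<epsilon> / 2) * c))"
    by (intro mult_left_mono) auto
  then show ?thesis using Suc by (simp add: algebra_simps)
qed simp

text \<open>The total decrease is of the form \<Psi> ln \<Psi> for each penalty in \<open>G\<close>,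
  phantom factors included, and \<open>entropy_tangent\<close> linearises it at an arbitrary level
  \<open>th\<close>.\<close>

lemma departures:
  assumes q: "0 \<le> q" and p: "0 \<le> p" and d: "d \<in> splits y"
  shows "(\<Sum>j\<in>J. real (x j) * (h p q (x(j := x j - 1)) y - V p q x (y - d) d))
       + real y * (h p q x (y - 1) - V p q x (y - d) d)
     \<le> - (p * real d) - q * (1 - \<epsilon> / 2) * ((1 + th) * G x (y - d) d - (real (card K) + of_bool sg) * exp th)"
proof -
  define v where "v = y - d"
  let ?e = "exp (\<kappa> * real d)" and ?r = "1 - \<epsilon> / 2"
  have dy: "d \<le> y" using d by (auto simp: splits_def split: if_splits)
  have r: "0 \<le> ?r" using eps by simp
  have 1: "(\<Sum>j\<in>J. real (x j) * (h p q (x(j := x j - 1)) y - V p q x v d))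
      \<le> q * ?e * (- ?r * (\<Sum>k\<in>K. \<Psi> x k * (\<Sum>j\<in>J. real (x j) * a j k)))"
  proof -
    have "(\<Sum>j\<in>J. real (x j) * (h p q (x(j := x j - 1)) y - V p q x v d))
        \<le> (\<Sum>j\<in>J. real (x j) * (V p q (x(j := x j - 1)) v d - V p q x v d))"
      unfolding v_def using h_le[OF d] by (intro sum_mono mult_left_mono) auto
    also have "\<dots> = q * ?e * (\<Sum>j\<in>J. real (x j) * (S (x(j := x j - 1)) - S x))"
      unfolding sum_distrib_left by (intro sum.cong) (auto simp: V_def G_def algebra_simps)
    also have "\<dots> \<le> q * ?e * (- ?r * (\<Sum>k\<in>K. \<Psi> x k * (\<Sum>j\<in>J. real (x j) * a j k)))"
      using q by (intro mult_left_mono S_depart) auto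
    finally show ?thesis .
  qed
  \<comment> \<open>The potential does not record which fictitious request is a phantom. Of the
    departure rate \<open>y\<close>, the share \<open>v\<close> is charged to ordinary requests and
    the share \<open>d\<close> to phantoms, each with its own split of \<open>y - 1\<close>.\<close>
  have 2: "real y * (h p q x (y - 1) - V p q x v d)
      \<le> real v * (V p q x (v - 1) d - V p q x v d) + real d * (V p q x v (d - 1) - V p q x v d)"
  proof -
    have a: "real v * (h p q x (y - 1) - V p q x v d) \<le> real v * (V p q x (v - 1) d - V p q x v d)"
    proof (cases "v = 0")
      case False
      then have sg: sg using d by (auto simp: v_def splits_def split: if_splits)
      have "h p q x (y - 1) \<le> V p q x (y - 1 - d) d"
        using False sg by (intro h_le) (unfold splits_def v_def, auto)
      moreover have "y - 1 - d = v - 1" by (simp add: v_def)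
      ultimately show ?thesis by (intro mult_left_mono) auto
    qed simp
    have b: "real d * (h p q x (y - 1) - V p q x v d) \<le> real d * (V p q x v (d - 1) - V p q x v d)"
    proof (cases "d = 0")
      case False
      have "h p q x (y - 1) \<le> V p q x (y - 1 - (d - 1)) (d - 1)"
        using False d by (intro h_le) (auto simp: splits_def split: if_splits)
      moreover have "y - 1 - (d - 1) = v" using False by (simp add: v_def)
      ultimately show ?thesis by (intro mult_left_mono) auto
    qed simp
    have "real y = real v + real d" using dy by (simp add: v_def)
    then show ?thesis using a b by (simp add: algebra_simps)
  qed
  have 3: "real v * (V p q x (v - 1) d - V p q x v d) \<le> q * (of_bool sg * (- ?r * (exp (b1 * real v) * (b1 * real v))))"
  proof -
    have "real v * (V p q x (v - 1) d - V p q x v d)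
        = (q * of_bool sg) * (real v * (exp (b1 * real (v - 1)) - exp (b1 * real v)))"
      by (simp add: V_def G_def algebra_simps)
    also have "\<dots> \<le> (q * of_bool sg) * (- ?r * (exp (b1 * real v) * (b1 * real v)))"
      using q b1_bounds by (intro mult_left_mono exp_depart) auto
    finally show ?thesis by (simp add: algebra_simps)
  qed
  have 4: "real d * (V p q x v (d - 1) - V p q x v d) \<le> - (p * real d) + q * S x * (- ?r * (?e * (\<kappa> * real d)))"
  proof -
    have "real d * (V p q x v (d - 1) - V p q x v d)
        = real d * (p * (real (d - 1) - real d)) + q * S x * (real d * (exp (\<kappa> * real (d - 1)) - ?e))"
      by (simp add: V_def G_def algebra_simps)
    also have "real d * (p * (real (d - 1) - real d)) = - (p * real d)"
      by (cases d) (auto simp: algebra_simps)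
    also have "q * S x * (real d * (exp (\<kappa> * real (d - 1)) - ?e)) \<le> q * S x * (- ?r * (?e * (\<kappa> * real d)))"
      using q \<kappa>_bounds by (intro mult_left_mono exp_depart) auto
    finally show ?thesis by simp
  qed
  \<comment> \<open>For each resource the tangent is applied to the logarithm of its penalty times
    the phantom factor.\<close>
  have 5: "(1 + th) * (S x * ?e) - real (card K) * exp th
      \<le> ?e * (\<Sum>k\<in>K. \<Psi> x k * (\<Sum>j\<in>J. real (x j) * a j k)) + S x * (?e * (\<kappa> * real d))"
  proof -
    have "(1 + th) * (S x * ?e) - real (card K) * exp th = (\<Sum>k\<in>K. \<Psi> x k * ?e * (1 + th) - exp th)"
      unfolding sum_subtractf sum_distrib_right[symmetric] S_def[symmetric] by (simp add: mult_ac)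
    also have "\<dots> \<le> (\<Sum>k\<in>K. \<Psi> x k * ?e * ((\<Sum>j\<in>J. real (x j) * a j k) + \<kappa> * real d))"
    proof (rule sum_mono)
      fix k
      show "\<Psi> x k * ?e * (1 + th) - exp th \<le> \<Psi> x k * ?e * ((\<Sum>j\<in>J. real (x j) * a j k) + \<kappa> * real d)"
        using entropy_tangent[of "(\<Sum>j\<in>J. real (x j) * a j k) + \<kappa> * real d" th]
        by (simp add: \<Psi>_def exp_add)
    qed
    also have "\<dots> = ?e * (\<Sum>k\<in>K. \<Psi> x k * (\<Sum>j\<in>J. real (x j) * a j k)) + S x * (?e * (\<kappa> * real d))"
      unfolding S_def sum_distrib_left[of ?e] sum_distrib_right[of _ K] sum.distrib[symmetric]
      by (intro sum.cong refl) (simp add: algebra_simps del: mult_cancel_left mult_cancel_right)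
    finally show ?thesis .
  qed
  have 6: "of_bool sg * ((1 + th) * exp (b1 * real v) - exp th) \<le> of_bool sg * (exp (b1 * real v) * (b1 * real v))"
    using entropy_tangent[of "b1 * real v" th] by (intro mult_left_mono) (auto simp: algebra_simps)
  define T1 where "T1 = ?e * (\<Sum>k\<in>K. \<Psi> x k * (\<Sum>j\<in>J. real (x j) * a j k))"
  define T2 where "T2 = S x * (?e * (\<kappa> * real d))"
  define T3 where "T3 = of_bool sg * (exp (b1 * real v) * (b1 * real v))"
  have expand: "(1 + t) * (X + o' * e) - (k + o') * z = ((1 + t) * X - k * z) + o' * ((1 + t) * e - z)"
    for t X o' e k z :: real by (simp add: algebra_simps)
  have "(1 + th) * G x v d - (real (card K) + of_bool sg) * exp th \<le> T1 + T2 + T3"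
    unfolding T1_def T2_def T3_def G_def expand by (rule add_mono[OF 5 6])
  from mult_left_mono[OF this mult_nonneg_nonneg[OF q r]]
  have 7: "q * ?r * ((1 + th) * G x v d - (real (card K) + of_bool sg) * exp th)
      \<le> q * ?r * (T1 + T2 + T3)" .
  have collect: "q' * e * (- r * B) + (q' * (o' * (- r * E)) + (- P + q' * X * (- r * Z)))
     = - P - q' * r * (e * B + X * Z + o' * E)" for q' e r B o' E P X Z :: real
    by (simp add: algebra_simps)
  have 8: "q * ?e * (- ?r * (\<Sum>k\<in>K. \<Psi> x k * (\<Sum>j\<in>J. real (x j) * a j k)))
     + (q * (of_bool sg * (- ?r * (exp (b1 * real v) * (b1 * real v))))
       + (- (p * real d) + q * S x * (- ?r * (?e * (\<kappa> * real d)))))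
     = - (p * real d) - q * ?r * (T1 + T2 + T3)"
    unfolding T1_def T2_def T3_def by (rule collect)
  note add_mono[OF 1 order_trans[OF 2 add_mono[OF 3 4]]]
  also note 8
  also have "- (p * real d) - q * ?r * (T1 + T2 + T3)
      \<le> - (p * real d) - q * ?r * ((1 + th) * G x v d - (real (card K) + of_bool sg) * exp th)"
    by (rule diff_left_mono[OF 7])
  finally show ?thesis unfolding v_def .
qed

section \<open>Initial value, growth, and the quantities controlled by the potential\<close>

text \<open>Initially there are no phantoms: all fictitious requests are put into \<open>v\<close>,
  and each penalty is at most exp \<open>th\<close>.\<close>

lemma initial:
  assumes q: "0 \<le> q" and y: "\<not> sg \<Longrightarrow> y = 0" and th: "0 \<le> th" "b1 * real y \<le> th"
  shows "h p q (\<lambda>_. 0) y \<le> q * (real (card K) + of_bool sg) * exp th"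
proof -
  have th1: "1 \<le> exp th" using th by simp
  have "h p q (\<lambda>_. 0) y \<le> V p q (\<lambda>_. 0) (y - 0) 0"
    using y by (intro h_le) (unfold splits_def, auto)
  also have "\<dots> = q * (real (card K) * 1 + of_bool sg * exp (b1 * real y))"
    by (simp add: V_def G_def S_def \<Psi>_def)
  also have "\<dots> \<le> q * (real (card K) * exp th + of_bool sg * exp th)"
    using th th1 q by (intro mult_left_mono add_mono) auto
  finally show ?thesis by (simp add: algebra_simps)
qed

lemma h_nonneg: assumes "0 \<le> p" "0 \<le> q" shows "0 \<le> h p q x y"
proof -
  obtain d where "h p q x y = V p q x (y - d) d" by (rule h_eq)
  then show ?thesis using assms by (simp add: V_def)
qed

lemma S_le_h: "S x \<le> h 0 1 x y"
proof -
  obtain d where d: "h 0 1 x y = V 0 1 x (y - d) d" by (rule h_eq)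
  have "S x \<le> S x * exp (\<kappa> * real d)" by (rule S_exp_ge)
  also have "\<dots> \<le> V 0 1 x (y - d) d" by (simp add: V_def G_def)
  finally show ?thesis using d by simp
qed

text \<open>The tangent of the logarithm at \<open>m\<close> gives b1 v \<le> ln m + exp(b1 v) / m -
  1, and phantoms are counted by p = 1. With \<open>m\<close> a bound for the expected penalty, this
  plays the role of Jensen's inequality for the logarithm.\<close>

lemma y_le_h:
  assumes q: "0 < q" and m: "0 < m" and qb: "q * b1 * m = 1" and sg: sg
  shows "real y \<le> h 1 q x y + (ln m - 1) / b1"
proof -
  obtain d where d: "d \<in> splits y" "h 1 q x y = V 1 q x (y - d) d" by (rule h_eq)
  have dy: "d \<le> y" using d by (auto simp: splits_def split: if_splits)
  have b1: "0 < b1" using qb b1_bounds by (cases "b1 = 0") auto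
  let ?E = "exp (b1 * real (y - d))"
  have "?E / m \<ge> 1 + ln (?E / m)" using m ln_le_minus_one[of "?E / m"] by simp
  also have "ln (?E / m) = b1 * real (y - d) - ln m" using m by (simp add: ln_div)
  finally have "real (y - d) \<le> (?E / m + ln m - 1) / b1" using b1 by (simp add: field_simps)
  also have "\<dots> = q * ?E + (ln m - 1) / b1" using b1 m qb by (simp add: field_simps)
  also have "\<dots> \<le> q * G x (y - d) d + (ln m - 1) / b1"
    using q sg unfolding G_def by (simp add: mult_left_mono)
  finally show ?thesis using d dy by (simp add: V_def of_nat_diff)
qed

lemma y_le_h0: "\<not> sg \<Longrightarrow> real y \<le> h 1 0 x y"
  by (rule h_eq[of y 1 0 x]) (unfold splits_def V_def, auto)

text \<open>The exponential growth condition under which Dynkin's formula is proved.\<close>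

lemma h_growth:
  assumes p: "0 \<le> p" and q: "0 \<le> q"
  shows "h p q x y \<le> (p + q * (real (card K) + 1)) * exp (real (sum x J) + real y)"
proof -
  have "\<Psi> x k \<le> exp (real (sum x J))" if "k \<in> K" for k
  proof -
    have "(\<Sum>j\<in>J. real (x j) * a j k) \<le> (\<Sum>j\<in>J. real (x j) * 1)"
      using a_bounds that eps by (intro sum_mono mult_left_mono) fastforce+
    then show ?thesis by (simp add: \<Psi>_def)
  qed
  then have S: "S x \<le> real (card K) * exp (real (sum x J))"
    unfolding S_def using sum_bounded_above[of K "\<Psi> x"] by simp
  have "h p q x y \<le> V p q x (y - y) y" by (intro h_le) (auto simp: splits_def)
  also have "\<dots> \<le> p * exp (real (sum x J) + real y)
      + q * (real (card K) * exp (real (sum x J)) * exp (real y) + 1 * exp (real (sum x J) + real y))"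
  proof -
    have 1: "real y \<le> exp (real (sum x J) + real y)"
      using exp_ge_add_one_self[of "real (sum x J) + real y"] by linarith
    have "\<kappa> * real y \<le> 1 * real y" using \<kappa>_bounds eps by (intro mult_right_mono) auto
    then have 2: "S x * exp (\<kappa> * real y) \<le> real (card K) * exp (real (sum x J)) * exp (real y)"
      by (intro mult_mono S) auto
    have "0 \<le> real (sum x J) + real y" by (intro add_nonneg_nonneg of_nat_0_le_iff)
    then have "(1::real) \<le> exp (real (sum x J) + real y)" by (simp only: one_le_exp_iff)
    then have 3: "of_bool sg * exp (b1 * real (y - y)) \<le> exp (real (sum x J) + real y)"
      by (auto simp: of_bool_def simp del: one_le_exp_iff)
    show ?thesis unfolding V_def G_def using 1 2 3 p q
      by (intro add_mono mult_left_mono) auto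
  qed
  also have "\<dots> = (p + q * (real (card K) + 1)) * exp (real (sum x J) + real y)"
    by (simp add: exp_add algebra_simps)
  finally show ?thesis .
qed

text \<open>Fix the split that is optimal in the current state; after a jump the potential is at
  most its value at the adjusted split. The equation for \<open>th\<close> makes the arrival term
  cancel the part \<open>th * G\<close> of the departure term, which leaves relaxation at rate \<mu>
  (1 - \<epsilon>/2).\<close>

lemma drift:
  assumes q: "0 \<le> q" and p: "0 \<le> p" and adm: "admissible x y bl dl"
    and lam: "0 \<le> lam" and mu: "0 \<le> \<mu>"
    and th: "E1 * \<beta>' * lam = \<mu> * (1 - \<epsilon> / 2) * th"
  shows "lam * ((case dl of None \<Rightarrow> h p q x (Suc y) | Some j \<Rightarrow> h p q (x(j := Suc (x j))) y) - h p q x y)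
      + \<mu> * ((\<Sum>j\<in>J. real (x j) * (h p q (x(j := x j - 1)) y - h p q x y))
             + real y * (h p q x (y - 1) - h p q x y))
     \<le> p * lam * of_bool bl - \<mu> * (1 - \<epsilon> / 2) * (h p q x y - q * (real (card K) + of_bool sg) * exp th)"
proof -
  obtain d where d: "d \<in> splits y" "h p q x y = V p q x (y - d) d" by (rule h_eq)
  define v where "v = y - d"
  define B where "B = (real (card K) + of_bool sg) * exp th"
  have "(case dl of None \<Rightarrow> h p q x (Suc y) | Some j \<Rightarrow> h p q (x(j := Suc (x j))) y) - h p q x y
      \<le> p * of_bool bl + q * arrival_bound x v d"
  proof (cases dl)
    case None
    then show ?thesis using arrival_reject[OF q p d(1), of x bl] adm d(2) by (simp add: v_def)
  next
    case (Some j)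
    have "0 \<le> p * of_bool bl" using p by simp
    then show ?thesis using arrival_accept[OF q p d(1), of x bl j] adm d(2) Some by (simp add: v_def)
  qed
  also have "\<dots> \<le> p * of_bool bl + q * (E1 * \<beta>' * G x v d)"
    using q by (intro add_left_mono mult_left_mono arrival_bound_le)
  finally have 1: "lam * ((case dl of None \<Rightarrow> h p q x (Suc y) | Some j \<Rightarrow> h p q (x(j := Suc (x j))) y) - h p q x y)
      \<le> lam * (p * of_bool bl + q * (E1 * \<beta>' * G x v d))" using lam by (intro mult_left_mono)
  have 2: "\<mu> * ((\<Sum>j\<in>J. real (x j) * (h p q (x(j := x j - 1)) y - h p q x y))
             + real y * (h p q x (y - 1) - h p q x y))
      \<le> \<mu> * (- (p * real d) - q * (1 - \<epsilon> / 2) * ((1 + th) * G x v d - B))"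
    using departures[OF q p d(1), of x th] mu unfolding d(2) v_def B_def by (intro mult_left_mono)
  have 3: "lam * (p * of_bool bl + q * (E1 * \<beta>' * G x v d))
      + \<mu> * (- (p * real d) - q * (1 - \<epsilon> / 2) * ((1 + th) * G x v d - B))
      = p * lam * of_bool bl - \<mu> * p * real d - \<mu> * (1 - \<epsilon> / 2) * (q * G x v d - q * B)
        + (E1 * \<beta>' * lam - \<mu> * (1 - \<epsilon> / 2) * th) * (q * G x v d)"
    by (simp add: algebra_simps)
  \<comment> \<open>The charge for phantoms decays at the full rate \<mu>; it is weakened to the
    rate of the penalties, so that the whole potential relaxes at one rate.\<close>
  have "(1 - \<epsilon> / 2) * (\<mu> * p * real d) \<le> 1 * (\<mu> * p * real d)"
    using mu p eps by (intro mult_right_mono) auto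
  then have 4: "- \<mu> * p * real d \<le> - (\<mu> * (1 - \<epsilon> / 2) * (p * real d))"
    by (simp add: algebra_simps)
  have 5: "\<mu> * (1 - \<epsilon> / 2) * (h p q x y - q * B) = \<mu> * (1 - \<epsilon> / 2) * (p * real d)
     + \<mu> * (1 - \<epsilon> / 2) * (q * G x v d - q * B)"
    unfolding d(2) V_def v_def by (simp add: algebra_simps)
  have 6: "q * (real (card K) + of_bool sg) * exp th = q * B" by (simp add: B_def)
  have 7: "(E1 * \<beta>' * lam - \<mu> * (1 - \<epsilon> / 2) * th) * (q * G x v d) = 0" using th by simp
  note add_mono[OF 1 2]
  also note 3
  also have "p * lam * of_bool bl - \<mu> * p * real d - \<mu> * (1 - \<epsilon> / 2) * (q * G x v d - q * B)
        + (E1 * \<beta>' * lam - \<mu> * (1 - \<epsilon> / 2) * th) * (q * G x v d)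
      \<le> p * lam * of_bool bl - \<mu> * (1 - \<epsilon> / 2) * (h p q x y - q * B)"
    unfolding 5 7 using 4 by simp
  finally show ?thesis unfolding 6 .
qed

end

section \<open>Jump sums of a piecewise constant path\<close>

text \<open>\<phi> is a left-continuous path, constant between the times in \<open>J\<close>, and
  \<psi> gives its right limits there. Induction on the number of jumps, removing the last
  one.\<close>

lemma telescoping_jumps:
  fixes \<phi> \<psi> :: "real \<Rightarrow> real"
  assumes "finite J" "J \<subseteq> {0<..<t}" "0 < t"
    and step: "\<And>r v. r \<in> J \<Longrightarrow> r < v \<Longrightarrow> v \<le> t \<Longrightarrow> J \<inter> {r<..<v} = {} \<Longrightarrow> \<phi> v = \<psi> r"
    and base: "\<And>v. 0 < v \<Longrightarrow> v \<le> t \<Longrightarrow> J \<inter> {0<..<v} = {} \<Longrightarrow> \<phi> v = \<phi>0"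
  shows "\<phi> t + sum \<phi> J = \<phi>0 + sum \<psi> J"
  using assms
proof (induction "card J" arbitrary: J t)
  case 0
  then show ?case by simp
next
  case (Suc n)
  let ?m = "Max J" and ?J = "J - {Max J}"
  have m: "?m \<in> J" using Suc by (intro Max_in) auto
  have le: "\<And>r. r \<in> J \<Longrightarrow> r \<le> ?m" using Suc.prems(1) by auto
  have mt: "0 < ?m" "?m < t" using m Suc.prems(2) by auto
  have eq: "J \<inter> {r<..<v} = ?J \<inter> {r<..<v}" if "v \<le> ?m" for r v
    using that by auto
  have "\<phi> ?m + sum \<phi> ?J = \<phi>0 + sum \<psi> ?J"
  proof (rule Suc.hyps(1))
    show "n = card ?J" using Suc.hyps(2) Suc.prems(1) m by simp
    show "finite ?J" using Suc.prems(1) by simp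
    show "?J \<subseteq> {0<..<?m}" using le Suc.prems(2) by fastforce
    show "0 < ?m" by (rule mt)
    show "\<phi> v = \<psi> r" if "r \<in> ?J" "r < v" "v \<le> ?m" "?J \<inter> {r<..<v} = {}" for r v
      using that mt eq[of v r] by (intro Suc.prems(4)) auto
    show "\<phi> v = \<phi>0" if "0 < v" "v \<le> ?m" "?J \<inter> {0<..<v} = {}" for v
      using that mt eq[of v 0] by (intro Suc.prems(5)) auto
  qed
  moreover have "\<phi> t = \<psi> ?m"
  proof (rule Suc.prems(4)[OF m])
    show "J \<inter> {?m<..<t} = {}" using le by fastforce
  qed (use mt in auto)
  ultimately show ?case using Suc.prems(1) m by (simp add: sum.remove[OF _ m])
qed

section \<open>The system as a function of the clock values\<close>

fun clock_class :: "clock \<Rightarrow> nat" where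
  "clock_class (Interarrival i n) = i"
| "clock_class (Net_Service i n) = i"
| "clock_class (Fict_Service i n) = i"
| "clock_class (Init_Service i n) = i"

text \<open>The canonical clocks: the sample point is the vector of clock values itself, and the
  random variables are its coordinates.\<close>

abbreviation (input) cval :: "clock \<Rightarrow> (clock \<Rightarrow> real) \<Rightarrow> real" where
  "cval c \<tau> \<equiv> \<tau> c"

abbreviation arr :: "nat \<Rightarrow> nat \<Rightarrow> (clock \<Rightarrow> real) \<Rightarrow> real" where
  "arr \<equiv> arrival_time cval"

lemma finite_classes [simp]: "finite (classes N)" and finite_allocs [simp]: "finite (allocs N i)"
  and finite_resources [simp]: "finite (resources N)"
  by (auto simp: classes_def allocs_def resources_def)

lemma in_clocks:
  "Interarrival i n \<in> clocks N y0 \<longleftrightarrow> i \<in> classes N"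
  "Net_Service i n \<in> clocks N y0 \<longleftrightarrow> i \<in> classes N"
  "Fict_Service i n \<in> clocks N y0 \<longleftrightarrow> i \<in> classes N"
  "Init_Service i n \<in> clocks N y0 \<longleftrightarrow> i \<in> classes N \<and> n < y0 i"
  unfolding clocks_def by blast+

lemma countable_clocks [simp]: "countable (clocks N y0)"
  unfolding clocks_def by (intro countable_UN countable_Un countable_image) (auto intro: countable_finite)

text \<open>Isolates what the left-limit state at \<open>w\<close> depends on: which requests have
  arrived before \<open>w\<close>, the decisions on them, and which services last until
  \<open>w\<close>.\<close>

lemma counts_cong:
  fixes T :: "clock \<Rightarrow> 'a \<Rightarrow> real" and T' :: "clock \<Rightarrow> 'b \<Rightarrow> real"
  assumes a: "\<And>i n. i \<in> classes N \<Longrightarrow> arrival_time T i n \<omega> < w \<longleftrightarrow> arrival_time T' i n \<omega>' < w"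
    and D: "\<And>i n. i \<in> classes N \<Longrightarrow> arrival_time T i n \<omega> < w \<Longrightarrow> D i n \<omega> = D' i n \<omega>'"
    and s: "\<And>i n. i \<in> classes N \<Longrightarrow> arrival_time T i n \<omega> < w \<Longrightarrow>
        (w \<le> arrival_time T i n \<omega> + T (Net_Service i n) \<omega> \<longleftrightarrow>
         w \<le> arrival_time T' i n \<omega>' + T' (Net_Service i n) \<omega>') \<and>
        (w \<le> arrival_time T i n \<omega> + T (Fict_Service i n) \<omega> \<longleftrightarrow>
         w \<le> arrival_time T' i n \<omega>' + T' (Fict_Service i n) \<omega>')"
    and y: "\<And>i n. i \<in> classes N \<Longrightarrow> n < y0 i \<Longrightarrow>
        w \<le> T (Init_Service i n) \<omega> \<longleftrightarrow> w \<le> T' (Init_Service i n) \<omega>'"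
  shows "net_count N T D (present_before w) \<omega> = net_count N T' D' (present_before w) \<omega>'"
    and "fict_count N y0 T D (present_before w) \<omega> = fict_count N y0 T' D' (present_before w) \<omega>'"
proof -
  have "{n. D i n \<omega> = Some j \<and> present_before w (arrival_time T i n \<omega>) (T (Net_Service i n) \<omega>)}
      = {n. D' i n \<omega>' = Some j \<and> present_before w (arrival_time T' i n \<omega>') (T' (Net_Service i n) \<omega>')}"
    if "i \<in> classes N" for i j
    using a[OF that] D[OF that] s[OF that] by (auto simp: present_before_def)
  then show "net_count N T D (present_before w) \<omega> = net_count N T' D' (present_before w) \<omega>'"
    by (intro ext) (simp add: net_count_def)
  have "{n. D i n \<omega> = None \<and> present_before w (arrival_time T i n \<omega>) (T (Fict_Service i n) \<omega>)}
      = {n. D' i n \<omega>' = None \<and> present_before w (arrival_time T' i n \<omega>') (T' (Fict_Service i n) \<omega>')}"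
    if "i \<in> classes N" for i
    using a[OF that] D[OF that] s[OF that] by (auto simp: present_before_def)
  moreover have "{n. n < y0 i \<and> present_before w 0 (T (Init_Service i n) \<omega>)}
      = {n. n < y0 i \<and> present_before w 0 (T' (Init_Service i n) \<omega>')}"
    if "i \<in> classes N" for i
    using y[OF that] by (auto simp: present_before_def)
  ultimately show "fict_count N y0 T D (present_before w) \<omega> = fict_count N y0 T' D' (present_before w) \<omega>'"
    by (intro ext) (simp add: fict_count_def)
qed

section \<open>The decisions as the solution of a recursion\<close>

locale loss_dynamics =
  fixes N :: loss_network and y0 :: "nat \<Rightarrow> nat"
    and dec :: "nat \<Rightarrow> (nat \<Rightarrow> nat \<Rightarrow> nat) \<Rightarrow> (nat \<Rightarrow> nat) \<Rightarrow> nat option"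
  assumes network: "is_loss_network N"
    and dec_allocs: "\<And>i x y j. i \<in> classes N \<Longrightarrow> dec i x y = Some j \<Longrightarrow> j \<in> allocs N i"
begin

text \<open>The policy equation at one sample point. It is polymorphic in the sample space, so that
  given decisions can be compared with those constructed from the clock values.\<close>

definition fixpt :: "(clock \<Rightarrow> 'a \<Rightarrow> real) \<Rightarrow> (nat \<Rightarrow> nat \<Rightarrow> 'a \<Rightarrow> nat option) \<Rightarrow> 'a \<Rightarrow> bool" where
  "fixpt T D \<omega> \<longleftrightarrow> (\<forall>i\<in>classes N. \<forall>n.
     D i n \<omega> = dec i (net_count N T D (present_before (arrival_time T i n \<omega>)) \<omega>)
                      (fict_count N y0 T D (present_before (arrival_time T i n \<omega>)) \<omega>))"

text \<open>The measure for the recursion over the arrivals. Simultaneous arrivals have equal rank,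
  which is harmless since decisions look at the left limit only.\<close>

definition rank :: "(clock \<Rightarrow> 'a \<Rightarrow> real) \<Rightarrow> nat \<Rightarrow> nat \<Rightarrow> 'a \<Rightarrow> nat" where
  "rank T i n \<omega> = (\<Sum>i'\<in>classes N. card {n'. arrival_time T i' n' \<omega> < arrival_time T i n \<omega>})"

definition locally_finite :: "(clock \<Rightarrow> 'a \<Rightarrow> real) \<Rightarrow> 'a \<Rightarrow> bool" where
  "locally_finite T \<omega> \<longleftrightarrow> (\<forall>i\<in>classes N. \<forall>t. finite {n. arrival_time T i n \<omega> \<le> t})"

lemma locally_finiteD:
  assumes "locally_finite T \<omega>" "i \<in> classes N"
  shows "finite {n. arrival_time T i n \<omega> \<le> t}" "finite {n. arrival_time T i n \<omega> < t}"
proof -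
  show 1: "finite {n. arrival_time T i n \<omega> \<le> t}" using assms by (auto simp: locally_finite_def)
  show "finite {n. arrival_time T i n \<omega> < t}" by (rule finite_subset[OF _ 1]) auto
qed

lemma rank_less:
  assumes fin: "locally_finite T \<omega>" and i: "i' \<in> classes N"
    and less: "arrival_time T i' n' \<omega> < arrival_time T i n \<omega>"
  shows "rank T i' n' \<omega> < rank T i n \<omega>"
  unfolding rank_def
proof (rule sum_strict_mono_ex1)
  show "\<forall>k\<in>classes N. card {m. arrival_time T k m \<omega> < arrival_time T i' n' \<omega>}
      \<le> card {m. arrival_time T k m \<omega> < arrival_time T i n \<omega>}"
    using less locally_finiteD(2)[OF fin] by (intro ballI card_mono) auto
  show "\<exists>k\<in>classes N. card {m. arrival_time T k m \<omega> < arrival_time T i' n' \<omega>}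
      < card {m. arrival_time T k m \<omega> < arrival_time T i n \<omega>}"
    using less locally_finiteD(2)[OF fin i] by (intro bexI[OF _ i] psubset_card_mono) auto
qed simp

text \<open>Two sets of clock values which cannot be told apart by observing the system before time \<^term>\<open>u\<close>.\<close>

definition agree :: "real \<Rightarrow> (clock \<Rightarrow> 'a \<Rightarrow> real) \<Rightarrow> 'a \<Rightarrow> (clock \<Rightarrow> 'b \<Rightarrow> real) \<Rightarrow> 'b \<Rightarrow> bool" where
  "agree u T \<omega> T' \<omega>' \<longleftrightarrow> (\<forall>i\<in>classes N.
     (\<forall>n. arrival_time T i n \<omega> < u \<or> arrival_time T' i n \<omega>' < u \<longrightarrow>
        arrival_time T i n \<omega> = arrival_time T' i n \<omega>' \<and>
        (\<forall>w\<le>u. (w \<le> arrival_time T i n \<omega> + T (Net_Service i n) \<omega> \<longleftrightarrow>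
                 w \<le> arrival_time T' i n \<omega>' + T' (Net_Service i n) \<omega>') \<and>
                (w \<le> arrival_time T i n \<omega> + T (Fict_Service i n) \<omega> \<longleftrightarrow>
                 w \<le> arrival_time T' i n \<omega>' + T' (Fict_Service i n) \<omega>'))) \<and>
     (\<forall>n<y0 i. \<forall>w\<le>u. w \<le> T (Init_Service i n) \<omega> \<longleftrightarrow> w \<le> T' (Init_Service i n) \<omega>'))"

lemma agree_counts:
  assumes ag: "agree u T \<omega> T' \<omega>'" and w: "w \<le> u"
    and D: "\<And>i n. i \<in> classes N \<Longrightarrow> arrival_time T i n \<omega> < w \<Longrightarrow> D i n \<omega> = D' i n \<omega>'"
  shows "net_count N T D (present_before w) \<omega> = net_count N T' D' (present_before w) \<omega>'"
    and "fict_count N y0 T D (present_before w) \<omega> = fict_count N y0 T' D' (present_before w) \<omega>'"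
proof -
  have 1: "arrival_time T i n \<omega> < w \<longleftrightarrow> arrival_time T' i n \<omega>' < w" if "i \<in> classes N" for i n
    using ag w that unfolding agree_def by (smt (verit))
  have 2: "(w \<le> arrival_time T i n \<omega> + T (Net_Service i n) \<omega> \<longleftrightarrow>
         w \<le> arrival_time T' i n \<omega>' + T' (Net_Service i n) \<omega>') \<and>
        (w \<le> arrival_time T i n \<omega> + T (Fict_Service i n) \<omega> \<longleftrightarrow>
         w \<le> arrival_time T' i n \<omega>' + T' (Fict_Service i n) \<omega>')"
    if "i \<in> classes N" "arrival_time T i n \<omega> < w" for i n
    using ag w that unfolding agree_def by (meson less_le_trans)
  have 3: "w \<le> T (Init_Service i n) \<omega> \<longleftrightarrow> w \<le> T' (Init_Service i n) \<omega>'"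
    if "i \<in> classes N" "n < y0 i" for i n
    using ag w that unfolding agree_def by blast
  show "net_count N T D (present_before w) \<omega> = net_count N T' D' (present_before w) \<omega>'"
    and "fict_count N y0 T D (present_before w) \<omega> = fict_count N y0 T' D' (present_before w) \<omega>'"
    using counts_cong[of N T \<omega> w T' \<omega>' D D' y0] 1 D 2 3 by blast+
qed

text \<open>Induction along the order of arrival: a decision uses only what is visible strictly
  before. The two systems may live on different spaces and need to agree only up to
  \<open>u\<close>; this yields both causality and the identification of given decisions with the
  constructed ones.\<close>

lemma fixpt_unique:
  assumes fp: "fixpt T D \<omega>" "fixpt T' D' \<omega>'" and fin: "locally_finite T \<omega>"
    and ag: "agree u T \<omega> T' \<omega>'"
  shows "i \<in> classes N \<Longrightarrow> arrival_time T i n \<omega> < u \<Longrightarrow> D i n \<omega> = D' i n \<omega>'"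
proof (induction "rank T i n \<omega>" arbitrary: i n rule: less_induct)
  case less
  let ?a = "arrival_time T i n \<omega>"
  have a: "arrival_time T' i n \<omega>' = ?a" using ag less.prems unfolding agree_def by metis
  have D: "D i' n' \<omega> = D' i' n' \<omega>'" if "i' \<in> classes N" "arrival_time T i' n' \<omega> < ?a" for i' n'
    using rank_less[OF fin that] that less.prems(2) by (intro less.hyps) auto
  have "D i n \<omega> = dec i (net_count N T D (present_before ?a) \<omega>) (fict_count N y0 T D (present_before ?a) \<omega>)"
    using fp(1) less.prems(1) by (auto simp: fixpt_def)
  also have "\<dots> = dec i (net_count N T' D' (present_before ?a) \<omega>') (fict_count N y0 T' D' (present_before ?a) \<omega>')"
    using agree_counts[OF ag less_imp_le[OF less.prems(2)], of D D'] D by simp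
  also have "\<dots> = D' i n \<omega>'"
    using fp(2) less.prems(1) unfolding a[symmetric] by (auto simp: fixpt_def)
  finally show ?case .
qed

text \<open>\<^term>\<open>decision_iter m\<close> is right for the requests with less than \<^term>\<open>m\<close> predecessors.\<close>

primrec decision_iter :: "nat \<Rightarrow> nat \<Rightarrow> nat \<Rightarrow> (clock \<Rightarrow> real) \<Rightarrow> nat option" where
  "decision_iter 0 = (\<lambda>i n \<tau>. None)"
| "decision_iter (Suc m) = (\<lambda>i n \<tau>. dec i (net_count N cval (decision_iter m) (present_before (arr i n \<tau>)) \<tau>)
                              (fict_count N y0 cval (decision_iter m) (present_before (arr i n \<tau>)) \<tau>))"

definition decision :: "nat \<Rightarrow> nat \<Rightarrow> (clock \<Rightarrow> real) \<Rightarrow> nat option" where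
  "decision i n \<tau> = decision_iter (Suc (rank cval i n \<tau>)) i n \<tau>"

lemma agree_refl: "agree u T \<omega> T \<omega>"
  by (auto simp: agree_def)

lemma decision_iter_eq:
  assumes fin: "locally_finite cval \<tau>"
  shows "i \<in> classes N \<Longrightarrow> rank cval i n \<tau> < m \<Longrightarrow> decision_iter m i n \<tau> = decision i n \<tau>"
proof (induction "rank cval i n \<tau>" arbitrary: i n m rule: less_induct)
  case less
  have key: "decision_iter (Suc k) i n \<tau> = dec i (net_count N cval decision (present_before (arr i n \<tau>)) \<tau>)
                              (fict_count N y0 cval decision (present_before (arr i n \<tau>)) \<tau>)"
    if "rank cval i n \<tau> < Suc k" for k
  proof -
    have "decision_iter k i' n' \<tau> = decision i' n' \<tau>" if "i' \<in> classes N" "arr i' n' \<tau> < arr i n \<tau>" for i' n'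
      using rank_less[OF fin that] that \<open>rank cval i n \<tau> < Suc k\<close> by (intro less.hyps) auto
    then show ?thesis
      using agree_counts[OF agree_refl order_refl, of cval \<tau> "arr i n \<tau>" "decision_iter k" decision] by simp
  qed
  obtain k where "m = Suc k" using less.prems by (cases m) auto
  then show ?case using key[of k] key[of "rank cval i n \<tau>"] less.prems by (simp add: decision_def)
qed

lemma fixpt_decision:
  assumes fin: "locally_finite cval \<tau>"
  shows "fixpt cval decision \<tau>"
  unfolding fixpt_def
proof (intro ballI allI)
  fix i n assume i: "i \<in> classes N"
  have "decision_iter (rank cval i n \<tau>) i' n' \<tau> = decision i' n' \<tau>" if "i' \<in> classes N" "arr i' n' \<tau> < arr i n \<tau>" for i' n'
    using rank_less[OF fin that] that by (intro decision_iter_eq[OF fin]) auto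
  then show "decision i n \<tau> = dec i (net_count N cval decision (present_before (arr i n \<tau>)) \<tau>)
                              (fict_count N y0 cval decision (present_before (arr i n \<tau>)) \<tau>)"
    using agree_counts[OF agree_refl order_refl, of cval \<tau> "arr i n \<tau>" "decision_iter (rank cval i n \<tau>)" decision]
    by (simp add: decision_def)
qed

section \<open>Clocks, stations and jumps of the state\<close>

definition good :: "(clock \<Rightarrow> real) \<Rightarrow> bool" where
  "good \<tau> \<longleftrightarrow> (\<forall>c\<in>clocks N y0. 0 < \<tau> c) \<and> locally_finite cval \<tau>"

text \<open>
  A clock runs from \<^term>\<open>start\<close> to \<^term>\<open>ring\<close>. Each request has two service clocks, of which only the one
  selected by the decision is active.
\<close>

fun start :: "clock \<Rightarrow> (clock \<Rightarrow> real) \<Rightarrow> real" where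
  "start (Interarrival i n) \<tau> = (\<Sum>p<n. \<tau> (Interarrival i p))"
| "start (Net_Service i n) \<tau> = arr i n \<tau>"
| "start (Fict_Service i n) \<tau> = arr i n \<tau>"
| "start (Init_Service i n) \<tau> = 0"

definition ring :: "clock \<Rightarrow> (clock \<Rightarrow> real) \<Rightarrow> real" where
  "ring c \<tau> = start c \<tau> + \<tau> c"

fun active :: "clock \<Rightarrow> (clock \<Rightarrow> real) \<Rightarrow> bool" where
  "active (Net_Service i n) \<tau> = (decision i n \<tau> \<noteq> None)"
| "active (Fict_Service i n) \<tau> = (decision i n \<tau> = None)"
| "active _ \<tau> = True"

text \<open>The network clock of a rejected request also has the value \<open>None\<close>; being
  inactive, it does not disturb the count of the fictitious system.\<close>

fun station :: "clock \<Rightarrow> (clock \<Rightarrow> real) \<Rightarrow> nat option" where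
  "station (Net_Service i n) \<tau> = decision i n \<tau>"
| "station _ \<tau> = None"

definition running :: "clock \<Rightarrow> real \<Rightarrow> (clock \<Rightarrow> real) \<Rightarrow> bool" where
  "running c u \<tau> \<longleftrightarrow> active c \<tau> \<and> start c \<tau> < u \<and> u \<le> ring c \<tau>"

definition services :: "nat \<Rightarrow> clock set" where
  "services i = range (Net_Service i) \<union> range (Fict_Service i) \<union> Init_Service i ` {..<y0 i}"

definition class_clocks :: "nat \<Rightarrow> clock set" where
  "class_clocks i = range (Interarrival i) \<union> services i"

abbreviation X :: "real \<Rightarrow> (clock \<Rightarrow> real) \<Rightarrow> nat \<Rightarrow> nat \<Rightarrow> nat" where
  "X u \<tau> \<equiv> net_count N cval decision (present_before u) \<tau>"
abbreviation Y :: "real \<Rightarrow> (clock \<Rightarrow> real) \<Rightarrow> nat \<Rightarrow> nat" where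
  "Y u \<tau> \<equiv> fict_count N y0 cval decision (present_before u) \<tau>"

text \<open>The state of a class just before time \<^term>\<open>u\<close>; the station \<^term>\<open>None\<close> is the fictitious system.\<close>

definition z :: "nat \<Rightarrow> real \<Rightarrow> (clock \<Rightarrow> real) \<Rightarrow> nat option \<Rightarrow> nat" where
  "z i u \<tau> q = (case q of None \<Rightarrow> Y u \<tau> i | Some j \<Rightarrow> X u \<tau> i j)"

lemma ring_Interarrival: "ring (Interarrival i n) \<tau> = arr i n \<tau>"
  by (simp add: ring_def arrival_time_def lessThan_Suc_atMost[symmetric])

lemma class_clocks_subset: "i \<in> classes N \<Longrightarrow> class_clocks i \<subseteq> clocks N y0"
  by (auto simp: class_clocks_def services_def clocks_def)

lemma goodD:
  assumes "good \<tau>"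
  shows "c \<in> clocks N y0 \<Longrightarrow> 0 < \<tau> c" "locally_finite cval \<tau>"
    "i \<in> classes N \<Longrightarrow> finite {n. arr i n \<tau> \<le> t}" "i \<in> classes N \<Longrightarrow> finite {n. arr i n \<tau> < t}"
  using assms locally_finiteD[of cval \<tau> i t] by (auto simp: good_def)

lemma decision_allocs: "good \<tau> \<Longrightarrow> i \<in> classes N \<Longrightarrow> decision i n \<tau> = Some j \<Longrightarrow> j \<in> allocs N i"
  using fixpt_decision[OF goodD(2)] dec_allocs unfolding fixpt_def by metis

lemma start_pos:
  assumes "good \<tau>" "i \<in> classes N"
  shows "0 < arr i n \<tau>"
  unfolding arrival_time_def by (intro sum_pos goodD(1)[OF assms(1)]) (simp_all add: in_clocks assms(2))

lemma finite_started:
  assumes "good \<tau>" "i \<in> classes N"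
  shows "finite {c \<in> services i. start c \<tau> < u}"
proof (rule finite_subset)
  let ?A = "{n. arr i n \<tau> < u}"
  show "{c \<in> services i. start c \<tau> < u} \<subseteq> Net_Service i ` ?A \<union> Fict_Service i ` ?A \<union> Init_Service i ` {..<y0 i}"
    by (auto simp: services_def)
  show "finite (Net_Service i ` ?A \<union> Fict_Service i ` ?A \<union> Init_Service i ` {..<y0 i})"
    using goodD(4)[OF assms] by auto
qed

lemma running_services:
  "{c \<in> services i. running c u \<tau> \<and> station c \<tau> = None} =
     Fict_Service i ` {n. decision i n \<tau> = None \<and> present_before u (arr i n \<tau>) (\<tau> (Fict_Service i n))}
     \<union> Init_Service i ` {n. n < y0 i \<and> present_before u 0 (\<tau> (Init_Service i n))}" (is ?A)
  "{c \<in> services i. running c u \<tau> \<and> station c \<tau> = Some j} =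
     Net_Service i ` {n. decision i n \<tau> = Some j \<and> present_before u (arr i n \<tau>) (\<tau> (Net_Service i n))}" (is ?B)
proof -
  have 1: "c \<in> services i \<longleftrightarrow> (case c of Net_Service i' n \<Rightarrow> i' = i | Fict_Service i' n \<Rightarrow> i' = i
     | Init_Service i' n \<Rightarrow> i' = i \<and> n < y0 i | _ \<Rightarrow> False)" for c
    unfolding services_def by (cases c) auto
  have 2: "c \<in> Net_Service i ` A \<longleftrightarrow> (case c of Net_Service i' n \<Rightarrow> i' = i \<and> n \<in> A | _ \<Rightarrow> False)"
    "c \<in> Fict_Service i ` A \<longleftrightarrow> (case c of Fict_Service i' n \<Rightarrow> i' = i \<and> n \<in> A | _ \<Rightarrow> False)"
    "c \<in> Init_Service i ` A \<longleftrightarrow> (case c of Init_Service i' n \<Rightarrow> i' = i \<and> n \<in> A | _ \<Rightarrow> False)" for c A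
    by (cases c; auto)+
  show ?A
    by (rule set_eqI, case_tac x)
      (simp_all add: 1 2 running_def present_before_def ring_def cong: conj_cong, metis option.exhaust)
  show ?B
    by (rule set_eqI, case_tac x)
      (simp_all add: 1 2 running_def present_before_def ring_def cong: conj_cong, auto)
qed

text \<open>Makes the state a count of running clocks, so that it changes exactly when a service
  clock starts or stops.\<close>

lemma z_card:
  assumes g: "good \<tau>" and i: "i \<in> classes N"
  shows "z i u \<tau> q = card {c \<in> services i. running c u \<tau> \<and> station c \<tau> = q}"
proof (cases q)
  case None
  let ?A = "{n. decision i n \<tau> = None \<and> present_before u (arr i n \<tau>) (\<tau> (Fict_Service i n))}"
  let ?B = "{n. n < y0 i \<and> present_before u 0 (\<tau> (Init_Service i n))}"
  have "finite ?A" by (rule finite_subset[OF _ goodD(4)[OF g i, of u]]) (auto simp: present_before_def)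
  then have "card (Fict_Service i ` ?A \<union> Init_Service i ` ?B)
      = card (Fict_Service i ` ?A) + card (Init_Service i ` ?B)"
    by (intro card_Un_disjoint finite_imageI) auto
  also have "\<dots> = card ?A + card ?B" by (subst (1 2) card_image) (simp_all add: inj_on_def)
  finally show ?thesis unfolding None running_services using i by (simp add: z_def fict_count_def)
next
  case (Some j)
  let ?A = "{n. decision i n \<tau> = Some j \<and> present_before u (arr i n \<tau>) (\<tau> (Net_Service i n))}"
  have "card (Net_Service i ` ?A) = card ?A" by (rule card_image) (simp add: inj_on_def)
  moreover have "card (Net_Service i ` ?A) = 0" if "j \<notin> allocs N i"
  proof -
    have "?A = {}" using decision_allocs[OF g i] that by blast
    then show ?thesis by (simp only: image_empty card.empty)
  qed
  ultimately show ?thesis unfolding Some running_services using i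
    by (cases "j \<in> allocs N i") (simp_all add: z_def net_count_def)
qed

text \<open>The state of the class just after \<open>c\<close> rings at time \<open>u\<close>. For
  an arrival the station is read off the decision rule at the state before \<open>u\<close>, so the
  value is the same for all interarrival clocks of the class.\<close>

definition after :: "clock \<Rightarrow> real \<Rightarrow> (clock \<Rightarrow> real) \<Rightarrow> nat option \<Rightarrow> nat" where
  "after c u \<tau> = (let i = clock_class c in
     (case c of Interarrival _ _ \<Rightarrow> (let s = dec i (X u \<tau>) (Y u \<tau>) in (z i u \<tau>)(s := Suc (z i u \<tau> s)))
      | _ \<Rightarrow> (z i u \<tau>)(station c \<tau> := z i u \<tau> (station c \<tau>) - 1)))"

lemma after_service:
  "c \<in> services i \<Longrightarrow> after c u \<tau> = (z i u \<tau>)(station c \<tau> := z i u \<tau> (station c \<tau>) - 1)"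
  by (auto simp: services_def after_def)

definition rung :: "nat \<Rightarrow> real \<Rightarrow> (clock \<Rightarrow> real) \<Rightarrow> clock set" where
  "rung i t \<tau> = {c \<in> class_clocks i. active c \<tau> \<and> ring c \<tau> < t}"

text \<open>One class suffices: its state jumps only at rings of its own clocks, and the other
  classes enter only through the decisions taken at its own arrivals.\<close>

definition distinct_rings :: "nat \<Rightarrow> (clock \<Rightarrow> real) \<Rightarrow> bool" where
  "distinct_rings i \<tau> \<longleftrightarrow> inj_on (\<lambda>c. ring c \<tau>) (class_clocks i)"

lemma finite_rung:
  assumes g: "good \<tau>" and i: "i \<in> classes N"
  shows "finite (rung i t \<tau>)"
proof (rule finite_subset)
  show "rung i t \<tau> \<subseteq> Interarrival i ` {n. arr i n \<tau> < t} \<union> {c \<in> services i. start c \<tau> < t}"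
  proof
    fix c assume c: "c \<in> rung i t \<tau>"
    have "0 < \<tau> c" using c class_clocks_subset[OF i] goodD(1)[OF g] by (auto simp: rung_def)
    then show "c \<in> Interarrival i ` {n. arr i n \<tau> < t} \<union> {c \<in> services i. start c \<tau> < t}"
      using c by (auto simp: rung_def class_clocks_def ring_Interarrival) (auto simp: ring_def)
  qed
qed (use goodD(4)[OF g i] finite_started[OF g i] in auto)

lemma ring_gt_start: "good \<tau> \<Longrightarrow> c \<in> clocks N y0 \<Longrightarrow> start c \<tau> < ring c \<tau>"
  using goodD(1) by (simp add: ring_def)

lemma start_nonneg:
  assumes g: "good \<tau>" and c: "c \<in> clocks N y0"
  shows "0 \<le> start c \<tau>"
proof (cases c)
  case (Interarrival i n)
  then show ?thesis using c
    by (auto intro!: sum_nonneg less_imp_le[OF goodD(1)[OF g]] simp: in_clocks)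
qed (use c start_pos[OF g] in \<open>auto simp: in_clocks intro: less_imp_le\<close>)

lemma service_start:
  assumes "c \<in> services i"
  obtains "start c \<tau> = 0" "c \<in> Init_Service i ` {..<y0 i}"
   | n where "start c \<tau> = ring (Interarrival i n) \<tau>" "c = Net_Service i n \<or> c = Fict_Service i n"
  using assms by (auto simp: services_def ring_Interarrival)

text \<open>At the ring of \<open>c\<close> the clock \<open>c\<close> stops, and the service clocks
  that start at this instant join; no further clock starts or stops before the next ring.\<close>

lemma z_constant:
  assumes g: "good \<tau>" and i: "i \<in> classes N" and d: "distinct_rings i \<tau>"
    and c: "c \<in> class_clocks i" "active c \<tau>" and v: "ring c \<tau> < v"
    and no: "\<And>c'. c' \<in> class_clocks i \<Longrightarrow> active c' \<tau> \<Longrightarrow> \<not> (ring c \<tau> < ring c' \<tau> \<and> ring c' \<tau> < v)"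
  shows "z i v \<tau> = after c (ring c \<tau>) \<tau>"
proof
  fix q
  let ?r = "ring c \<tau>"
  \<comment> \<open>The service clocks started by the ring of \<open>c\<close>: exactly one if
    \<open>c\<close> is an interarrival clock, none if it is a service clock.\<close>
  define new where "new = {c' \<in> services i. active c' \<tau> \<and> start c' \<tau> = ?r}"
  have r0: "0 < ?r" using ring_gt_start[OF g] start_nonneg[OF g] c(1) class_clocks_subset[OF i] by force
  have cl: "c' \<in> services i \<Longrightarrow> c' \<in> class_clocks i" for c' by (simp add: class_clocks_def)
  have clc: "c' \<in> services i \<Longrightarrow> c' \<in> clocks N y0" for c' using cl class_clocks_subset[OF i] by auto
  have run: "running c' v \<tau> \<longleftrightarrow> (running c' ?r \<tau> \<and> c' \<noteq> c) \<or> c' \<in> new" if c': "c' \<in> services i" for c'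
  proof (cases "active c' \<tau>")
    case act: True
    have gt: "start c' \<tau> < ring c' \<tau>" by (rule ring_gt_start[OF g clc[OF c']])
    have st: "start c' \<tau> \<le> ?r \<longleftrightarrow> start c' \<tau> < v"
      using c'
    proof (cases rule: service_start[of _ _ \<tau>])
      case 1 then show ?thesis using r0 v by auto
    next
      case (2 n)
      then show ?thesis using no[of "Interarrival i n"] v by (auto simp: class_clocks_def)
    qed
    have ne: "ring c' \<tau> \<noteq> ?r" if "c' \<noteq> c"
      using that d c(1) cl[OF c'] by (auto simp: distinct_rings_def inj_on_def)
    have "v \<le> ring c' \<tau> \<longleftrightarrow> ?r < ring c' \<tau>" using no[OF cl[OF c'] act] v by auto
    then show ?thesis using act gt st ne c' unfolding running_def new_def by (cases "c' = c") auto
  qed (simp add: running_def new_def)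
  have fin: "finite {c \<in> services i. running c ?r \<tau> \<and> station c \<tau> = q}"
    by (rule finite_subset[OF _ finite_started[OF g i, of ?r]]) (auto simp: running_def)
  have zv: "z i v \<tau> q = card ({c' \<in> services i. running c' ?r \<tau> \<and> station c' \<tau> = q} - {c}
      \<union> {c' \<in> new. station c' \<tau> = q})"
    unfolding z_card[OF g i] by (rule arg_cong[of _ _ card]) (use run in \<open>auto simp: new_def\<close>)
  show "z i v \<tau> q = after c ?r \<tau> q"
  proof (cases "c \<in> services i")
    case False
    then obtain n where c_eq: "c = Interarrival i n" using c(1) by (auto simp: class_clocks_def)
    have cn: "c \<notin> services i" using c_eq by (auto simp: services_def)
    define cn where "cn = (if decision i n \<tau> = None then Fict_Service i n else Net_Service i n)"
    have arr_inj: "m = n" if "arr i m \<tau> = arr i n \<tau>" for m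
      using that d unfolding distinct_rings_def inj_on_def
      by (metis (no_types, lifting) UnI1 class_clocks_def clock.inject(1) rangeI ring_Interarrival)
    have new: "new = {cn}"
    proof -
      have "?r \<noteq> 0" using r0 by simp
      then show ?thesis
        unfolding new_def cn_def c_eq ring_Interarrival
        using start_pos[OF g i] by (auto simp: services_def dest!: arr_inj)
    qed
    have st: "station cn \<tau> = decision i n \<tau>" by (auto simp: cn_def)
    have nrun: "\<not> running cn ?r \<tau>" using new by (auto simp: new_def running_def)
    have decision: "decision i n \<tau> = dec i (X ?r \<tau>) (Y ?r \<tau>)"
      using fixpt_decision[OF goodD(2)[OF g]] i unfolding fixpt_def by (simp add: c_eq ring_Interarrival)
    show ?thesis
    proof (cases "q = decision i n \<tau>")
      case True
      have "{c' \<in> new. station c' \<tau> = q} = {cn}" using new st True by auto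
      then have "z i v \<tau> q = card (insert cn {c' \<in> services i. running c' ?r \<tau> \<and> station c' \<tau> = q})"
        unfolding zv using cn by (intro arg_cong[of _ _ card]) (auto)
      also have "\<dots> = Suc (z i ?r \<tau> q)" unfolding z_card[OF g i] using fin nrun by simp
      finally show ?thesis using True decision by (simp add: after_def c_eq Let_def)
    next
      case False
      have "{c' \<in> new. station c' \<tau> = q} = {}" using new st False by auto
      then have "z i v \<tau> q = card {c' \<in> services i. running c' ?r \<tau> \<and> station c' \<tau> = q}"
        unfolding zv using cn by (intro arg_cong[of _ _ card]) (auto)
      then show ?thesis using False decision unfolding z_card[OF g i, symmetric] by (simp add: after_def c_eq Let_def)
    qed
  next
    case cs: True
    have "z i v \<tau> q = ((z i ?r \<tau>)(station c \<tau> := z i ?r \<tau> (station c \<tau>) - 1)) q"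
    proof -
      \<comment> \<open>A service clock starts either at time 0 or at an arrival of its class, and
        no arrival coincides with the ring of a service clock.\<close>
      have "new = {}"
      proof -
        have False if c': "c' \<in> new" for c'
        proof -
          have s: "c' \<in> services i" "start c' \<tau> = ?r" using c' by (auto simp: new_def)
          from s(1) show False
          proof (cases rule: service_start[of _ _ \<tau>])
            case 1 then show False using s r0 by simp
          next
            case (2 m)
            then have "ring (Interarrival i m) \<tau> = ring c \<tau>" using s by simp
            then have "Interarrival i m = c"
              using d c(1) unfolding distinct_rings_def inj_on_def by (auto simp: class_clocks_def)
            then show False using cs by (auto simp: services_def)
          qed
        qed
        then show ?thesis by auto
      qed
      then have zq: "z i v \<tau> q = card ({c' \<in> services i. running c' ?r \<tau> \<and> station c' \<tau> = q} - {c})"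
        unfolding zv by simp
      have "running c ?r \<tau>" using c(2) ring_gt_start[OF g clc[OF cs]] by (simp add: running_def)
      then have "z i v \<tau> q = card {c' \<in> services i. running c' ?r \<tau> \<and> station c' \<tau> = q}
          - (if q = station c \<tau> then 1 else 0)"
        unfolding zq using fin cs by (auto simp: card_Diff_singleton_if)
      then show ?thesis unfolding z_card[OF g i, symmetric] by simp
    qed
    then show ?thesis by (simp add: after_service[OF cs])
  qed
qed

text \<open>The initial requests arrive at time 0, so the left limits count them only for
  \<open>v > 0\<close>; at time 0 itself the count is empty.\<close>

lemma z_initial:
  assumes g: "good \<tau>" and i: "i \<in> classes N" and v: "0 < v"
    and no: "\<And>c'. c' \<in> class_clocks i \<Longrightarrow> active c' \<tau> \<Longrightarrow> v \<le> ring c' \<tau>"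
  shows "z i v \<tau> = (\<lambda>q. if q = None then y0 i else 0)"
proof (rule ext)
  fix q :: "nat option"
  have v_le: "v \<le> arr i n \<tau>" for n
    using no[of "Interarrival i n"] by (simp add: class_clocks_def ring_Interarrival)
  have v_init: "v \<le> ring (Init_Service i n) \<tau>" if n: "n < y0 i" for n
  proof (rule no)
    show "Init_Service i n \<in> class_clocks i" unfolding class_clocks_def services_def using n by blast
    show "active (Init_Service i n) \<tau>" by (simp only: active.simps)
  qed
  have run: "running c v \<tau> \<and> station c \<tau> = q \<longleftrightarrow> q = None \<and> c \<in> Init_Service i ` {..<y0 i}"
    if c: "c \<in> services i" for c
  proof -
    from c consider (net) n where "c = Net_Service i n" | (fict) n where "c = Fict_Service i n"
      | (init) n where "c = Init_Service i n" "n < y0 i"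
      unfolding services_def by blast
    then show ?thesis
    proof cases
      case net
      have "\<not> running c v \<tau>" unfolding running_def net using v_le[of n] by simp
      moreover have "c \<notin> Init_Service i ` {..<y0 i}" unfolding net by blast
      ultimately show ?thesis by blast
    next
      case fict
      have "\<not> running c v \<tau>" unfolding running_def fict using v_le[of n] by simp
      moreover have "c \<notin> Init_Service i ` {..<y0 i}" unfolding fict by blast
      ultimately show ?thesis by blast
    next
      case (init n)
      have "running c v \<tau>" unfolding running_def init(1) using v_init[OF init(2)] v by simp
      moreover have "station c \<tau> = None" unfolding init(1) by simp
      moreover have "c \<in> Init_Service i ` {..<y0 i}" using init by blast
      ultimately show ?thesis by blast
    qed
  qed
  have "{c \<in> services i. running c v \<tau> \<and> station c \<tau> = q}
      = {c \<in> services i. q = None \<and> c \<in> Init_Service i ` {..<y0 i}}"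
    by (rule Collect_cong, rule conj_cong, rule refl, rule run)
  also have "\<dots> = (if q = None then Init_Service i ` {..<y0 i} else {})"
  proof -
    have "Init_Service i ` {..<y0 i} \<subseteq> services i" unfolding services_def by (rule Un_upper2)
    then show ?thesis
    proof (cases "q = None")
      case True
      have "{c \<in> services i. q = None \<and> c \<in> Init_Service i ` {..<y0 i}} = services i \<inter> Init_Service i ` {..<y0 i}"
        unfolding True by blast
      then show ?thesis unfolding True using \<open>Init_Service i ` {..<y0 i} \<subseteq> services i\<close> by (simp only: if_True Int_absorb1 simp_thms)
    next
      case False
      have "{c \<in> services i. q = None \<and> c \<in> Init_Service i ` {..<y0 i}} = {}" using False by blast
      then show ?thesis using False by (simp only: if_False)
    qed
  qed
  finally have "z i v \<tau> q = card (if q = None then Init_Service i ` {..<y0 i} else {})"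
    unfolding z_card[OF g i] by (rule arg_cong)
  moreover have "card (Init_Service i ` {..<y0 i}) = y0 i" by (subst card_image) (simp_all add: inj_on_def)
  ultimately show "z i v \<tau> q = (if q = None then y0 i else 0)" by simp
qed

text \<open>Written without differences: if \<open>f\<close> is nonnegative, both sides consist of
  nonnegative terms and can be integrated before integrability is known.\<close>

lemma jump_identity:
  fixes f :: "(nat option \<Rightarrow> nat) \<Rightarrow> real"
  assumes g: "good \<tau>" and i: "i \<in> classes N" and d: "distinct_rings i \<tau>" and t: "0 < t"
  shows "f (z i t \<tau>) + (\<Sum>c\<in>rung i t \<tau>. f (z i (ring c \<tau>) \<tau>))
    = f (\<lambda>q. if q = None then y0 i else 0) + (\<Sum>c\<in>rung i t \<tau>. f (after c (ring c \<tau>) \<tau>))"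
proof -
  let ?R = "rung i t \<tau>" and ?r = "\<lambda>c. ring c \<tau>"
  have inj: "inj_on ?r ?R"
    using d unfolding distinct_rings_def by (rule inj_on_subset) (auto simp: rung_def)
  \<comment> \<open>Jumps are indexed by their times; as rings are distinct, the time determines the
    clock.\<close>
  define \<psi> where "\<psi> s = f (after (the_inv_into ?R ?r s) s \<tau>)" for s
  have \<psi>: "\<psi> (?r c) = f (after c (?r c) \<tau>)" if "c \<in> ?R" for c
    unfolding \<psi>_def by (simp add: the_inv_into_f_f[OF inj that])
  have "f (z i t \<tau>) + sum (\<lambda>s. f (z i s \<tau>)) (?r ` ?R) = f (\<lambda>q. if q = None then y0 i else 0) + sum \<psi> (?r ` ?R)"
  proof (rule telescoping_jumps[OF _ _ t])
    show "finite (?r ` ?R)" using finite_rung[OF g i] by simp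
    show "?r ` ?R \<subseteq> {0<..<t}"
    proof
      fix s assume "s \<in> ?r ` ?R"
      then obtain c where c: "c \<in> ?R" "s = ?r c" by auto
      then have "c \<in> clocks N y0" using class_clocks_subset[OF i] by (auto simp: rung_def)
      then show "s \<in> {0<..<t}" using c ring_gt_start[OF g, of c] start_nonneg[OF g, of c] by (auto simp: rung_def)
    qed
    show "f (z i v \<tau>) = \<psi> r" if r: "r \<in> ?r ` ?R" "r < v" "v \<le> t" "?r ` ?R \<inter> {r<..<v} = {}" for r v
    proof -
      obtain c where c: "c \<in> ?R" "r = ?r c" using r(1) by auto
      have "z i v \<tau> = after c (?r c) \<tau>"
      proof (rule z_constant[OF g i d])
        show "\<not> (?r c < ?r c' \<and> ?r c' < v)" if "c' \<in> class_clocks i" "active c' \<tau>" for c'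
        proof
          assume a: "?r c < ?r c' \<and> ?r c' < v"
          then have "c' \<in> ?R" using that r(3) by (auto simp: rung_def)
          then have "?r c' \<in> ?r ` ?R \<inter> {r<..<v}" using a c(2) by auto
          then show False using r(4) by blast
        qed
      qed (use c r(2) in \<open>auto simp: rung_def\<close>)
      then show ?thesis using \<psi>[OF c(1)] c(2) by simp
    qed
    show "f (z i v \<tau>) = f (\<lambda>q. if q = None then y0 i else 0)"
      if v: "0 < v" "v \<le> t" "?r ` ?R \<inter> {0<..<v} = {}" for v
    proof -
      have "v \<le> ?r c'" if c': "c' \<in> class_clocks i" "active c' \<tau>" for c'
      proof (rule ccontr)
        assume a: "\<not> v \<le> ?r c'"
        have "c' \<in> clocks N y0" using class_clocks_subset[OF i] c' by auto
        then have "0 < ?r c'" using ring_gt_start[OF g, of c'] start_nonneg[OF g, of c'] by simp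
        moreover have "c' \<in> ?R" using a c' v(2) by (auto simp: rung_def)
        ultimately have "?r c' \<in> ?r ` ?R \<inter> {0<..<v}" using a by auto
        then show False using v(3) by blast
      qed
      then show ?thesis using z_initial[OF g i v(1)] by simp
    qed
  qed
  then show ?thesis unfolding sum.reindex[OF inj] by (simp add: \<psi>)
qed

section \<open>Running clocks and their rates\<close>

lemma rates: "i \<in> classes N \<Longrightarrow> 0 < arrival_rate N i" "i \<in> classes N \<Longrightarrow> 0 < service_rate N i"
  using network by (auto simp: is_loss_network_def)

definition stations :: "nat \<Rightarrow> nat option set" where
  "stations i = insert None (Some ` allocs N i)"

lemma finite_stations [simp]: "finite (stations i)" by (simp add: stations_def)

lemma station_in:
  assumes "good \<tau>" "i \<in> classes N" "c \<in> services i" "running c u \<tau>"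
  shows "station c \<tau> \<in> stations i"
  using assms decision_allocs[OF assms(1,2)] unfolding services_def stations_def by (auto simp: running_def)

lemma arr_Suc: "arr i (Suc n) \<tau> = arr i n \<tau> + \<tau> (Interarrival i (Suc n))"
  by (simp add: arrival_time_def)

lemma arr_mono:
  assumes "good \<tau>" "i \<in> classes N" "m < n"
  shows "arr i m \<tau> < arr i n \<tau>"
  using assms(3)
proof (induction n)
  case (Suc n)
  have "arr i n \<tau> < arr i (Suc n) \<tau>" using goodD(1)[OF assms(1)] assms(2) by (simp add: arr_Suc in_clocks)
  then show ?case using Suc by (cases "m = n") auto
qed simp

lemma start_Interarrival: "start (Interarrival i n) \<tau> = (case n of 0 \<Rightarrow> 0 | Suc m \<Rightarrow> arr i m \<tau>)"
  by (cases n) (simp_all add: arrival_time_def lessThan_Suc_atMost)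

text \<open>The running intervals of the interarrival clocks tile the positive half line. Hence
  exactly one of them is running at any time, and the total arrival intensity is constant.\<close>

lemma running_Interarrival:
  assumes g: "good \<tau>" and i: "i \<in> classes N" and u: "0 < u"
  obtains n where "{c \<in> range (Interarrival i). running c u \<tau>} = {Interarrival i n}"
proof -
  have fin: "finite {n. arr i n \<tau> < u}" by (rule goodD(4)[OF g i])
  obtain k where k: "\<not> arr i k \<tau> < u"
    using ex_new_if_finite[OF infinite_UNIV_nat fin] by blast
  define n where "n = (LEAST k. \<not> arr i k \<tau> < u)"
  have n: "\<not> arr i n \<tau> < u" unfolding n_def by (rule LeastI, rule k)
  have less: "arr i m \<tau> < u" if "m < n" for m using not_less_Least[of m] that unfolding n_def by blast
  have "running (Interarrival i m) u \<tau> \<longleftrightarrow> m = n" for m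
  proof (cases m n rule: linorder_cases)
    case less: less
    then show ?thesis using \<open>\<And>m. m < n \<Longrightarrow> arr i m \<tau> < u\<close>[OF less] by (simp add: running_def ring_Interarrival)
  next
    case equal
    then show ?thesis using n u less
      by (cases n) (simp_all add: running_def ring_Interarrival start_Interarrival not_less del: start.simps(1))
  next
    case greater
    then obtain m' where m': "m = Suc m'" "n \<le> m'" by (cases m) auto
    have "arr i n \<tau> \<le> arr i m' \<tau>" using arr_mono[OF g i, of n m'] m' by (cases "n = m'") auto
    then show ?thesis using n greater by (simp add: running_def start_Interarrival m' del: start.simps(1))
  qed
  then have "{c \<in> range (Interarrival i). running c u \<tau>} = {Interarrival i n}" by auto
  then show ?thesis by (rule that)
qed

text \<open>The rates of the running clocks add up to the shape of a generator: one interarrival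
  clock, and at each station as many service clocks as the state says.\<close>

lemma sum_running:
  fixes G :: "clock \<Rightarrow> real"
  assumes g: "good \<tau>" and i: "i \<in> classes N" and u: "0 < u"
    and a: "\<And>n. G (Interarrival i n) = a"
    and b: "\<And>c. c \<in> services i \<Longrightarrow> running c u \<tau> \<Longrightarrow> G c = b (station c \<tau>)"
    and nonneg: "\<And>c. 0 \<le> G c"
  shows "(\<integral>\<^sup>+c. ennreal (clock_rate N c) * (if running c u \<tau> then ennreal (G c) else 0) \<partial>count_space (class_clocks i))
    = ennreal (arrival_rate N i * a + service_rate N i * (\<Sum>q\<in>stations i. real (z i u \<tau> q) * b q))"
proof -
  obtain n where n: "{c \<in> range (Interarrival i). running c u \<tau>} = {Interarrival i n}"
    by (rule running_Interarrival[OF g i u])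
  define R where "R = {c \<in> services i. running c u \<tau>}"
  have finR: "finite R" unfolding R_def
    by (rule finite_subset[OF _ finite_started[OF g i, of u]]) (auto simp: running_def)
  have notin: "Interarrival i n \<notin> R" by (auto simp: R_def services_def)
  have runI: "running (Interarrival i n) u \<tau>" using n by blast
  have "(\<integral>\<^sup>+c. ennreal (clock_rate N c) * (if running c u \<tau> then ennreal (G c) else 0) \<partial>count_space (class_clocks i))
      = (\<Sum>c\<in>insert (Interarrival i n) R. ennreal (clock_rate N c) * (if running c u \<tau> then ennreal (G c) else 0))"
  proof (rule nn_integral_count_space')
    show "ennreal (clock_rate N c) * (if running c u \<tau> then ennreal (G c) else 0) = 0"
      if "c \<in> class_clocks i" "c \<notin> insert (Interarrival i n) R" for c
    proof -
      have "\<not> running c u \<tau>"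
        using that n unfolding class_clocks_def R_def by blast
      then show ?thesis by simp
    qed
    show "insert (Interarrival i n) R \<subseteq> class_clocks i" unfolding class_clocks_def R_def by blast
  qed (use finR in simp)
  also have "\<dots> = ennreal (arrival_rate N i * a) + (\<Sum>c\<in>R. ennreal (service_rate N i * b (station c \<tau>)))"
  proof -
    have "ennreal (clock_rate N c) * (if running c u \<tau> then ennreal (G c) else 0)
        = ennreal (service_rate N i * b (station c \<tau>))" if "c \<in> R" for c
    proof -
      have "clock_rate N c = service_rate N i" using that unfolding R_def services_def by auto
      moreover have "running c u \<tau>" "c \<in> services i" using that unfolding R_def by auto
      ultimately show ?thesis using b[of c] nonneg[of c] rates[OF i] by (simp add: ennreal_mult'')
    qed
    moreover have "ennreal (arrival_rate N i) * ennreal a = ennreal (arrival_rate N i * a)"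
      using a[of n] nonneg[of "Interarrival i n"] by (simp add: ennreal_mult'')
    ultimately show ?thesis using finR notin runI by (simp add: a)
  qed
  also have "(\<Sum>c\<in>R. ennreal (service_rate N i * b (station c \<tau>)))
      = ennreal (\<Sum>c\<in>R. service_rate N i * b (station c \<tau>))"
  proof (intro sum_ennreal mult_nonneg_nonneg)
    fix c assume "c \<in> R"
    then have "G c = b (station c \<tau>)" using b by (simp add: R_def)
    then show "0 \<le> b (station c \<tau>)" using nonneg[of c] by simp
  qed (use rates[OF i] in simp)
  also have "(\<Sum>c\<in>R. service_rate N i * b (station c \<tau>))
      = service_rate N i * (\<Sum>q\<in>stations i. real (z i u \<tau> q) * b q)"
  proof -
    have "(\<Sum>c\<in>R. b (station c \<tau>)) = (\<Sum>q\<in>stations i. \<Sum>c\<in>{c\<in>R. station c \<tau> = q}. b (station c \<tau>))"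
      by (rule sum.group[symmetric]) (use finR station_in[OF g i, of _ u] in \<open>auto simp: R_def\<close>)
    also have "\<dots> = (\<Sum>q\<in>stations i. real (card {c\<in>R. station c \<tau> = q}) * b q)"
      by (intro sum.cong refl) simp
    also have "\<dots> = (\<Sum>q\<in>stations i. real (z i u \<tau> q) * b q)"
      by (simp add: z_card[OF g i] R_def conj_assoc)
    finally show ?thesis by (simp add: sum_distrib_left[symmetric])
  qed
  finally show ?thesis
  proof -
    assume eq: "(\<integral>\<^sup>+c. ennreal (clock_rate N c) * (if running c u \<tau> then ennreal (G c) else 0) \<partial>count_space (class_clocks i)) = ennreal (arrival_rate N i * a) + ennreal (service_rate N i * (\<Sum>q\<in>stations i. real (z i u \<tau> q) * b q))"
    have "0 \<le> arrival_rate N i * a" using rates[OF i] nonneg[of "Interarrival i n"] a[of n] by simp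
    moreover have "0 \<le> (\<Sum>q\<in>stations i. real (z i u \<tau> q) * b q)"
    proof (rule sum_nonneg)
      fix q assume "q \<in> stations i"
      show "0 \<le> real (z i u \<tau> q) * b q"
      \<comment> \<open>A station with no running clock has weight 0; at any other station
        \<open>b\<close> is a value of \<open>G\<close> and thus nonnegative.\<close>
      proof (cases "z i u \<tau> q = 0")
        case False
        then have "{c \<in> services i. running c u \<tau> \<and> station c \<tau> = q} \<noteq> {}"
          unfolding z_card[OF g i] by (metis card.empty)
        then obtain c where "c \<in> services i" "running c u \<tau>" "station c \<tau> = q" by blast
        then show ?thesis using b[of c] nonneg[of c] by simp
      qed simp
    qed
    ultimately show ?thesis unfolding eq using rates[OF i] by (simp add: ennreal_plus)
  qed
qed

section \<open>Dependence on a single clock\<close>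

lemma start_upd [simp]: "start c (\<tau>(c := v)) = start c \<tau>"
  by (cases c) (auto simp: arrival_time_def)

lemma arr_upd:
  "arr i n (\<tau>(c := v)) = arr i n \<tau> + (case c of Interarrival i' m \<Rightarrow> if i' = i \<and> m \<le> n then v - \<tau> c else 0 | _ \<Rightarrow> 0)"
proof (cases c)
  case (Interarrival i' m)
  show ?thesis
  proof (cases "i' = i \<and> m \<le> n")
    case True
    have "arr i n (\<tau>(c := v)) = v + (\<Sum>p\<in>{..n} - {m}. \<tau> (Interarrival i p))"
      unfolding arrival_time_def using True Interarrival
      by (subst sum.remove[of _ m]) (auto intro!: sum.cong)
    moreover have "arr i n \<tau> = \<tau> c + (\<Sum>p\<in>{..n} - {m}. \<tau> (Interarrival i p))"
      unfolding arrival_time_def using True Interarrival by (subst sum.remove[of _ m]) auto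
    ultimately show ?thesis using True Interarrival by simp
  qed (use Interarrival in \<open>auto simp: arrival_time_def intro!: sum.cong\<close>)
qed (auto simp: arrival_time_def)

lemma good_upd:
  assumes g: "good \<tau>" and v: "0 < v"
  shows "good (\<tau>(c := v))"
  unfolding good_def
proof
  show "\<forall>c'\<in>clocks N y0. 0 < (\<tau>(c := v)) c'" using goodD(1)[OF g] v by simp
  show "locally_finite cval (\<tau>(c := v))"
    unfolding locally_finite_def
  proof (intro ballI allI)
    fix i t assume i: "i \<in> classes N"
    have le: "arr i n \<tau> \<le> arr i n (\<tau>(c := v)) + \<bar>v - \<tau> c\<bar>" for n
      unfolding arr_upd by (cases c) auto
    have "{n. arr i n (\<tau>(c := v)) \<le> t} \<subseteq> {n. arr i n \<tau> \<le> t + \<bar>v - \<tau> c\<bar>}"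
    proof (intro Collect_mono impI)
      fix n assume "arr i n (\<tau>(c := v)) \<le> t"
      then show "arr i n \<tau> \<le> t + \<bar>v - \<tau> c\<bar>" using le[of n] by linarith
    qed
    then show "finite {n. arr i n (\<tau>(c := v)) \<le> t}"
      using goodD(3)[OF g i, of "t + \<bar>v - \<tau> c\<bar>"] by (rule finite_subset)
  qed
qed

text \<open>Before time \<open>u\<close> a clock that rings at \<open>u\<close> or later is visible
  only by not having rung. If it is an interarrival clock, its own arrival and all later ones of the
  class occur at \<open>u\<close> or later for both values.\<close>

lemma agree_upd:
  assumes g: "good \<tau>" and v: "0 < v" "0 < v'" and c: "c \<in> clocks N y0"
    and u: "u \<le> start c \<tau> + v" "u \<le> start c \<tau> + v'"
  shows "agree u cval (\<tau>(c := v)) cval (\<tau>(c := v'))"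
proof -
  have later: "u \<le> arr i n (\<tau>(Interarrival i m := x))"
    if "i \<in> classes N" "m \<le> n" "0 < x" "u \<le> start (Interarrival i m) \<tau> + x" for i m n x
  proof -
    have g': "good (\<tau>(Interarrival i m := x))" by (rule good_upd[OF g that(3)])
    have "arr i m (\<tau>(Interarrival i m := x)) = start (Interarrival i m) \<tau> + x"
      using ring_Interarrival[of i m "\<tau>(Interarrival i m := x)"] by (simp only: ring_def start_upd fun_upd_same)
    moreover have "arr i m (\<tau>(Interarrival i m := x)) \<le> arr i n (\<tau>(Interarrival i m := x))"
      using arr_mono[OF g' that(1), of m n] that(2) by (cases "m = n") auto
    ultimately show ?thesis using that(4) by simp
  qed
  show ?thesis
  proof (cases c)
    case (Interarrival i0 m)
    have i0: "i0 \<in> classes N" using c Interarrival by (simp add: in_clocks)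
    show ?thesis unfolding agree_def
    proof (intro ballI conjI allI impI)
      fix i n assume i: "i \<in> classes N"
      assume less: "arr i n (\<tau>(c := v)) < u \<or> arr i n (\<tau>(c := v')) < u"
      have ne: "\<not> (i0 = i \<and> m \<le> n)"
        using later[of i m n v] later[of i m n v'] i v u less Interarrival by auto
      then show eq: "arr i n (\<tau>(c := v)) = arr i n (\<tau>(c := v'))"
        by (auto simp: arr_upd Interarrival)
      fix w
      show "(w \<le> arr i n (\<tau>(c := v)) + (\<tau>(c := v)) (Net_Service i n)) =
            (w \<le> arr i n (\<tau>(c := v')) + (\<tau>(c := v')) (Net_Service i n))"
        unfolding eq by (simp add: Interarrival)
      show "(w \<le> arr i n (\<tau>(c := v)) + (\<tau>(c := v)) (Fict_Service i n)) =
            (w \<le> arr i n (\<tau>(c := v')) + (\<tau>(c := v')) (Fict_Service i n))"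
        unfolding eq by (simp add: Interarrival)
    qed (simp add: Interarrival)
  next
    case (Net_Service i0 m)
    then show ?thesis using u unfolding agree_def by (auto simp: arr_upd)
  next
    case (Fict_Service i0 m)
    then show ?thesis using u unfolding agree_def by (auto simp: arr_upd)
  next
    case (Init_Service i0 m)
    then show ?thesis using u unfolding agree_def by (auto simp: arr_upd)
  qed
qed

text \<open>Combines \<open>agree_upd\<close> with uniqueness of the decisions. The strict
  inequality between \<open>start c \<tau>\<close> and \<open>u\<close> ensures that the decision
  activating a service clock is taken before \<open>u\<close>, so it does not depend on the value of
  this clock either.\<close>

lemma causal:
  assumes g: "good \<tau>" and v: "0 < v" "0 < v'" and c: "c \<in> clocks N y0"
    and u: "start c \<tau> < u" "u \<le> start c \<tau> + v" "u \<le> start c \<tau> + v'"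
  defines "\<tau>1 \<equiv> \<tau>(c := v)" and "\<tau>2 \<equiv> \<tau>(c := v')"
  shows "X u \<tau>1 = X u \<tau>2" "Y u \<tau>1 = Y u \<tau>2" "active c \<tau>1 = active c \<tau>2" "station c \<tau>1 = station c \<tau>2"
    "z i u \<tau>1 = z i u \<tau>2" "after c u \<tau>1 = after c u \<tau>2" "running c u \<tau>1 = running c u \<tau>2"
proof -
  have ag: "agree u cval \<tau>1 cval \<tau>2" unfolding \<tau>1_def \<tau>2_def by (rule agree_upd[OF g v c u(2,3)])
  have g12: "good \<tau>1" "good \<tau>2" unfolding \<tau>1_def \<tau>2_def using good_upd[OF g] v by auto
  have D: "decision i n \<tau>1 = decision i n \<tau>2" if "i \<in> classes N" "arr i n \<tau>1 < u" for i n
    by (rule fixpt_unique[OF fixpt_decision fixpt_decision _ ag that]) (use g12 in \<open>auto dest: goodD(2)\<close>)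
  show XY: "X u \<tau>1 = X u \<tau>2" "Y u \<tau>1 = Y u \<tau>2"
    using agree_counts[OF ag order_refl, of decision decision] D by auto
  show z: "z i u \<tau>1 = z i u \<tau>2" for i unfolding z_def XY by simp
  have st: "start c \<tau>1 = start c \<tau>" "start c \<tau>2 = start c \<tau>" by (simp_all add: \<tau>1_def \<tau>2_def)
  have act: "active c \<tau>1 = active c \<tau>2 \<and> station c \<tau>1 = station c \<tau>2"
    using c u(1) D unfolding st(1)[symmetric] by (cases c) (auto simp: in_clocks)
  then show "active c \<tau>1 = active c \<tau>2" "station c \<tau>1 = station c \<tau>2" by auto
  show "after c u \<tau>1 = after c u \<tau>2" using act by (cases c) (simp_all add: after_def XY z)
  show "running c u \<tau>1 = running c u \<tau>2" using act u by (simp add: running_def ring_def st, simp add: \<tau>1_def \<tau>2_def)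
qed

end

section \<open>Measurability\<close>

text \<open>A countable set containing all counts, which vanish off the index ranges. Over a
  countable state space the decision rule and every test function are measurable.\<close>

definition net_states :: "loss_network \<Rightarrow> (nat \<Rightarrow> nat \<Rightarrow> nat) set" where
  "net_states N = {x. \<forall>i j. \<not> (i \<in> classes N \<and> j \<in> allocs N i) \<longrightarrow> x i j = 0}"

definition fict_states :: "loss_network \<Rightarrow> (nat \<Rightarrow> nat) set" where
  "fict_states N = {y. \<forall>i. i \<notin> classes N \<longrightarrow> y i = 0}"

lemma countable_finitely_supported:
  assumes "finite A"
  shows "countable {f :: 'b \<Rightarrow> nat. \<forall>a. a \<notin> A \<longrightarrow> f a = 0}"
proof (rule countable_image_inj_on)
  show "countable ((\<lambda>f. restrict f A) ` {f :: 'b \<Rightarrow> nat. \<forall>a. a \<notin> A \<longrightarrow> f a = 0})"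
    by (rule countable_subset[OF _ countable_PiE[OF assms, of "\<lambda>_. UNIV"]]) auto
  show "inj_on (\<lambda>f. restrict f A) {f :: 'b \<Rightarrow> nat. \<forall>a. a \<notin> A \<longrightarrow> f a = 0}"
  proof (rule inj_onI, rule ext)
    fix f g :: "'b \<Rightarrow> nat" and a
    assume "f \<in> {f. \<forall>a. a \<notin> A \<longrightarrow> f a = 0}" "g \<in> {f. \<forall>a. a \<notin> A \<longrightarrow> f a = 0}" "restrict f A = restrict g A"
    then show "f a = g a" by (cases "a \<in> A") (auto dest: fun_cong[of _ _ a])
  qed
qed

lemma countable_fict_states: "countable (fict_states N)"
  unfolding fict_states_def by (intro countable_finitely_supported) simp

lemma countable_net_states: "countable (net_states N)"
proof (rule countable_image_inj_on)
  let ?A = "SIGMA i : classes N. allocs N i"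
  show "countable (case_prod ` net_states N)"
    by (rule countable_subset[OF _ countable_finitely_supported[of ?A]]) (auto simp: net_states_def)
  show "inj_on case_prod (net_states N)" by (auto simp: inj_on_def fun_eq_iff)
qed

lemma measurable_count_space_compose2:
  assumes "f \<in> measurable M (count_space A)" "countable A" "g \<in> measurable M (count_space B)" "countable B"
    and F: "\<And>a b. F a b \<in> measurable M K"
  shows "(\<lambda>\<omega>. F (f \<omega>) (g \<omega>) \<omega>) \<in> measurable M K"
proof (rule measurable_compose_countable'[OF _ assms(1,2)])
  fix a assume "a \<in> A"
  show "(\<lambda>\<omega>. F a (g \<omega>) \<omega>) \<in> measurable M K"
    by (rule measurable_compose_countable'[OF F assms(3,4)])
qed

lemma measurable_arrival_time:
  assumes "\<And>c. c \<in> clocks N y0 \<Longrightarrow> T c \<in> borel_measurable M" "i \<in> classes N"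
  shows "arrival_time T i n \<in> borel_measurable M"
  unfolding arrival_time_def[abs_def] using assms by (intro borel_measurable_sum) (simp add: in_clocks)

text \<open>The presence predicate is left general, to cover both the left limits seen by arrivals
  and the right-continuous counts in the reward rate.\<close>

lemma measurable_counts:
  assumes D: "\<And>i n. i \<in> classes N \<Longrightarrow> D i n \<in> measurable M (count_space UNIV)"
    and P: "\<And>i n. i \<in> classes N \<Longrightarrow>
        {\<omega> \<in> space M. P \<omega> (arrival_time T i n \<omega>) (T (Net_Service i n) \<omega>)} \<in> sets M"
      "\<And>i n. i \<in> classes N \<Longrightarrow>
        {\<omega> \<in> space M. P \<omega> (arrival_time T i n \<omega>) (T (Fict_Service i n) \<omega>)} \<in> sets M"
      "\<And>i n. i \<in> classes N \<Longrightarrow> n < y0 i \<Longrightarrow> {\<omega> \<in> space M. P \<omega> 0 (T (Init_Service i n) \<omega>)} \<in> sets M"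
  shows "(\<lambda>\<omega>. net_count N T D (P \<omega>) \<omega>) \<in> measurable M (count_space (net_states N))"
    and "(\<lambda>\<omega>. fict_count N y0 T D (P \<omega>) \<omega>) \<in> measurable M (count_space (fict_states N))"
proof -
  have Dq: "{\<omega> \<in> space M. D i n \<omega> = q} \<in> sets M" if "i \<in> classes N" for i n q
    using measurable_sets[OF D[OF that], of "{q}"] by (simp add: vimage_def Int_def conj_commute)
  have conj: "{\<omega> \<in> space M. D i n \<omega> = q \<and> R \<omega>} \<in> sets M"
    if "i \<in> classes N" "{\<omega> \<in> space M. R \<omega>} \<in> sets M" for i n q R
  proof -
    have "{\<omega> \<in> space M. D i n \<omega> = q \<and> R \<omega>} = {\<omega> \<in> space M. D i n \<omega> = q} \<inter> {\<omega> \<in> space M. R \<omega>}"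
      by blast
    then show ?thesis using sets.Int[OF Dq[OF that(1), of n q] that(2)] by (simp only:)
  qed
  have x: "(\<lambda>\<omega>. net_count N T D (P \<omega>) \<omega> i j) \<in> measurable M (count_space UNIV)" for i j
  proof (cases "i \<in> classes N \<and> j \<in> allocs N i")
    case True
    have "(\<lambda>\<omega>. card {n. D i n \<omega> = Some j \<and> P \<omega> (arrival_time T i n \<omega>) (T (Net_Service i n) \<omega>)})
        \<in> measurable M (count_space UNIV)"
      using True by (intro measurable_card) (simp add: conj P(1))
    then show ?thesis using True by (simp add: net_count_def)
  qed (auto simp: net_count_def)
  have "{\<omega> \<in> space M. \<forall>i\<in>classes N. \<forall>j\<in>allocs N i. net_count N T D (P \<omega>) \<omega> i j = a i j} \<in> sets M" for a
  proof -
    have "{\<omega> \<in> space M. net_count N T D (P \<omega>) \<omega> i j = a i j} \<in> sets M" for i j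
      using measurable_sets[OF x[of i j], of "{a i j}"] by (simp add: vimage_def Int_def conj_commute)
    then show ?thesis by (intro sets.sets_Collect_finite_All finite_classes finite_allocs)
  qed
  moreover have "(\<lambda>\<omega>. net_count N T D (P \<omega>) \<omega>) -` {a} \<inter> space M
      = {\<omega> \<in> space M. \<forall>i\<in>classes N. \<forall>j\<in>allocs N i. net_count N T D (P \<omega>) \<omega> i j = a i j}"
    if "a \<in> net_states N" for a
  proof -
    have "net_count N T D (P \<omega>) \<omega> = a"
      if eq: "\<forall>i\<in>classes N. \<forall>j\<in>allocs N i. net_count N T D (P \<omega>) \<omega> i j = a i j" for \<omega>
    proof (intro ext)
      fix i j
      show "net_count N T D (P \<omega>) \<omega> i j = a i j"
      proof (cases "i \<in> classes N \<and> j \<in> allocs N i")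
        case False
        then have "a i j = 0" using \<open>a \<in> net_states N\<close> unfolding net_states_def by blast
        then show ?thesis using False unfolding net_count_def by (simp only: if_False)
      qed (use eq in blast)
    qed
    then show ?thesis by blast
  qed
  ultimately show "(\<lambda>\<omega>. net_count N T D (P \<omega>) \<omega>) \<in> measurable M (count_space (net_states N))"
    unfolding measurable_count_space_eq_countable[OF countable_net_states]
  proof (intro conjI ballI funcsetI)
    show "net_count N T D (P \<omega>) \<omega> \<in> net_states N" for \<omega>
      unfolding net_states_def net_count_def by simp
  qed simp
  have y: "(\<lambda>\<omega>. fict_count N y0 T D (P \<omega>) \<omega> i) \<in> measurable M (count_space UNIV)" for i
  proof (cases "i \<in> classes N")
    case True
    have init: "{\<omega> \<in> space M. n < y0 i \<and> P \<omega> 0 (T (Init_Service i n) \<omega>)} \<in> sets M" for n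
    proof (cases "n < y0 i")
      case less: True
      have eq: "{\<omega> \<in> space M. n < y0 i \<and> P \<omega> 0 (T (Init_Service i n) \<omega>)}
          = {\<omega> \<in> space M. P \<omega> 0 (T (Init_Service i n) \<omega>)}"
        by (simp only: less simp_thms)
      show ?thesis unfolding eq by (rule P(3)[OF True less])
    next
      case False
      then have eq: "{\<omega> \<in> space M. n < y0 i \<and> P \<omega> 0 (T (Init_Service i n) \<omega>)} = {}" by blast
      show ?thesis unfolding eq by (rule sets.empty_sets)
    qed
    let ?g = "\<lambda>\<omega>. card {n. n < y0 i \<and> P \<omega> 0 (T (Init_Service i n) \<omega>)}"
    let ?f = "\<lambda>\<omega>. card {n. D i n \<omega> = None \<and> P \<omega> (arrival_time T i n \<omega>) (T (Fict_Service i n) \<omega>)}"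
    have g: "?g \<in> measurable M (count_space UNIV)"
      by (rule measurable_card) (simp only: mem_Collect_eq init)
    have f: "?f \<in> measurable M (count_space UNIV)"
      by (rule measurable_card) (simp only: mem_Collect_eq conj[OF True P(2)[OF True]])
    have "(\<lambda>\<omega>. ?f \<omega> + ?g \<omega>) \<in> measurable M (count_space UNIV)"
      by (rule measurable_count_space_compose2[where F="\<lambda>a b \<omega>. a + b", OF f _ g]) auto
    then show ?thesis unfolding fict_count_def using True by (simp only: if_True)
  qed (simp add: fict_count_def)
  have "{\<omega> \<in> space M. \<forall>i\<in>classes N. fict_count N y0 T D (P \<omega>) \<omega> i = a i} \<in> sets M" for a
  proof -
    have "{\<omega> \<in> space M. fict_count N y0 T D (P \<omega>) \<omega> i = a i} \<in> sets M" for i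
      using measurable_sets[OF y[of i], of "{a i}"] by (simp add: vimage_def Int_def conj_commute)
    then show ?thesis by (intro sets.sets_Collect_finite_All finite_classes)
  qed
  moreover have "(\<lambda>\<omega>. fict_count N y0 T D (P \<omega>) \<omega>) -` {a} \<inter> space M
      = {\<omega> \<in> space M. \<forall>i\<in>classes N. fict_count N y0 T D (P \<omega>) \<omega> i = a i}"
    if "a \<in> fict_states N" for a
  proof -
    have "fict_count N y0 T D (P \<omega>) \<omega> = a"
      if eq: "\<forall>i\<in>classes N. fict_count N y0 T D (P \<omega>) \<omega> i = a i" for \<omega>
    proof (intro ext)
      fix i
      show "fict_count N y0 T D (P \<omega>) \<omega> i = a i"
      proof (cases "i \<in> classes N")
        case False
        then have "a i = 0" using \<open>a \<in> fict_states N\<close> unfolding fict_states_def by blast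
        then show ?thesis using False unfolding fict_count_def by (simp only: if_False)
      qed (use eq in blast)
    qed
    then show ?thesis by blast
  qed
  ultimately show "(\<lambda>\<omega>. fict_count N y0 T D (P \<omega>) \<omega>) \<in> measurable M (count_space (fict_states N))"
    unfolding measurable_count_space_eq_countable[OF countable_fict_states]
  proof (intro conjI ballI funcsetI)
    show "fict_count N y0 T D (P \<omega>) \<omega> \<in> fict_states N" for \<omega>
      unfolding fict_states_def fict_count_def by simp
  qed simp
qed

lemma measurable_counts_present_before:
  assumes T: "\<And>c. c \<in> clocks N y0 \<Longrightarrow> T c \<in> borel_measurable M"
    and D: "\<And>i n. i \<in> classes N \<Longrightarrow> D i n \<in> measurable M (count_space UNIV)"
    and u: "u \<in> borel_measurable M"
  shows "(\<lambda>\<omega>. net_count N T D (present_before (u \<omega>)) \<omega>) \<in> measurable M (count_space (net_states N))"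
    and "(\<lambda>\<omega>. fict_count N y0 T D (present_before (u \<omega>)) \<omega>) \<in> measurable M (count_space (fict_states N))"
proof -
  have [measurable]: "u \<in> borel_measurable M" by (rule u)
  have P: "{\<omega> \<in> space M. present_before (u \<omega>) (a \<omega>) (b \<omega>)} \<in> sets M"
    if [measurable]: "a \<in> borel_measurable M" "b \<in> borel_measurable M" for a b
    unfolding present_before_def by measurable
  note P' = P[OF measurable_arrival_time[OF T] T] P[OF borel_measurable_const T]
  show "(\<lambda>\<omega>. net_count N T D (present_before (u \<omega>)) \<omega>) \<in> measurable M (count_space (net_states N))"
    by (rule measurable_counts(1)[OF D, where ?y0.0 = y0]) (auto intro!: P' simp: in_clocks)
  show "(\<lambda>\<omega>. fict_count N y0 T D (present_before (u \<omega>)) \<omega>) \<in> measurable M (count_space (fict_states N))"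
    by (rule measurable_counts(2)[OF D]) (auto intro!: P' simp: in_clocks)
qed

lemma emeasure_exponential_tail:
  assumes "0 < l" "0 \<le> a"
  shows "emeasure (density lborel (\<lambda>x. ennreal (exponential_density l x))) {a..} = ennreal (exp (- l * a))"
proof -
  have "emeasure (density lborel (\<lambda>x. ennreal (exponential_density l x))) {a..}
      = (\<integral>\<^sup>+x. ennreal (l * exp (- l * x)) * indicator {a..} x \<partial>lborel)"
    using assms by (subst emeasure_density)
      (auto intro!: nn_integral_cong simp: exponential_density_def indicator_def algebra_simps)
  also have "\<dots> = ennreal (0 - (- exp (- l * a)))"
  proof (rule nn_integral_FTC_atLeast)
    show "((\<lambda>x. - exp (- l * x)) has_real_derivative l * exp (- l * x)) (at x)" for x
      by (auto intro!: derivative_eq_intros)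
    have "((\<lambda>x. - exp (- (l * x))) \<longlongrightarrow> - 0) at_top"
      by (intro tendsto_minus filterlim_compose[OF exp_at_bot] filterlim_uminus_at_top_at_bot
        filterlim_compose[OF filterlim_uminus_at_bot_at_top]
        filterlim_tendsto_pos_mult_at_top[OF tendsto_const assms(1) filterlim_ident])
    then show "((\<lambda>x. - exp (- l * x)) \<longlongrightarrow> 0) at_top" by simp
  qed (use assms in auto)
  finally show ?thesis by simp
qed

context loss_dynamics begin

abbreviation borel_clocks :: "(clock \<Rightarrow> real) measure" where
  "borel_clocks \<equiv> PiM (clocks N y0) (\<lambda>_. borel)"

lemma measurable_clock [measurable (raw)]: "c \<in> clocks N y0 \<Longrightarrow> (\<lambda>\<tau>. \<tau> c) \<in> borel_measurable borel_clocks"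
  by (rule measurable_component_singleton)

lemma measurable_arr: "i \<in> classes N \<Longrightarrow> arr i n \<in> borel_measurable borel_clocks"
  by (rule measurable_arrival_time) (rule measurable_clock)

lemma measurable_start: "c \<in> clocks N y0 \<Longrightarrow> start c \<in> borel_measurable borel_clocks"
proof -
  have "start (Interarrival i n) = (\<lambda>\<tau>. \<Sum>p<n. \<tau> (Interarrival i p))" "start (Net_Service i n) = arr i n"
    "start (Fict_Service i n) = arr i n" "start (Init_Service i n) = (\<lambda>_. 0)" for i n
    by (simp_all add: fun_eq_iff)
  moreover assume "c \<in> clocks N y0"
  ultimately show ?thesis
    using measurable_arr by (cases c) (simp_all add: in_clocks borel_measurable_sum measurable_clock)
qed

lemma measurable_ring: "c \<in> clocks N y0 \<Longrightarrow> ring c \<in> borel_measurable borel_clocks"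
  unfolding ring_def[abs_def] by (intro borel_measurable_add measurable_start measurable_clock)

lemma measurable_decision_iter: "i \<in> classes N \<Longrightarrow> decision_iter m i n \<in> measurable borel_clocks (count_space UNIV)"
proof (induction m arbitrary: i n)
  case (Suc m)
  note c = measurable_counts_present_before[OF measurable_clock Suc.IH measurable_arr[OF Suc.prems, of n]]
  show ?case unfolding decision_iter.simps
    by (rule measurable_count_space_compose2[OF c(1) countable_net_states c(2) countable_fict_states]) auto
qed simp

lemma measurable_rank: "i \<in> classes N \<Longrightarrow> rank cval i n \<in> measurable borel_clocks (count_space UNIV)"
proof -
  assume i: "i \<in> classes N"
  have "(\<lambda>\<tau>. real (card {n'. arr i' n' \<tau> < arr i n \<tau>})) \<in> borel_measurable borel_clocks" if i': "i' \<in> classes N" for i'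
  proof -
    have "{\<tau> \<in> space borel_clocks. n' \<in> {n'. arr i' n' \<tau> < arr i n \<tau>}} \<in> sets borel_clocks" for n'
      unfolding mem_Collect_eq by (rule borel_measurable_less[OF measurable_arr[OF i'] measurable_arr[OF i]])
    then show ?thesis by (intro measurable_compose[OF measurable_card, where g=real]) simp_all
  qed
  then have "(\<lambda>\<tau>. \<Sum>i'\<in>classes N. real (card {n'. arr i' n' \<tau> < arr i n \<tau>})) \<in> borel_measurable borel_clocks"
    by (rule borel_measurable_sum)
  then have "(\<lambda>\<tau>. nat \<lfloor>\<Sum>i'\<in>classes N. real (card {n'. arr i' n' \<tau> < arr i n \<tau>})\<rfloor>) \<in> measurable borel_clocks (count_space UNIV)"
    by measurable
  moreover have "nat \<lfloor>\<Sum>i'\<in>classes N. real (card {n'. arr i' n' \<tau> < arr i n \<tau>})\<rfloor> = rank cval i n \<tau>" for \<tau>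
    unfolding rank_def of_nat_sum[symmetric] by (simp only: floor_of_nat nat_int)
  ultimately show ?thesis by (simp cong: measurable_cong)
qed

lemma measurable_decision: "i \<in> classes N \<Longrightarrow> decision i n \<in> measurable borel_clocks (count_space UNIV)"
  unfolding decision_def[abs_def]
  by (rule measurable_compose_countable[OF measurable_decision_iter measurable_rank])

abbreviation time_clocks :: "(real \<times> (clock \<Rightarrow> real)) measure" where
  "time_clocks \<equiv> borel \<Otimes>\<^sub>M borel_clocks"

text \<open>Joint measurability in time and clock values, as required for exchanging the time
  integral with the expectation.\<close>

lemma measurable_XY:
  "(\<lambda>p. X (fst p) (snd p)) \<in> measurable time_clocks (count_space (net_states N))"
  "(\<lambda>p. Y (fst p) (snd p)) \<in> measurable time_clocks (count_space (fict_states N))"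
proof -
  have 1: "(\<lambda>p. snd p c) \<in> borel_measurable time_clocks" if "c \<in> clocks N y0" for c
    by (rule measurable_compose[OF measurable_snd measurable_clock[OF that]])
  have 2: "(\<lambda>p. decision i n (snd p)) \<in> measurable time_clocks (count_space UNIV)" if "i \<in> classes N" for i n
    by (rule measurable_compose[OF measurable_snd measurable_decision[OF that]])
  note c = measurable_counts_present_before[of N y0 "\<lambda>c p. snd p c" time_clocks "\<lambda>i n p. decision i n (snd p)" fst, OF 1 2 measurable_fst]
  have "net_count N (\<lambda>c p. snd p c) (\<lambda>i n p. decision i n (snd p)) P p = net_count N cval decision P (snd p)" for P and p :: "real \<times> (clock \<Rightarrow> real)"
    by (simp add: net_count_def arrival_time_def fun_eq_iff)
  then show "(\<lambda>p. X (fst p) (snd p)) \<in> measurable time_clocks (count_space (net_states N))" using c(1) by simp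
  have "fict_count N y0 (\<lambda>c p. snd p c) (\<lambda>i n p. decision i n (snd p)) P p = fict_count N y0 cval decision P (snd p)" for P and p :: "real \<times> (clock \<Rightarrow> real)"
    by (simp add: fict_count_def arrival_time_def fun_eq_iff)
  then show "(\<lambda>p. Y (fst p) (snd p)) \<in> measurable time_clocks (count_space (fict_states N))" using c(2) by simp
qed

lemma measurable_state:
  assumes "\<And>x y. H x y \<in> measurable time_clocks K"
  shows "(\<lambda>p. H (X (fst p) (snd p)) (Y (fst p) (snd p)) p) \<in> measurable time_clocks K"
  by (rule measurable_count_space_compose2[OF measurable_XY(1) countable_net_states measurable_XY(2) countable_fict_states assms])

lemma measurable_station:
  assumes c: "c \<in> clocks N y0"
  shows "station c \<in> measurable borel_clocks (count_space UNIV)"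
proof -
  have "station (Interarrival i n) = (\<lambda>_. None)" "station (Net_Service i n) = decision i n"
    "station (Fict_Service i n) = (\<lambda>_. None)" "station (Init_Service i n) = (\<lambda>_. None)" for i n
    by (simp_all add: fun_eq_iff)
  then show ?thesis using c measurable_decision by (cases c) (simp_all add: in_clocks)
qed

lemma measurable_active:
  assumes c: "c \<in> clocks N y0"
  shows "active c \<in> measurable borel_clocks (count_space UNIV)"
proof -
  have "(\<lambda>\<tau>. f (decision i n \<tau>)) \<in> measurable borel_clocks (count_space UNIV)" if "i \<in> classes N" for i n f
    by (rule measurable_compose[OF measurable_decision[OF that]]) simp
  moreover have "active (Interarrival i n) = (\<lambda>_. True)" "active (Net_Service i n) = (\<lambda>\<tau>. decision i n \<tau> \<noteq> None)"
    "active (Fict_Service i n) = (\<lambda>\<tau>. decision i n \<tau> = None)" "active (Init_Service i n) = (\<lambda>_. True)" for i n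
    by (simp_all add: fun_eq_iff)
  ultimately show ?thesis using c by (cases c) (simp_all add: in_clocks)
qed

lemma measurable_z: "(\<lambda>p. f (z i (fst p) (snd p))) \<in> measurable time_clocks (count_space UNIV)"
  unfolding z_def[abs_def] by (rule measurable_state) simp

lemma measurable_after:
  assumes "c \<in> clocks N y0"
  shows "(\<lambda>p. f (after c (fst p) (snd p))) \<in> measurable time_clocks (count_space UNIV)"
proof -
  define zz where "zz x y = (\<lambda>q. case q of None \<Rightarrow> y (clock_class c) | Some j \<Rightarrow> x (clock_class c) j)"
    for x :: "nat \<Rightarrow> nat \<Rightarrow> nat" and y :: "nat \<Rightarrow> nat"
  define H where "H x y s = f (case c of Interarrival _ _ \<Rightarrow>
      (zz x y)(dec (clock_class c) x y := Suc (zz x y (dec (clock_class c) x y)))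
    | _ \<Rightarrow> (zz x y)(s := zz x y s - 1))" for x y s
  have "(\<lambda>p. H (X (fst p) (snd p)) (Y (fst p) (snd p)) (station c (snd p))) \<in> measurable time_clocks (count_space UNIV)"
    by (rule measurable_state)
      (rule measurable_compose[OF measurable_compose[OF measurable_snd measurable_station[OF assms]]], simp)
  moreover have "H (X u \<tau>) (Y u \<tau>) (station c \<tau>) = f (after c u \<tau>)" for u \<tau>
  proof -
    have "zz (X u \<tau>) (Y u \<tau>) = z (clock_class c) u \<tau>" by (simp add: zz_def z_def fun_eq_iff)
    then show ?thesis by (cases c) (simp_all add: H_def after_def Let_def)
  qed
  ultimately show ?thesis by simp
qed

section \<open>The law of the clocks\<close>

text \<open>The rate 1 outside \<open>clocks N y0\<close> is a default which makes every factor a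
  probability measure.\<close>

definition clock_law :: "clock \<Rightarrow> real measure" where
  "clock_law c = density lborel (\<lambda>x. ennreal (exponential_density (if c \<in> clocks N y0 then clock_rate N c else 1) x))"

definition Q :: "(clock \<Rightarrow> real) measure" where
  "Q = PiM (clocks N y0) clock_law"

lemma rate_pos: "c \<in> clocks N y0 \<Longrightarrow> 0 < clock_rate N c"
  using rates by (cases c) (auto simp: in_clocks)

lemma clock_law_eq: "c \<in> clocks N y0 \<Longrightarrow> clock_law c = density lborel (\<lambda>x. ennreal (exponential_density (clock_rate N c) x))"
  by (simp add: clock_law_def)

lemma sets_clock_law [simp, measurable_cong]: "sets (clock_law c) = sets borel"
  by (simp add: clock_law_def)

lemma space_clock_law [simp]: "space (clock_law c) = UNIV"
  by (simp add: clock_law_def)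

lemma prob_space_clock_law: "prob_space (clock_law c)"
  unfolding clock_law_def by (rule prob_space_exponential_density) (simp add: rate_pos)

lemma sets_Q [simp, measurable_cong]: "sets Q = sets borel_clocks"
  unfolding Q_def by (intro sets_PiM_cong) simp_all

lemma space_Q: "space Q = space borel_clocks"
  by (rule sets_eq_imp_space_eq) simp

lemma prob_space_Q: "prob_space Q"
  unfolding Q_def by (intro prob_space_PiM prob_space_clock_law)

sublocale Q: prob_space Q by (rule prob_space_Q)

lemma measurable_upd:
  assumes c: "c \<in> clocks N y0"
  shows "(\<lambda>p. (fst p)(c := snd p)) \<in> measurable (borel_clocks \<Otimes>\<^sub>M borel) borel_clocks"
  using measurable_add_dim[of c "clocks N y0" "\<lambda>_. borel :: real measure"] c
  by (simp add: insert_absorb case_prod_beta')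

lemma measurable_upd_compose:
  assumes c: "c \<in> clocks N y0" and f: "f \<in> measurable M borel_clocks" and g: "g \<in> borel_measurable M"
  shows "(\<lambda>x. (f x)(c := g x)) \<in> measurable M borel_clocks"
proof -
  have "(\<lambda>x. (f x, g x)) \<in> measurable M (borel_clocks \<Otimes>\<^sub>M borel)"
    using f g by measurable
  from measurable_compose[OF this measurable_upd[OF c]] show ?thesis by simp
qed

text \<open>Under a product law, redrawing one coordinate independently of the others leaves the law
  unchanged.\<close>

lemma resample:
  assumes c: "c \<in> clocks N y0" and g: "g \<in> borel_measurable borel_clocks"
  shows "(\<integral>\<^sup>+\<tau>. g \<tau> \<partial>Q) = (\<integral>\<^sup>+\<tau>. \<integral>\<^sup>+v. g (\<tau>(c := v)) \<partial>clock_law c \<partial>Q)"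
proof -
  let ?I = "clocks N y0 - {c}"
  define Q' where "Q' = PiM ?I clock_law"
  interpret c: prob_space "clock_law c" by (rule prob_space_clock_law)
  interpret Q': prob_space Q' unfolding Q'_def by (intro prob_space_PiM prob_space_clock_law)
  interpret P: pair_sigma_finite "clock_law c" Q' ..
  have ins: "insert c ?I = clocks N y0" using c by blast
  have Q: "Q = distr (clock_law c \<Otimes>\<^sub>M Q') Q (\<lambda>(x, X). X(c := x))"
    using distr_pair_PiM_eq_PiM[of ?I clock_law c] prob_space_clock_law unfolding ins Q_def Q'_def by simp
  have m: "(\<lambda>(x, X). X(c := x)) \<in> measurable (clock_law c \<Otimes>\<^sub>M Q') Q"
  proof -
    have "(\<lambda>p. (snd p, fst p)) \<in> measurable (clock_law c \<Otimes>\<^sub>M Q') (Q' \<Otimes>\<^sub>M clock_law c)" by measurable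
    from measurable_compose[OF this, of "\<lambda>(f, y). f(c := y)"]
    show ?thesis using measurable_add_dim[of c ?I clock_law] unfolding ins Q'_def[symmetric] Q_def[symmetric]
      by (simp add: case_prod_beta')
  qed
  have split: "(\<integral>\<^sup>+\<tau>. h \<tau> \<partial>Q) = (\<integral>\<^sup>+X. \<integral>\<^sup>+v. h (X(c := v)) \<partial>clock_law c \<partial>Q')"
    if h: "h \<in> borel_measurable borel_clocks" for h
  proof -
    have h': "h \<in> borel_measurable Q" using h by (simp cong: measurable_cong_sets)
    have "(\<integral>\<^sup>+\<tau>. h \<tau> \<partial>Q) = (\<integral>\<^sup>+p. h ((\<lambda>(x, X). X(c := x)) p) \<partial>(clock_law c \<Otimes>\<^sub>M Q'))"
      by (subst Q) (rule nn_integral_distr[OF m], simp add: h')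
    also have "\<dots> = (\<integral>\<^sup>+X. \<integral>\<^sup>+v. h ((\<lambda>(x, X). X(c := x)) (v, X)) \<partial>clock_law c \<partial>Q')"
      by (rule P.nn_integral_snd[symmetric]) (rule measurable_compose[OF m h'])
    finally show ?thesis by simp
  qed
  have "(\<lambda>\<tau>. \<integral>\<^sup>+v. g (\<tau>(c := v)) \<partial>clock_law c) \<in> borel_measurable borel_clocks"
  proof (rule c.borel_measurable_nn_integral)
    have "(\<lambda>p. g ((fst p)(c := snd p))) \<in> borel_measurable (borel_clocks \<Otimes>\<^sub>M borel)"
      by (rule measurable_compose[OF measurable_upd[OF c] g])
    then show "(\<lambda>(\<tau>, v). g (\<tau>(c := v))) \<in> borel_measurable (borel_clocks \<Otimes>\<^sub>M clock_law c)"
      by (simp add: case_prod_beta' cong: measurable_cong_sets)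
  qed
  \<comment> \<open>The inner integral no longer depends on the coordinate \<open>c\<close>, so the
    additional integration over it has mass 1.\<close>
  from split[OF this] show ?thesis using c.emeasure_space_1 by (simp add: split[OF g])
qed

text \<open>
  As long as a clock has not rung, the state does not depend on its value. Integrating over this
  value alone turns the sum over its ring into an integral of its hazard rate.
\<close>

lemma compensation:
  assumes c: "c \<in> clocks N y0" and \<Phi>: "\<Phi> \<in> borel_measurable time_clocks"
    and causal: "\<And>\<tau> v v' u. good \<tau> \<Longrightarrow> 0 < v \<Longrightarrow> 0 < v' \<Longrightarrow> start c \<tau> < u \<Longrightarrow> u \<le> start c \<tau> + v \<Longrightarrow>
        u \<le> start c \<tau> + v' \<Longrightarrow> \<Phi> (u, \<tau>(c := v)) = \<Phi> (u, \<tau>(c := v'))"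
    and good: "AE \<tau> in Q. good \<tau>"
  shows "(\<integral>\<^sup>+\<tau>. (if ring c \<tau> < t then \<Phi> (ring c \<tau>, \<tau>) else 0) \<partial>Q)
    = (\<integral>\<^sup>+\<tau>. \<integral>\<^sup>+u. ennreal (clock_rate N c) *
         (if start c \<tau> < u \<and> u \<le> ring c \<tau> \<and> u < t then \<Phi> (u, \<tau>) else 0) \<partial>lborel \<partial>Q)"
    (is "?L = ?R")
proof -
  interpret c: prob_space "clock_law c" by (rule prob_space_clock_law)
  interpret P: pair_sigma_finite lborel "clock_law c" ..
  let ?\<gamma> = "clock_rate N c"
  have \<gamma>: "0 < ?\<gamma>" by (rule rate_pos[OF c])
  have [measurable]: "ring c \<in> borel_measurable borel_clocks" "start c \<in> borel_measurable borel_clocks"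
    by (rule measurable_ring[OF c], rule measurable_start[OF c])
  note [measurable] = \<Phi>
  have ring: "ring c (\<tau>(c := v)) = start c \<tau> + v" for \<tau> v by (simp add: ring_def)
  have "?L = (\<integral>\<^sup>+\<tau>. \<integral>\<^sup>+v. (if start c \<tau> + v < t then \<Phi> (start c \<tau> + v, \<tau>(c := v)) else 0) \<partial>clock_law c \<partial>Q)"
  proof (subst resample[OF c])
    show "(\<lambda>\<tau>. if ring c \<tau> < t then \<Phi> (ring c \<tau>, \<tau>) else 0) \<in> borel_measurable borel_clocks"
      by measurable
  qed (simp only: ring)
  also have "\<dots> = (\<integral>\<^sup>+\<tau>. \<integral>\<^sup>+v. \<integral>\<^sup>+u. ennreal ?\<gamma> *
      (if start c \<tau> < u \<and> u \<le> start c \<tau> + v \<and> u < t then \<Phi> (u, \<tau>(c := v)) else 0) \<partial>lborel \<partial>clock_law c \<partial>Q)"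
  proof (rule nn_integral_cong_AE, use good AE_space in eventually_elim)
    fix \<tau> assume g: "good \<tau>" and "\<tau> \<in> space Q"
    then have sp: "\<tau> \<in> space borel_clocks" by (simp add: space_Q)
    define s where "s = start c \<tau>"
    \<comment> \<open>By causality the value \<open>v\<close> of the clock may be replaced by
      \<open>u - s\<close>, the value for which it rings exactly at \<open>u\<close>. What remains
      of \<open>v\<close> is the indicator that the clock has not rung before
      \<open>u\<close>.\<close>
    define \<psi> where "\<psi> u = (if s < u \<and> u < t then \<Phi> (u, \<tau>(c := u - s)) else 0)" for u
    show "(\<integral>\<^sup>+v. (if start c \<tau> + v < t then \<Phi> (start c \<tau> + v, \<tau>(c := v)) else 0) \<partial>clock_law c)
      = (\<integral>\<^sup>+v. \<integral>\<^sup>+u. ennreal ?\<gamma> *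
      (if start c \<tau> < u \<and> u \<le> start c \<tau> + v \<and> u < t then \<Phi> (u, \<tau>(c := v)) else 0) \<partial>lborel \<partial>clock_law c)"
    proof -
      have \<psi>_meas [measurable]: "\<psi> \<in> borel_measurable borel"
      proof -
        have "\<tau> \<in> space borel_clocks" by (rule sp)
        then have "(\<lambda>u. \<tau>(c := u - s)) \<in> measurable borel borel_clocks"
          by (intro measurable_upd_compose[OF c]) measurable
        then have "(\<lambda>u. \<Phi> (u, \<tau>(c := u - s))) \<in> borel_measurable borel" by measurable
        then show ?thesis unfolding \<psi>_def[abs_def] by measurable
      qed
      have "(if s < u \<and> u \<le> s + v \<and> u < t then \<Phi> (u, \<tau>(c := v)) else 0) = \<psi> u * indicator {u - s..} v" for u v
        using causal[OF g, of v "u - s" u] by (auto simp: \<psi>_def s_def indicator_def)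
      then have "(\<integral>\<^sup>+v. \<integral>\<^sup>+u. ennreal ?\<gamma> *
          (if s < u \<and> u \<le> s + v \<and> u < t then \<Phi> (u, \<tau>(c := v)) else 0) \<partial>lborel \<partial>clock_law c)
        = (\<integral>\<^sup>+v. \<integral>\<^sup>+u. ennreal ?\<gamma> * (\<psi> u * indicator {u - s..} v) \<partial>lborel \<partial>clock_law c)"
        by (simp only:)
      also have "\<dots> = (\<integral>\<^sup>+u. \<integral>\<^sup>+v. ennreal ?\<gamma> * (\<psi> u * indicator {u - s..} v) \<partial>clock_law c \<partial>lborel)"
      proof (rule P.Fubini')
        have "{x \<in> space (borel \<Otimes>\<^sub>M borel). fst x - s \<le> snd x} \<in> sets ((borel :: real measure) \<Otimes>\<^sub>M (borel :: real measure))"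
          by measurable
        then have "{x :: real \<times> real. fst x - s \<le> snd x} \<in> sets (borel \<Otimes>\<^sub>M borel)"
          by (simp add: space_pair_measure)
        then have "(\<lambda>x. indicator {x. fst x - s \<le> snd x} x :: ennreal) \<in> borel_measurable (lborel \<Otimes>\<^sub>M clock_law c)"
          by (intro borel_measurable_indicator) (simp cong: sets_pair_measure_cong)
        then have "(\<lambda>x. ennreal ?\<gamma> * (\<psi> (fst x) * indicator {x. fst x - s \<le> snd x} x)) \<in> borel_measurable (lborel \<Otimes>\<^sub>M clock_law c)"
          by measurable
        also have "(\<lambda>x. ennreal ?\<gamma> * (\<psi> (fst x) * indicator {x. fst x - s \<le> snd x} x))
            = (\<lambda>(u, v). ennreal ?\<gamma> * (\<psi> u * indicator {u - s..} v))"
          by (auto simp: fun_eq_iff indicator_def)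
        finally show "(\<lambda>(u, v). ennreal ?\<gamma> * (\<psi> u * indicator {u - s..} v)) \<in> borel_measurable (lborel \<Otimes>\<^sub>M clock_law c)" .
      qed
      also have "\<dots> = (\<integral>\<^sup>+u. ennreal ?\<gamma> * (\<psi> u * ennreal (exp (- ?\<gamma> * (u - s)))) \<partial>lborel)"
      proof (rule nn_integral_cong)
        fix u
        have "(\<integral>\<^sup>+v. ennreal ?\<gamma> * (\<psi> u * indicator {u - s..} v) \<partial>clock_law c)
          = ennreal ?\<gamma> * (\<psi> u * emeasure (clock_law c) {u - s..})"
          by (simp add: nn_integral_cmult)
        also have "\<dots> = ennreal ?\<gamma> * (\<psi> u * ennreal (exp (- ?\<gamma> * (u - s))))"
        proof (cases "s < u")
          case True
          then show ?thesis using \<gamma> by (simp add: clock_law_eq[OF c] emeasure_exponential_tail del: mult_minus_left)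
        qed (simp add: \<psi>_def)
        finally show "(\<integral>\<^sup>+v. ennreal ?\<gamma> * (\<psi> u * indicator {u - s..} v) \<partial>clock_law c)
          = ennreal ?\<gamma> * (\<psi> u * ennreal (exp (- ?\<gamma> * (u - s))))" .
      qed
      also have "\<dots> = (\<integral>\<^sup>+v. ennreal ?\<gamma> * (\<psi> (s + v) * ennreal (exp (- ?\<gamma> * v))) \<partial>lborel)"
        by (subst nn_integral_real_affine[where c=1 and t=s]) simp_all
      \<comment> \<open>Rate times tail is the density: the hazard rate of the exponential law is
        constant.\<close>
      also have "\<dots> = (\<integral>\<^sup>+v. ennreal (exponential_density ?\<gamma> v) * (if s + v < t then \<Phi> (s + v, \<tau>(c := v)) else 0) \<partial>lborel)"
      proof (rule nn_integral_cong_AE, use AE_lborel_singleton[of 0] in eventually_elim)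
        fix v :: real assume "v \<noteq> 0"
        then show "ennreal ?\<gamma> * (\<psi> (s + v) * ennreal (exp (- ?\<gamma> * v)))
          = ennreal (exponential_density ?\<gamma> v) * (if s + v < t then \<Phi> (s + v, \<tau>(c := v)) else 0)"
          using \<gamma> by (auto simp: \<psi>_def exponential_density_def ennreal_mult' mult_ac)
      qed
      also have "\<dots> = (\<integral>\<^sup>+v. (if s + v < t then \<Phi> (s + v, \<tau>(c := v)) else 0) \<partial>clock_law c)"
        unfolding clock_law_eq[OF c]
      proof (rule nn_integral_density[symmetric])
        have "(\<lambda>v. \<tau>(c := v)) \<in> measurable borel borel_clocks"
          using sp by (intro measurable_upd_compose[OF c]) measurable
        then have "(\<lambda>v. \<Phi> (s + v, \<tau>(c := v))) \<in> borel_measurable borel" by measurable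
        then show "(\<lambda>v. if s + v < t then \<Phi> (s + v, \<tau>(c := v)) else 0) \<in> borel_measurable lborel" by measurable
      qed measurable
      finally show ?thesis unfolding s_def by simp
    qed
  qed
  also have "\<dots> = ?R"
  proof (subst resample[OF c, where g="\<lambda>\<tau>. \<integral>\<^sup>+u. ennreal ?\<gamma> *
         (if start c \<tau> < u \<and> u \<le> ring c \<tau> \<and> u < t then \<Phi> (u, \<tau>) else 0) \<partial>lborel"])
    show "(\<lambda>\<tau>. \<integral>\<^sup>+u. ennreal ?\<gamma> * (if start c \<tau> < u \<and> u \<le> ring c \<tau> \<and> u < t then \<Phi> (u, \<tau>) else 0) \<partial>lborel)
        \<in> borel_measurable borel_clocks"
      by measurable
  qed (simp only: ring start_upd)
  finally show ?thesis .
qed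

section \<open>Almost sure properties of the clocks\<close>

lemma AE_clock_law_pos: "AE v in clock_law c. 0 < v"
proof -
  have "AE v in lborel. 0 < ennreal (exponential_density (if c \<in> clocks N y0 then clock_rate N c else 1) v) \<longrightarrow> 0 < v"
    using AE_lborel_singleton[of "0::real"] by eventually_elim (auto simp: exponential_density_def)
  then show ?thesis unfolding clock_law_def by (subst AE_density) auto
qed

lemma AE_clocks_pos: "AE \<tau> in Q. \<forall>c\<in>clocks N y0. 0 < \<tau> c"
  by (rule AE_ball_countable'[OF _ countable_clocks], unfold Q_def)
    (rule AE_PiM_component[OF prob_space_clock_law _ AE_clock_law_pos])

text \<open>Exponential tilting: multiplying the density of rate l by exp(-\<theta> v) gives l / (l
  + \<theta>) times the density of rate l + \<theta>.\<close>

lemma clock_law_laplace: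
  assumes c: "c \<in> clocks N y0" and \<theta>: "0 \<le> \<theta>"
  shows "(\<integral>\<^sup>+v. ennreal (exp (- \<theta> * v)) \<partial>clock_law c) = ennreal (clock_rate N c / (clock_rate N c + \<theta>))"
proof -
  let ?l = "clock_rate N c"
  have l: "0 < ?l" by (rule rate_pos[OF c])
  interpret E: prob_space "density lborel (\<lambda>x. ennreal (exponential_density (?l + \<theta>) x))"
    using l \<theta> by (intro prob_space_exponential_density) simp
  have 1: "(\<integral>\<^sup>+v. ennreal (exponential_density (?l + \<theta>) v) \<partial>lborel) = 1"
    using E.emeasure_space_1 by (simp add: emeasure_density)
  have "(\<integral>\<^sup>+v. ennreal (exp (- \<theta> * v)) \<partial>clock_law c)
      = (\<integral>\<^sup>+v. ennreal (exponential_density ?l v) * ennreal (exp (- \<theta> * v)) \<partial>lborel)"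
    unfolding clock_law_eq[OF c] by (rule nn_integral_density) simp_all
  also have "\<dots> = (\<integral>\<^sup>+v. ennreal (?l / (?l + \<theta>)) * ennreal (exponential_density (?l + \<theta>) v) \<partial>lborel)"
  proof (rule nn_integral_cong)
    fix v :: real
    have "exponential_density ?l v * exp (- \<theta> * v) = ?l / (?l + \<theta>) * exponential_density (?l + \<theta>) v"
    proof (cases "v < 0")
      case False
      have "exp (- v * ?l) * exp (- \<theta> * v) = exp (- v * (?l + \<theta>))"
        by (simp add: exp_add[symmetric] algebra_simps)
      moreover have "?l / (?l + \<theta>) * ((?l + \<theta>) * e) = ?l * e" for e
        using l \<theta> by simp
      ultimately show ?thesis using False by (simp only: exponential_density_def if_False mult.assoc)
    qed (simp add: exponential_density_def)
    then show "ennreal (exponential_density ?l v) * ennreal (exp (- \<theta> * v))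
        = ennreal (?l / (?l + \<theta>)) * ennreal (exponential_density (?l + \<theta>) v)"
      using l \<theta> by (simp add: ennreal_mult'[symmetric] ennreal_mult''[symmetric])
  qed
  also have "\<dots> = ennreal (?l / (?l + \<theta>))" by (subst nn_integral_cmult) (simp_all add: 1)
  finally show ?thesis .
qed

lemma arr_laplace:
  assumes i: "i \<in> classes N" and \<theta>: "0 \<le> \<theta>"
  shows "(\<integral>\<^sup>+\<tau>. ennreal (exp (- \<theta> * arr i n \<tau>)) \<partial>Q)
    = ennreal ((arrival_rate N i / (arrival_rate N i + \<theta>)) ^ Suc n)"
proof (induction n)
  case 0
  have c: "Interarrival i 0 \<in> clocks N y0" using i by (simp add: in_clocks)
  have "(\<integral>\<^sup>+\<tau>. ennreal (exp (- \<theta> * arr i 0 \<tau>)) \<partial>Q)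
      = (\<integral>\<^sup>+\<tau>. \<integral>\<^sup>+v. ennreal (exp (- \<theta> * arr i 0 (\<tau>(Interarrival i 0 := v)))) \<partial>clock_law (Interarrival i 0) \<partial>Q)"
    using measurable_arr[OF i] by (intro resample[OF c]) measurable
  also have "\<dots> = ennreal (arrival_rate N i / (arrival_rate N i + \<theta>))"
    by (simp add: arrival_time_def clock_law_laplace[OF c \<theta>, simplified] Q.emeasure_space_1)
  finally show ?case by simp
next
  case (Suc n)
  let ?c = "Interarrival i (Suc n)"
  have c: "?c \<in> clocks N y0" using i by (simp add: in_clocks)
  have [measurable]: "arr i n \<in> borel_measurable borel_clocks" by (rule measurable_arr[OF i])
  have "arr i (Suc n) (\<tau>(?c := v)) = arr i n \<tau> + v" for \<tau> v
    using arr_upd[of i n \<tau> ?c v] by (simp add: arr_Suc)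
  then have *: "ennreal (exp (- \<theta> * arr i (Suc n) (\<tau>(?c := v))))
      = ennreal (exp (- \<theta> * arr i n \<tau>)) * ennreal (exp (- \<theta> * v))" for \<tau> v
    by (simp add: ennreal_mult'[symmetric] exp_add[symmetric] algebra_simps)
  have "(\<integral>\<^sup>+\<tau>. ennreal (exp (- \<theta> * arr i (Suc n) \<tau>)) \<partial>Q)
      = (\<integral>\<^sup>+\<tau>. \<integral>\<^sup>+v. ennreal (exp (- \<theta> * arr i (Suc n) (\<tau>(?c := v)))) \<partial>clock_law ?c \<partial>Q)"
    using measurable_arr[OF i] by (intro resample[OF c]) measurable
  also have "\<dots> = (\<integral>\<^sup>+\<tau>. ennreal (exp (- \<theta> * arr i n \<tau>)) * ennreal (arrival_rate N i / (arrival_rate N i + \<theta>)) \<partial>Q)"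
    unfolding * using clock_law_laplace[OF c \<theta>] by (simp add: nn_integral_cmult)
  also have "\<dots> = ennreal ((arrival_rate N i / (arrival_rate N i + \<theta>)) ^ Suc n) * ennreal (arrival_rate N i / (arrival_rate N i + \<theta>))"
    unfolding Suc.IH[symmetric] by (rule nn_integral_multc) measurable
  finally show ?case using rates[OF i] \<theta> by (simp add: ennreal_mult'[symmetric] mult_ac)
qed

text \<open>Chernoff's bound from the Laplace transform. The parameter \<theta> is kept free, since
  exponential moments of high order need a large one.\<close>

lemma emeasure_arr_le:
  assumes i: "i \<in> classes N" and \<theta>: "0 \<le> \<theta>"
  shows "emeasure Q {\<tau> \<in> space Q. arr i n \<tau> \<le> t}
    \<le> ennreal (exp (\<theta> * t) * (arrival_rate N i / (arrival_rate N i + \<theta>)) ^ Suc n)"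
proof -
  have [measurable]: "arr i n \<in> borel_measurable borel_clocks" by (rule measurable_arr[OF i])
  have "emeasure Q {\<tau> \<in> space Q. arr i n \<tau> \<le> t} = (\<integral>\<^sup>+\<tau>. indicator {\<tau> \<in> space Q. arr i n \<tau> \<le> t} \<tau> \<partial>Q)"
    by (rule nn_integral_indicator[symmetric]) measurable
  also have "\<dots> \<le> (\<integral>\<^sup>+\<tau>. ennreal (exp (\<theta> * t)) * ennreal (exp (- \<theta> * arr i n \<tau>)) \<partial>Q)"
  proof (rule nn_integral_mono)
    fix \<tau>
    show "indicator {\<tau> \<in> space Q. arr i n \<tau> \<le> t} \<tau> \<le> ennreal (exp (\<theta> * t)) * ennreal (exp (- \<theta> * arr i n \<tau>))"
    proof (cases "arr i n \<tau> \<le> t")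
      case True
      then have "1 \<le> exp (\<theta> * t + - \<theta> * arr i n \<tau>)" using \<theta> by (simp add: mult_left_mono)
      then show ?thesis unfolding exp_add
        by (auto simp: indicator_def ennreal_mult'[symmetric] simp del: exp_le_one_iff one_le_exp_iff)
    qed simp
  qed
  also have "\<dots> = ennreal (exp (\<theta> * t)) * ennreal ((arrival_rate N i / (arrival_rate N i + \<theta>)) ^ Suc n)"
    unfolding arr_laplace[OF i \<theta>, symmetric] by (rule nn_integral_cmult) measurable
  finally show ?thesis using rates[OF i] \<theta> by (simp add: ennreal_mult'[symmetric] del: power_Suc)
qed

text \<open>Chernoff's bound with \<theta> = 1 is geometric in the number of the request, so by
  Borel-Cantelli only finitely many arrivals occur before each integer time.\<close>

lemma AE_good: "AE \<tau> in Q. good \<tau>"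
proof -
  have "AE \<tau> in Q. finite {n. arr i n \<tau> \<le> real m}" if i: "i \<in> classes N" for i m
  proof -
    have [measurable]: "arr i n \<in> borel_measurable borel_clocks" for n by (rule measurable_arr[OF i])
    let ?A = "\<lambda>n. {\<tau> \<in> space Q. arr i n \<tau> \<le> real m}" and ?r = "arrival_rate N i / (arrival_rate N i + 1)"
    have r: "0 < ?r" "?r < 1" using rates[OF i] by auto
    have "AE \<tau> in Q. eventually (\<lambda>n. \<tau> \<in> space Q - ?A n) sequentially"
    proof (rule borel_cantelli_AE1)
      have "summable (\<lambda>n. exp (real m) * ?r ^ Suc n)"
      proof (intro summable_mult)
        have "summable (\<lambda>n. ?r ^ n)" using r by (intro summable_geometric) (simp only: real_norm_def abs_of_pos)
        then show "summable (\<lambda>n. ?r ^ Suc n)" by (simp only: summable_Suc_iff)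
      qed
      then show "summable (\<lambda>n. measure Q (?A n))"
      proof (rule summable_comparison_test[rotated], intro exI allI impI)
        fix n
        have "0 \<le> exp (real m) * ?r ^ Suc n"
          using r by (intro mult_nonneg_nonneg zero_le_power) simp_all
        then have "measure Q (?A n) \<le> exp (real m) * ?r ^ Suc n"
          unfolding measure_def using emeasure_arr_le[OF i zero_le_one, of n "real m", unfolded mult_1]
          by (intro enn2real_leI)
        then show "norm (measure Q (?A n)) \<le> exp (real m) * ?r ^ Suc n" by simp
      qed
    qed (measurable, simp add: Q.emeasure_eq_measure)
    then show ?thesis
    proof eventually_elim
      fix \<tau> assume "eventually (\<lambda>n. \<tau> \<in> space Q - ?A n) sequentially"
      then obtain k where "\<And>n. n \<ge> k \<Longrightarrow> \<tau> \<in> space Q - ?A n" unfolding eventually_sequentially by blast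
      then have "{n. arr i n \<tau> \<le> real m} \<subseteq> {..<k}" by (auto simp: not_less[symmetric])
      then show "finite {n. arr i n \<tau> \<le> real m}" by (rule finite_subset) simp
    qed
  qed
  then have "AE \<tau> in Q. \<forall>i\<in>classes N. \<forall>m. finite {n. arr i n \<tau> \<le> real m}"
    by (intro AE_ball_countable' countable_finite) (auto simp: AE_all_countable)
  with AE_clocks_pos show ?thesis
  proof eventually_elim
    fix \<tau> assume pos: "\<forall>c\<in>clocks N y0. 0 < \<tau> c" and fin: "\<forall>i\<in>classes N. \<forall>m. finite {n. arr i n \<tau> \<le> real m}"
    have "finite {n. arr i n \<tau> \<le> t}" if "i \<in> classes N" for i t
    proof (rule finite_subset)
      show "finite {n. arr i n \<tau> \<le> real (nat \<lceil>t\<rceil>)}" using fin that by blast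
      show "{n. arr i n \<tau> \<le> t} \<subseteq> {n. arr i n \<tau> \<le> real (nat \<lceil>t\<rceil>)}"
        using real_nat_ceiling_ge[of t] by (intro Collect_mono impI) linarith
    qed
    then show "good \<tau>" using pos by (simp add: good_def locally_finite_def)
  qed
qed

text \<open>Redrawing the clock \<open>c\<close> alone leaves \<open>h\<close> unchanged, and the
  exponential law has no atoms.\<close>

lemma AE_clock_neq:
  assumes c: "c \<in> clocks N y0" and h: "h \<in> borel_measurable borel_clocks"
    and inv: "\<And>\<tau> v. h (\<tau>(c := v)) = h \<tau>"
  shows "AE \<tau> in Q. \<tau> c \<noteq> h \<tau>"
proof -
  have [measurable]: "(\<lambda>\<tau>. \<tau> c) \<in> borel_measurable borel_clocks" "h \<in> borel_measurable borel_clocks"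
    using measurable_clock[OF c] h by auto
  have "(\<integral>\<^sup>+\<tau>. indicator {\<tau>. \<tau> c = h \<tau>} \<tau> \<partial>Q)
     = (\<integral>\<^sup>+\<tau>. \<integral>\<^sup>+v. indicator {\<tau>. \<tau> c = h \<tau>} (\<tau>(c := v)) \<partial>clock_law c \<partial>Q)"
  proof (rule resample[OF c])
    have "(\<lambda>\<tau>. if \<tau> c = h \<tau> then 1 else 0 :: ennreal) \<in> borel_measurable borel_clocks" by measurable
    then show "indicator {\<tau>. \<tau> c = h \<tau>} \<in> (borel_measurable borel_clocks :: (_ \<Rightarrow> ennreal) set)"
      by (rule measurable_cong[THEN iffD1, rotated]) (auto simp: indicator_def)
  qed
  also have "\<dots> = (\<integral>\<^sup>+\<tau>. \<integral>\<^sup>+v. indicator {h \<tau>} v \<partial>clock_law c \<partial>Q)"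
    by (intro nn_integral_cong) (auto simp: indicator_def inv)
  also have "\<dots> = (\<integral>\<^sup>+\<tau>. 0 \<partial>Q)"
  proof (rule nn_integral_cong)
    fix \<tau>
    have "(\<integral>\<^sup>+v. indicator {h \<tau>} v \<partial>clock_law c)
       = (\<integral>\<^sup>+v. ennreal (exponential_density (clock_rate N c) v) * indicator {h \<tau>} v \<partial>lborel)"
      unfolding clock_law_eq[OF c] by (rule nn_integral_density) simp_all
    also have "\<dots> = (\<integral>\<^sup>+v. 0 \<partial>(lborel :: real measure))"
    proof (rule nn_integral_cong_AE)
      show "AE v in lborel. ennreal (exponential_density (clock_rate N c) v) * indicator {h \<tau>} v = 0"
        using AE_lborel_singleton[of "h \<tau>"] by eventually_elim (simp add: indicator_def)
    qed
    finally show "(\<integral>\<^sup>+v. indicator {h \<tau>} v \<partial>clock_law c) = 0" by simp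
  qed
  finally have "(\<integral>\<^sup>+\<tau>. indicator {\<tau>. \<tau> c = h \<tau>} \<tau> \<partial>Q) = 0" by simp
  then have "AE \<tau> in Q. (indicator {\<tau>. \<tau> c = h \<tau>} \<tau> :: ennreal) = 0"
  proof (subst (asm) nn_integral_0_iff_AE)
    have "(\<lambda>\<tau>. if \<tau> c = h \<tau> then 1 else 0 :: ennreal) \<in> borel_measurable Q" by measurable
    then show "(\<lambda>\<tau>. indicator {\<tau>. \<tau> c = h \<tau>} \<tau>) \<in> (borel_measurable Q :: (_ \<Rightarrow> ennreal) set)"
      by (rule measurable_cong[THEN iffD1, rotated]) (auto simp: indicator_def)
  qed
  then show ?thesis by eventually_elim (auto simp: indicator_def split: if_splits)
qed

text \<open>The value of a service clock enters its own ring time but that of no other clock of the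
  class, so coincidences with it are null events. Interarrival clocks ring at different times
  already because all clocks are positive.\<close>

lemma AE_distinct_rings:
  assumes i: "i \<in> classes N"
  shows "AE \<tau> in Q. distinct_rings i \<tau>"
proof -
  have count: "countable (services i)" and count': "countable (class_clocks i)"
    unfolding class_clocks_def services_def by auto
  have "AE \<tau> in Q. \<forall>c\<in>services i. \<forall>c'\<in>class_clocks i. c \<noteq> c' \<longrightarrow> ring c \<tau> \<noteq> ring c' \<tau>"
  proof (intro AE_ball_countable' count count')
    fix c c' assume c: "c \<in> services i" and c': "c' \<in> class_clocks i"
    have cl: "c \<in> clocks N y0" "c' \<in> clocks N y0"
      using c c' class_clocks_subset[OF i] by (auto simp: class_clocks_def)
    show "AE \<tau> in Q. c \<noteq> c' \<longrightarrow> ring c \<tau> \<noteq> ring c' \<tau>"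
    proof (cases "c = c'")
      case False
      have "AE \<tau> in Q. \<tau> c \<noteq> ring c' \<tau> - start c \<tau>"
      proof (rule AE_clock_neq[OF cl(1)])
        have [measurable]: "ring c' \<in> borel_measurable borel_clocks" "start c \<in> borel_measurable borel_clocks"
          using measurable_ring[OF cl(2)] measurable_start[OF cl(1)] by auto
        show "(\<lambda>\<tau>. ring c' \<tau> - start c \<tau>) \<in> borel_measurable borel_clocks" by measurable
        have "start c' (\<tau>(c := v)) = start c' \<tau>" for \<tau> v
          using c by (cases c'; cases c) (auto simp: services_def arr_upd)
        then show "ring c' (\<tau>(c := v)) - start c (\<tau>(c := v)) = ring c' \<tau> - start c \<tau>" for \<tau> v
          using False by (simp add: ring_def)
      qed
      then show ?thesis by eventually_elim (auto simp: ring_def)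
    qed simp
  qed
  with AE_good show ?thesis
  proof eventually_elim
    fix \<tau> assume g: "good \<tau>"
      and ne: "\<forall>c\<in>services i. \<forall>c'\<in>class_clocks i. c \<noteq> c' \<longrightarrow> ring c \<tau> \<noteq> ring c' \<tau>"
    have "m = n" if "arr i m \<tau> = arr i n \<tau>" for m n
      using arr_mono[OF g i, of m n] arr_mono[OF g i, of n m] that by (cases m n rule: linorder_cases) auto
    then show "distinct_rings i \<tau>" unfolding distinct_rings_def
    proof (intro inj_onI)
      fix c c' assume c: "c \<in> class_clocks i" "c' \<in> class_clocks i" and eq: "ring c \<tau> = ring c' \<tau>"
      show "c = c'"
      proof (cases "c \<in> services i \<or> c' \<in> services i")
        case True then show ?thesis using ne c eq by metis
      next
        case False
        then obtain m n where mn: "c = Interarrival i m" "c' = Interarrival i n" using c by (auto simp: class_clocks_def)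
        then have "arr i m \<tau> = arr i n \<tau>" using eq by (simp add: ring_Interarrival)
        then have "m = n" by (rule \<open>\<And>m n. arr i m \<tau> = arr i n \<tau> \<Longrightarrow> m = n\<close>)
        then show ?thesis using mn by simp
      qed
    qed
  qed
qed

section \<open>Dynkin's formula\<close>

definition class_size :: "nat \<Rightarrow> (nat option \<Rightarrow> nat) \<Rightarrow> nat" where
  "class_size i v = (\<Sum>q\<in>stations i. v q)"

lemma class_size_le:
  assumes g: "good \<tau>" and i: "i \<in> classes N"
  shows "class_size i (z i u \<tau>) \<le> y0 i + card {n. arr i n \<tau> < u}"
proof -
  let ?R = "{c \<in> services i. running c u \<tau>}" and ?A = "{n. arr i n \<tau> < u}"
  define cn where "cn n = (if decision i n \<tau> = None then Fict_Service i n else Net_Service i n)" for n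
  have finR: "finite ?R" by (rule finite_subset[OF _ finite_started[OF g i, of u]]) (auto simp: running_def)
  have finA: "finite ?A" by (rule goodD(4)[OF g i])
  have "class_size i (z i u \<tau>) = (\<Sum>q\<in>stations i. \<Sum>c\<in>{c\<in>?R. station c \<tau> = q}. 1)"
    unfolding class_size_def z_card[OF g i] by (intro sum.cong) (auto intro: arg_cong[of _ _ card])
  also have "\<dots> = (\<Sum>c\<in>?R. 1)"
    by (rule sum.group) (use finR station_in[OF g i, of _ u] in auto)
  also have "\<dots> = card ?R" by simp
  also have "\<dots> \<le> card (Init_Service i ` {..<y0 i} \<union> cn ` ?A)"
    by (rule card_mono) (use finA in \<open>auto simp: services_def running_def cn_def image_iff\<close>)
  also have "\<dots> \<le> card (Init_Service i ` {..<y0 i}) + card (cn ` ?A)" by (rule card_Un_le)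
  also have "\<dots> \<le> card {..<y0 i} + card ?A" by (intro add_mono card_image_le finA finite_lessThan)
  finally show ?thesis by simp
qed

text \<open>If k > 0 requests have arrived, one of them has number at least k - 1, so a single term
  of the series dominates.\<close>

lemma exp_class_size_le:
  assumes g: "good \<tau>" and i: "i \<in> classes N" and u: "u \<le> t" and K: "0 \<le> K"
    and sp: "\<tau> \<in> space Q"
  shows "ennreal (exp (K * real (class_size i (z i u \<tau>)))) \<le> ennreal (exp (K * real (y0 i))) *
     (1 + (\<Sum>n. ennreal (exp (K * real (Suc n))) * indicator {\<tau> \<in> space Q. arr i n \<tau> \<le> t} \<tau>))"
proof -
  let ?S = "{n. arr i n \<tau> < u}"
  define h where "h n = ennreal (exp (K * real (Suc n))) * indicator {\<tau> \<in> space Q. arr i n \<tau> \<le> t} \<tau>" for n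
  have fin: "finite ?S" by (rule goodD(4)[OF g i])
  have "ennreal (exp (K * real (card ?S))) \<le> 1 + suminf h"
  proof (cases "card ?S = 0")
    case True then show ?thesis by simp
  next
    case False
    have "\<exists>n\<in>?S. card ?S \<le> Suc n"
    proof (rule ccontr)
      assume "\<not> ?thesis"
      then have "?S \<subseteq> {..<card ?S - 1}" by force
      from card_mono[OF _ this] False show False by simp
    qed
    then obtain n where n: "arr i n \<tau> < u" "card ?S \<le> Suc n" by blast
    have "ennreal (exp (K * real (card ?S))) \<le> h n"
      using n u K sp by (simp add: h_def indicator_def mult_left_mono)
    also have "h n = sum h {n}" by simp
    also have "\<dots> \<le> suminf h" by (rule sum_le_suminf) simp_all
    also have "\<dots> \<le> 1 + suminf h" by (simp add: add_increasing)
    finally show ?thesis .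
  qed
  moreover have "ennreal (exp (K * real (class_size i (z i u \<tau>)))) \<le> ennreal (exp (K * real (y0 i))) * ennreal (exp (K * real (card ?S)))"
  proof -
    have "K * real (class_size i (z i u \<tau>)) \<le> K * real (y0 i + card ?S)"
      using class_size_le[OF g i, of u] K by (intro mult_left_mono) (simp_all only: of_nat_le_iff)
    then show ?thesis by (simp add: ennreal_mult'[symmetric] exp_add[symmetric] algebra_simps)
  qed
  ultimately show ?thesis unfolding h_def by (meson mult_left_mono order_trans zero_le)
qed

lemma moment_bound:
  assumes i: "i \<in> classes N" and K: "0 \<le> K"
  obtains B :: real where "0 \<le> B"
    "\<And>u. u \<le> t \<Longrightarrow> (\<integral>\<^sup>+\<tau>. ennreal (exp (K * real (class_size i (z i u \<tau>)))) \<partial>Q) \<le> ennreal B"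
proof -
  \<comment> \<open>With this \<theta> the ratio \<open>r\<close> equals exp K / (1 + exp K) < 1:
    the Chernoff bound beats the growth by exp K per arrival.\<close>
  define \<theta> where "\<theta> = exp K * arrival_rate N i"
  define r where "r = exp K * (arrival_rate N i / (arrival_rate N i + \<theta>))"
  have l: "0 < arrival_rate N i" by (rule rates[OF i])
  have \<theta>: "0 \<le> \<theta>" using l by (simp add: \<theta>_def)
  have "0 < arrival_rate N i + exp K * arrival_rate N i" using l by (simp add: add_pos_pos)
  then have r: "0 \<le> r" "r < 1" using l by (simp_all add: r_def \<theta>_def divide_less_eq)
  have [measurable]: "arr i n \<in> borel_measurable borel_clocks" for n by (rule measurable_arr[OF i])
  let ?A = "\<lambda>n. {\<tau> \<in> space Q. arr i n \<tau> \<le> t}"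
  have sm: "summable (\<lambda>n. exp (\<theta> * t) * r ^ Suc n)"
  proof (intro summable_mult)
    have "summable (\<lambda>n. r ^ n)" using r by (intro summable_geometric) simp
    then show "summable (\<lambda>n. r ^ Suc n)" by (simp only: summable_Suc_iff)
  qed
  define Z where "Z = (\<Sum>n. exp (\<theta> * t) * r ^ Suc n)"
  have Z: "0 \<le> Z" unfolding Z_def using r by (intro suminf_nonneg sm) simp
  have "(\<integral>\<^sup>+\<tau>. ennreal (exp (K * real (class_size i (z i u \<tau>)))) \<partial>Q) \<le> ennreal (exp (K * real (y0 i)) * (1 + Z))"
    if u: "u \<le> t" for u
  proof -
    have "(\<integral>\<^sup>+\<tau>. ennreal (exp (K * real (class_size i (z i u \<tau>)))) \<partial>Q)
      \<le> (\<integral>\<^sup>+\<tau>. ennreal (exp (K * real (y0 i))) * (1 + (\<Sum>n. ennreal (exp (K * real (Suc n))) * indicator (?A n) \<tau>)) \<partial>Q)"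
    proof (rule nn_integral_mono_AE, use AE_good AE_space in eventually_elim)
      fix \<tau> assume "good \<tau>" "\<tau> \<in> space Q"
      then show "ennreal (exp (K * real (class_size i (z i u \<tau>)))) \<le> ennreal (exp (K * real (y0 i))) *
          (1 + (\<Sum>n. ennreal (exp (K * real (Suc n))) * indicator (?A n) \<tau>))"
        by (intro exp_class_size_le[OF _ i u K])
    qed
    also have "\<dots> = ennreal (exp (K * real (y0 i))) * (1 + (\<Sum>n. ennreal (exp (K * real (Suc n))) * emeasure Q (?A n)))"
    proof -
      have "(\<integral>\<^sup>+\<tau>. (\<Sum>n. ennreal (exp (K * real (Suc n))) * indicator (?A n) \<tau>) \<partial>Q)
          = (\<Sum>n. ennreal (exp (K * real (Suc n))) * emeasure Q (?A n))"
      proof -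
        have "?A n \<in> sets Q" for n by measurable
        then show ?thesis
          by (subst nn_integral_suminf) (simp_all add: nn_integral_cmult_indicator del: of_nat_Suc)
      qed
      then show ?thesis by (simp add: nn_integral_cmult nn_integral_add Q.emeasure_space_1 del: of_nat_Suc)
    qed
    also have "\<dots> \<le> ennreal (exp (K * real (y0 i))) * (1 + (\<Sum>n. ennreal (exp (\<theta> * t) * r ^ Suc n)))"
    proof (intro mult_left_mono add_left_mono suminf_le)
      fix n
      have "ennreal (exp (K * real (Suc n))) * emeasure Q (?A n)
        \<le> ennreal (exp (K * real (Suc n))) * ennreal (exp (\<theta> * t) * (arrival_rate N i / (arrival_rate N i + \<theta>)) ^ Suc n)"
        by (intro mult_left_mono emeasure_arr_le[OF i \<theta>]) simp
      also have "\<dots> = ennreal (exp (\<theta> * t) * r ^ Suc n)"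
      proof -
        have "exp (K * real (Suc n)) = exp K ^ Suc n" by (simp only: exp_of_nat2_mult)
        moreover have "r ^ Suc n = exp K ^ Suc n * (arrival_rate N i / (arrival_rate N i + \<theta>)) ^ Suc n"
          unfolding r_def by (rule power_mult_distrib)
        ultimately show ?thesis by (simp add: ennreal_mult'[symmetric] mult_ac del: power_Suc of_nat_Suc)
      qed
      finally show "ennreal (exp (K * real (Suc n))) * emeasure Q (?A n) \<le> ennreal (exp (\<theta> * t) * r ^ Suc n)" .
    qed simp_all
    also have "(\<Sum>n. ennreal (exp (\<theta> * t) * r ^ Suc n)) = ennreal Z"
      unfolding Z_def using r by (intro suminf_ennreal2 sm) simp
    also have "ennreal (exp (K * real (y0 i))) * (1 + ennreal Z) = ennreal (exp (K * real (y0 i)) * (1 + Z))"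
      using Z by (simp add: ennreal_mult')
    finally show ?thesis .
  qed
  then show ?thesis using Z by (intro that[of "exp (K * real (y0 i)) * (1 + Z)"]) auto
qed

text \<open>The compensation formula summed over all clocks of a class. \<open>F\<close> may depend
  on a clock only through its being an arrival clock or through its station, so the compensator
  becomes the total rate \<open>p\<close>.\<close>

lemma ring_sum:
  fixes F :: "clock \<Rightarrow> real \<Rightarrow> (clock \<Rightarrow> real) \<Rightarrow> real"
  assumes i: "i \<in> classes N"
    and meas: "\<And>c. c \<in> class_clocks i \<Longrightarrow> (\<lambda>p. F c (fst p) (snd p)) \<in> borel_measurable time_clocks"
    and causal: "\<And>c \<tau> v v' u. c \<in> class_clocks i \<Longrightarrow> good \<tau> \<Longrightarrow> 0 < v \<Longrightarrow> 0 < v' \<Longrightarrow> start c \<tau> < u \<Longrightarrow>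
        u \<le> start c \<tau> + v \<Longrightarrow> u \<le> start c \<tau> + v' \<Longrightarrow> F c u (\<tau>(c := v)) = F c u (\<tau>(c := v'))"
    and nonneg: "\<And>c u \<tau>. 0 \<le> F c u \<tau>"
    and a: "\<And>u \<tau> n. F (Interarrival i n) u \<tau> = a u \<tau>"
    and b: "\<And>c u \<tau>. c \<in> services i \<Longrightarrow> F c u \<tau> = b (station c \<tau>) u \<tau>"
    and p: "\<And>u \<tau>. p u \<tau> = arrival_rate N i * a u \<tau>
         + service_rate N i * (\<Sum>q\<in>stations i. real (z i u \<tau> q) * b q u \<tau>)"
  obtains S where "S \<in> borel_measurable Q"
    "AE \<tau> in Q. ennreal (\<Sum>c\<in>rung i t \<tau>. F c (ring c \<tau>) \<tau>) = S \<tau>"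
    "(\<integral>\<^sup>+\<tau>. S \<tau> \<partial>Q) = (\<integral>\<^sup>+u. indicator {0<..<t} u * (\<integral>\<^sup>+\<tau>. ennreal (p u \<tau>) \<partial>Q) \<partial>lborel)"
proof -
  let ?C = "class_clocks i"
  have cl: "c \<in> clocks N y0" if "c \<in> ?C" for c using class_clocks_subset[OF i] that by auto
  have count: "countable ?C" unfolding class_clocks_def services_def by auto
  interpret P: pair_sigma_finite lborel Q ..
  have act_meas: "(\<lambda>p. active c (snd p)) \<in> measurable time_clocks (count_space UNIV)" if "c \<in> ?C" for c
    by (rule measurable_compose[OF measurable_snd measurable_active[OF cl[OF that]]])
  define \<Phi> where "\<Phi> c p = (if active c (snd p) then ennreal (F c (fst p) (snd p)) else 0)" for c p
  have \<Phi>_meas: "\<Phi> c \<in> borel_measurable time_clocks" if c: "c \<in> ?C" for c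
    unfolding \<Phi>_def[abs_def] using act_meas[OF c] meas[OF c] by measurable
  have ring_meas: "ring c \<in> borel_measurable borel_clocks" "start c \<in> borel_measurable borel_clocks" if "c \<in> ?C" for c
    using measurable_ring[OF cl[OF that]] measurable_start[OF cl[OF that]] by auto
  \<comment> \<open>A measurable version of the sum over the random set
    \<open>rung i t \<tau>\<close>; the sum over the fixed countable set of clocks can be exchanged
    with the integrals.\<close>
  define S where "S \<tau> = (\<integral>\<^sup>+c. (if ring c \<tau> < t then \<Phi> c (ring c \<tau>, \<tau>) else 0) \<partial>count_space ?C)" for \<tau>
  have S_AE: "AE \<tau> in Q. ennreal (\<Sum>c\<in>rung i t \<tau>. F c (ring c \<tau>) \<tau>) = S \<tau>"
    unfolding S_def using AE_good
  proof eventually_elim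
    fix \<tau> assume g: "good \<tau>"
    have "(\<integral>\<^sup>+c. (if ring c \<tau> < t then \<Phi> c (ring c \<tau>, \<tau>) else 0) \<partial>count_space ?C)
        = (\<Sum>c\<in>rung i t \<tau>. (if ring c \<tau> < t then \<Phi> c (ring c \<tau>, \<tau>) else 0))"
      by (rule nn_integral_count_space') (use finite_rung[OF g i] in \<open>auto simp: rung_def \<Phi>_def\<close>)
    also have "\<dots> = (\<Sum>c\<in>rung i t \<tau>. ennreal (F c (ring c \<tau>) \<tau>))"
      by (intro sum.cong) (auto simp: rung_def \<Phi>_def)
    also have "\<dots> = ennreal (\<Sum>c\<in>rung i t \<tau>. F c (ring c \<tau>) \<tau>)" using nonneg by (intro sum_ennreal)
    finally show "ennreal (\<Sum>c\<in>rung i t \<tau>. F c (ring c \<tau>) \<tau>)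
      = (\<integral>\<^sup>+c. (if ring c \<tau> < t then \<Phi> c (ring c \<tau>, \<tau>) else 0) \<partial>count_space ?C)" by simp
  qed
  have m0: "(\<lambda>\<tau>. if ring c \<tau> < t then \<Phi> c (ring c \<tau>, \<tau>) else 0) \<in> borel_measurable Q" if c: "c \<in> ?C" for c
  proof -
    have [measurable]: "\<Phi> c \<in> borel_measurable time_clocks" "ring c \<in> borel_measurable borel_clocks"
      using \<Phi>_meas[OF c] ring_meas[OF c] by auto
    show ?thesis by measurable
  qed
  interpret C: sigma_finite_measure "count_space ?C" by (rule sigma_finite_measure_count_space_countable[OF count])
  have S_meas: "S \<in> borel_measurable Q" unfolding S_def[abs_def]
  proof (rule C.borel_measurable_nn_integral)
    have "(\<lambda>(c, \<tau>). if ring c \<tau> < t then \<Phi> c (ring c \<tau>, \<tau>) else 0) \<in> borel_measurable (count_space ?C \<Otimes>\<^sub>M Q)"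
      by (rule measurable_pair_measure_countable1[OF count]) (simp add: m0)
    from measurable_pair_swap[OF this]
    show "(\<lambda>(\<tau>, c). if ring c \<tau> < t then \<Phi> c (ring c \<tau>, \<tau>) else 0) \<in> borel_measurable (Q \<Otimes>\<^sub>M count_space ?C)"
      by (simp add: case_prod_beta' cong: if_cong)
  qed
  have "(\<integral>\<^sup>+\<tau>. S \<tau> \<partial>Q) = (\<integral>\<^sup>+c. (\<integral>\<^sup>+\<tau>. (if ring c \<tau> < t then \<Phi> c (ring c \<tau>, \<tau>) else 0) \<partial>Q) \<partial>count_space ?C)"
    unfolding S_def by (rule nn_integral_count_space_nn_integral[OF count m0])
  also have "\<dots> = (\<integral>\<^sup>+c. (\<integral>\<^sup>+\<tau>. \<integral>\<^sup>+u. ennreal (clock_rate N c) *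
         (if start c \<tau> < u \<and> u \<le> ring c \<tau> \<and> u < t then \<Phi> c (u, \<tau>) else 0) \<partial>lborel \<partial>Q) \<partial>count_space ?C)"
  proof (rule nn_integral_cong)
    fix c assume "c \<in> space (count_space ?C)"
    then have c: "c \<in> ?C" by simp
    show "(\<integral>\<^sup>+\<tau>. (if ring c \<tau> < t then \<Phi> c (ring c \<tau>, \<tau>) else 0) \<partial>Q)
      = (\<integral>\<^sup>+\<tau>. \<integral>\<^sup>+u. ennreal (clock_rate N c) *
         (if start c \<tau> < u \<and> u \<le> ring c \<tau> \<and> u < t then \<Phi> c (u, \<tau>) else 0) \<partial>lborel \<partial>Q)"
    proof (rule compensation[OF cl[OF c] \<Phi>_meas[OF c] _ AE_good])
      fix \<tau> v v' u
      assume *: "good \<tau>" "0 < v" "0 < v'" "start c \<tau> < u" "u \<le> start c \<tau> + v" "u \<le> start c \<tau> + v'"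
      show "\<Phi> c (u, \<tau>(c := v)) = \<Phi> c (u, \<tau>(c := v'))"
        unfolding \<Phi>_def fst_conv snd_conv
        using causal[OF c *] loss_dynamics.causal(3)[OF loss_dynamics_axioms *(1,2,3) cl[OF c] *(4,5,6)] by simp
    qed
  qed
  also have "\<dots> = (\<integral>\<^sup>+c. (\<integral>\<^sup>+u. \<integral>\<^sup>+\<tau>. ennreal (clock_rate N c) *
         (if start c \<tau> < u \<and> u \<le> ring c \<tau> \<and> u < t then \<Phi> c (u, \<tau>) else 0) \<partial>Q \<partial>lborel) \<partial>count_space ?C)"
  proof (rule nn_integral_cong)
    fix c assume "c \<in> space (count_space ?C)"
    then have c: "c \<in> ?C" by simp
    have [measurable]: "\<Phi> c \<in> borel_measurable time_clocks" "ring c \<in> borel_measurable borel_clocks" "start c \<in> borel_measurable borel_clocks"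
      using \<Phi>_meas[OF c] ring_meas[OF c] by auto
    show "(\<integral>\<^sup>+\<tau>. \<integral>\<^sup>+u. ennreal (clock_rate N c) *
         (if start c \<tau> < u \<and> u \<le> ring c \<tau> \<and> u < t then \<Phi> c (u, \<tau>) else 0) \<partial>lborel \<partial>Q)
      = (\<integral>\<^sup>+u. \<integral>\<^sup>+\<tau>. ennreal (clock_rate N c) *
         (if start c \<tau> < u \<and> u \<le> ring c \<tau> \<and> u < t then \<Phi> c (u, \<tau>) else 0) \<partial>Q \<partial>lborel)"
      by (rule P.Fubini') measurable
  qed
  also have "\<dots> = (\<integral>\<^sup>+u. \<integral>\<^sup>+\<tau>. \<integral>\<^sup>+c. ennreal (clock_rate N c) *
         (if start c \<tau> < u \<and> u \<le> ring c \<tau> \<and> u < t then \<Phi> c (u, \<tau>) else 0) \<partial>count_space ?C \<partial>Q \<partial>lborel)"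
  proof -
    have m: "(\<lambda>p. ennreal (clock_rate N c) * (if start c (snd p) < fst p \<and> fst p \<le> ring c (snd p) \<and> fst p < t then \<Phi> c p else 0))
        \<in> borel_measurable (lborel \<Otimes>\<^sub>M Q)" if c: "c \<in> ?C" for c
    proof -
      have [measurable]: "\<Phi> c \<in> borel_measurable time_clocks" "ring c \<in> borel_measurable borel_clocks" "start c \<in> borel_measurable borel_clocks"
        using \<Phi>_meas[OF c] ring_meas[OF c] by auto
      show ?thesis by measurable
    qed
    have "(\<integral>\<^sup>+\<tau>. \<integral>\<^sup>+c. ennreal (clock_rate N c) *
         (if start c \<tau> < u \<and> u \<le> ring c \<tau> \<and> u < t then \<Phi> c (u, \<tau>) else 0) \<partial>count_space ?C \<partial>Q)
       = (\<integral>\<^sup>+c. \<integral>\<^sup>+\<tau>. ennreal (clock_rate N c) *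
         (if start c \<tau> < u \<and> u \<le> ring c \<tau> \<and> u < t then \<Phi> c (u, \<tau>) else 0) \<partial>Q \<partial>count_space ?C)" for u
    proof (rule nn_integral_count_space_nn_integral[OF count])
      fix c assume "c \<in> ?C"
      from measurable_compose[OF measurable_Pair1' m[OF this], of u]
      show "(\<lambda>\<tau>. ennreal (clock_rate N c) * (if start c \<tau> < u \<and> u \<le> ring c \<tau> \<and> u < t then \<Phi> c (u, \<tau>) else 0)) \<in> borel_measurable Q"
        by simp
    qed
    then show ?thesis
    proof (simp only:, intro nn_integral_count_space_nn_integral[OF count, symmetric])
      fix c assume "c \<in> ?C"
      from Q.borel_measurable_nn_integral_fst[OF m[OF this]]
      show "(\<lambda>u. \<integral>\<^sup>+\<tau>. ennreal (clock_rate N c) * (if start c \<tau> < u \<and> u \<le> ring c \<tau> \<and> u < t then \<Phi> c (u, \<tau>) else 0) \<partial>Q) \<in> borel_measurable lborel"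
        by simp
    qed
  qed
  also have "\<dots> = (\<integral>\<^sup>+u. indicator {0<..<t} u * (\<integral>\<^sup>+\<tau>. ennreal (arrival_rate N i * a u \<tau>
         + service_rate N i * (\<Sum>q\<in>stations i. real (z i u \<tau> q) * b q u \<tau>)) \<partial>Q) \<partial>lborel)"
  proof (rule nn_integral_cong)
    fix u :: real
    show "(\<integral>\<^sup>+\<tau>. \<integral>\<^sup>+c. ennreal (clock_rate N c) *
         (if start c \<tau> < u \<and> u \<le> ring c \<tau> \<and> u < t then \<Phi> c (u, \<tau>) else 0) \<partial>count_space ?C \<partial>Q)
      = indicator {0<..<t} u * (\<integral>\<^sup>+\<tau>. ennreal (arrival_rate N i * a u \<tau>
         + service_rate N i * (\<Sum>q\<in>stations i. real (z i u \<tau> q) * b q u \<tau>)) \<partial>Q)"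
    proof (cases "0 < u \<and> u < t")
      case True
      have "(\<integral>\<^sup>+\<tau>. \<integral>\<^sup>+c. ennreal (clock_rate N c) *
         (if start c \<tau> < u \<and> u \<le> ring c \<tau> \<and> u < t then \<Phi> c (u, \<tau>) else 0) \<partial>count_space ?C \<partial>Q)
         = (\<integral>\<^sup>+\<tau>. ennreal (arrival_rate N i * a u \<tau>
         + service_rate N i * (\<Sum>q\<in>stations i. real (z i u \<tau> q) * b q u \<tau>)) \<partial>Q)"
      proof (rule nn_integral_cong_AE, use AE_good in eventually_elim)
        fix \<tau> assume g: "good \<tau>"
        have "(\<integral>\<^sup>+c. ennreal (clock_rate N c) * (if start c \<tau> < u \<and> u \<le> ring c \<tau> \<and> u < t then \<Phi> c (u, \<tau>) else 0) \<partial>count_space ?C)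
            = (\<integral>\<^sup>+c. ennreal (clock_rate N c) * (if running c u \<tau> then ennreal (F c u \<tau>) else 0) \<partial>count_space ?C)"
          using True by (intro nn_integral_cong) (auto simp: running_def \<Phi>_def)
        also have "\<dots> = ennreal (arrival_rate N i * a u \<tau> + service_rate N i * (\<Sum>q\<in>stations i. real (z i u \<tau> q) * b q u \<tau>))"
          by (rule sum_running[OF g i, where G="\<lambda>c. F c u \<tau>" and a="a u \<tau>" and b="\<lambda>q. b q u \<tau>"])
            (use True a b nonneg in auto)
        finally show "(\<integral>\<^sup>+c. ennreal (clock_rate N c) * (if start c \<tau> < u \<and> u \<le> ring c \<tau> \<and> u < t then \<Phi> c (u, \<tau>) else 0) \<partial>count_space ?C)
          = ennreal (arrival_rate N i * a u \<tau> + service_rate N i * (\<Sum>q\<in>stations i. real (z i u \<tau> q) * b q u \<tau>))" .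
      qed
      then show ?thesis using True by simp
    next
      case False
      have "(\<integral>\<^sup>+\<tau>. \<integral>\<^sup>+c. ennreal (clock_rate N c) *
         (if start c \<tau> < u \<and> u \<le> ring c \<tau> \<and> u < t then \<Phi> c (u, \<tau>) else 0) \<partial>count_space ?C \<partial>Q) = (\<integral>\<^sup>+\<tau>. 0 \<partial>Q)"
      proof (rule nn_integral_cong_AE, use AE_good in eventually_elim)
        fix \<tau> assume g: "good \<tau>"
        have "\<not> (start c \<tau> < u \<and> u < t)" if "c \<in> ?C" for c
          using start_nonneg[OF g cl[OF that]] False by auto
        then show "(\<integral>\<^sup>+c. ennreal (clock_rate N c) *
         (if start c \<tau> < u \<and> u \<le> ring c \<tau> \<and> u < t then \<Phi> c (u, \<tau>) else 0) \<partial>count_space ?C) = 0"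
          by (subst nn_integral_0_iff_AE) (auto simp: AE_count_space)
      qed
      then show ?thesis using False by (auto simp: indicator_def)
    qed
  qed
  finally show ?thesis unfolding p[symmetric] by (rule that[OF S_meas S_AE])
qed

end

section \<open>A comparison lemma for integral inequalities\<close>

text \<open>Compare with the solution \<open>m\<close> of m' = P - c (m - B), m(0) = B. After the
  last time at which \<phi> is not above \<open>m\<close>, the bound gives L \<le> m', so \<phi>
  cannot get above \<open>m\<close>. As \<open>L\<close> need not be continuous, integrals are
  compared instead of derivatives.\<close>

lemma gronwall_linear:
  fixes \<phi> L :: "real \<Rightarrow> real"
  assumes L: "\<And>t. 0 < t \<Longrightarrow> L integrable_on {0..t}"
    and eq: "\<And>t. 0 < t \<Longrightarrow> \<phi> t = ini + integral {0..t} L"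
    and le: "\<And>u. 0 < u \<Longrightarrow> L u \<le> P - c * (\<phi> u - B)"
    and c: "0 < c" and init: "ini \<le> B" and t: "0 < t"
  shows "\<phi> t \<le> B + P * (1 - exp (- c * t)) / c"
proof (rule ccontr)
  assume neg: "\<not> ?thesis"
  define m where "m u = B + P * (1 - exp (- c * u)) / c" for u
  \<comment> \<open>Defined by the integral so as to be continuous at 0 as well; the value of \<phi>
    at 0 is unconstrained, and for left limits it is not \<open>ini\<close>.\<close>
  define D where "D u = ini + integral {0..u} L - m u" for u
  have D\<phi>: "D u = \<phi> u - m u" if "0 < u" for u using eq[OF that] by (simp add: D_def)
  have m': "(m has_real_derivative P - c * (m u - B)) (at u within A)" for u A
    unfolding m_def using c by (auto intro!: derivative_eq_intros simp: field_simps)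
  have cont: "continuous_on {0..t} D" unfolding D_def
    by (intro continuous_intros indefinite_integral_continuous_1 L[OF t])
      (meson DERIV_continuous_on m')
  have D0: "D 0 \<le> 0" using init by (simp add: D_def m_def)
  have Dt: "0 < D t" using neg t by (simp add: D\<phi> m_def)
  define s where "s = Sup {u \<in> {0..t}. D u \<le> 0}"
  have closed: "closed {u \<in> {0..t}. D u \<le> 0}"
    using continuous_on_closed_Collect_le[OF cont continuous_on_const[of "{0..t}" 0]] by simp
  have ne: "{u \<in> {0..t}. D u \<le> 0} \<noteq> {}" using D0 t by force
  have bdd: "bdd_above {u \<in> {0..t}. D u \<le> 0}" by (rule bdd_aboveI[of _ t]) simp
  have s: "s \<in> {u \<in> {0..t}. D u \<le> 0}" unfolding s_def by (rule closed_contains_Sup[OF ne bdd closed])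
  have st: "0 \<le> s" "s < t" using s Dt by (auto simp: less_le)
  have pos: "0 < D u" if "s < u" "u \<le> t" for u
  proof (rule ccontr)
    assume "\<not> 0 < D u"
    then have "u \<le> s" unfolding s_def using that st by (intro cSup_upper bdd) auto
    then show False using that by simp
  qed
  have int: "L integrable_on {s..t}" by (rule integrable_subinterval_real[OF L[OF t]]) (use st in auto)
  have "integral {0..t} L = integral {0..s} L + integral {s..t} L"
    using st by (intro Henstock_Kurzweil_Integration.integral_combine[symmetric] L[OF t]) auto
  moreover have mi: "((\<lambda>u. P - c * (m u - B)) has_integral (m t - m s)) {s..t}"
    using st m' by (intro fundamental_theorem_of_calculus) (auto simp: has_real_derivative_iff_has_vector_derivative[symmetric])
  moreover have "integral {s..t} L \<le> m t - m s"
  proof (rule has_integral_le[OF _ mi])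
    \<comment> \<open>At \<open>s\<close> itself \<phi> is not known to exceed \<open>m\<close>, and
      \<open>s\<close> may be 0, where \<open>L\<close> has no bound. The value at this one point is
      replaced.\<close>
    show "((\<lambda>u. if u = s then P - c * (m s - B) else L u) has_integral integral {s..t} L) {s..t}"
      by (rule has_integral_spike_finite[OF _ _ integrable_integral[OF int], of "{s}"]) auto
    show "(if u = s then P - c * (m s - B) else L u) \<le> P - c * (m u - B)" if "u \<in> {s..t}" for u
    proof (cases "u = s")
      case False
      then have u: "s < u" "0 < u" "u \<le> t" using that st by auto
      have "c * (m u - B) \<le> c * (\<phi> u - B)" using pos[OF u(1,3)] D\<phi>[OF u(2)] c by (intro mult_left_mono) auto
      then show ?thesis using le[OF u(2)] False by simp
    qed simp
  qed
  ultimately have "D t \<le> D s" by (simp add: D_def)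
  then show False using s Dt by simp
qed

context loss_dynamics begin

text \<open>The station \<open>s\<close> of a new request is a parameter, because it depends on the
  state of all classes while \<open>f\<close> sees one class only.\<close>

definition generator :: "nat \<Rightarrow> ((nat option \<Rightarrow> nat) \<Rightarrow> real) \<Rightarrow> nat option \<Rightarrow> (nat option \<Rightarrow> nat) \<Rightarrow> real" where
  "generator i f s v = arrival_rate N i * (f (v(s := Suc (v s))) - f v)
     + service_rate N i * (\<Sum>q\<in>stations i. real (v q) * (f (v(q := v q - 1)) - f v))"

text \<open>Integrates \<open>jump_identity\<close>. By \<open>ring_sum\<close>, the sums of values
  before and after the jumps become time integrals of the rates \<open>p\<close> and
  \<open>r\<close>, whose difference is the generator. The growth bound together with
  \<open>moment_bound\<close> makes all terms finite, so that they may be subtracted.\<close>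

lemma dynkin:
  fixes f :: "(nat option \<Rightarrow> nat) \<Rightarrow> real"
  assumes i: "i \<in> classes N" and f0: "\<And>v. 0 \<le> f v"
    and growth: "\<And>v. f v \<le> C * exp (K * real (class_size i v))" and C: "0 \<le> C" and K: "0 \<le> K"
  defines "\<phi> \<equiv> \<lambda>u. \<integral>\<tau>. f (z i u \<tau>) \<partial>Q"
    and "L \<equiv> \<lambda>u. \<integral>\<tau>. generator i f (dec i (X u \<tau>) (Y u \<tau>)) (z i u \<tau>) \<partial>Q"
  shows "integrable Q (\<lambda>\<tau>. f (z i t \<tau>))"
    and "integrable Q (\<lambda>\<tau>. generator i f (dec i (X t \<tau>) (Y t \<tau>)) (z i t \<tau>))"
    and "0 < t \<Longrightarrow> L integrable_on {0..t}"
    and "0 < t \<Longrightarrow> \<phi> t = f (\<lambda>q. if q = None then y0 i else 0) + integral {0..t} L"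
proof -
  let ?l = "arrival_rate N i" and ?m = "service_rate N i"
  have lm: "0 < ?l" "0 < ?m" using rates[OF i] by auto
  define nxt where "nxt u \<tau> = (z i u \<tau>)(dec i (X u \<tau>) (Y u \<tau>) := Suc (z i u \<tau> (dec i (X u \<tau>) (Y u \<tau>))))" for u \<tau>
  define p where "p u \<tau> = ?l * f (z i u \<tau>) + ?m * (\<Sum>q\<in>stations i. real (z i u \<tau> q) * f (z i u \<tau>))" for u \<tau>
  define r where "r u \<tau> = ?l * f (nxt u \<tau>) + ?m * (\<Sum>q\<in>stations i. real (z i u \<tau> q) * f ((z i u \<tau>)(q := z i u \<tau> q - 1)))" for u \<tau>
  have generator: "generator i f (dec i (X u \<tau>) (Y u \<tau>)) (z i u \<tau>) = r u \<tau> - p u \<tau>" for u \<tau>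
    by (simp add: generator_def p_def r_def nxt_def right_diff_distrib sum_subtractf algebra_simps)
  have p0: "0 \<le> p u \<tau>" and r0: "0 \<le> r u \<tau>" for u \<tau>
    unfolding p_def r_def using lm f0 by (auto intro!: add_nonneg_nonneg mult_nonneg_nonneg sum_nonneg)
  define C2 where "C2 = (?l * exp K + ?m) * C"
  have C2: "0 \<le> C2" using lm C by (simp add: C2_def)
  have f_le: "f v \<le> C * exp (K * x)" if "real (class_size i v) \<le> x" for v x
  proof -
    have "C * exp (K * real (class_size i v)) \<le> C * exp (K * x)" using that C K by (intro mult_left_mono) (auto intro: mult_left_mono)
    then show ?thesis using growth[of v] by simp
  qed
  have sz_up: "class_size i (v(s := Suc (v s))) \<le> class_size i v + 1" for v s
  proof (cases "s \<in> stations i")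
    case True
    then show ?thesis unfolding class_size_def by (simp add: sum.remove[of _ s])
  next
    case False
    then have "class_size i (v(s := Suc (v s))) = class_size i v" unfolding class_size_def by (intro sum.cong) auto
    then show ?thesis by simp
  qed
  have sz_down: "class_size i (v(s := v s - 1)) \<le> class_size i v" for v s
    unfolding class_size_def by (intro sum_mono) auto
  \<comment> \<open>Raising the exponent by one absorbs the departure rate, which is linear in the
    number of requests.\<close>
  have exp1: "exp (K * x) \<le> exp ((K + 1) * x)" "x * exp (K * x) \<le> exp ((K + 1) * x)" if "0 \<le> x" for x :: real
  proof -
    show "exp (K * x) \<le> exp ((K + 1) * x)" using that by (simp add: algebra_simps)
    have "x \<le> exp x" using exp_ge_add_one_self[of x] by linarith
    then have "x * exp (K * x) \<le> exp x * exp (K * x)" by (intro mult_right_mono) simp_all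
    also have "\<dots> = exp ((K + 1) * x)" by (simp add: exp_add[symmetric] algebra_simps)
    finally show "x * exp (K * x) \<le> exp ((K + 1) * x)" .
  qed
  have bound: "?l * f v1 + ?m * (\<Sum>q\<in>stations i. real (v q) * f (v2 q)) \<le> C2 * exp ((K + 1) * real (class_size i v))"
    if v1: "class_size i v1 \<le> class_size i v + 1" and v2: "\<And>q. class_size i (v2 q) \<le> class_size i v" for v v1 v2
  proof -
    let ?x = "real (class_size i v)"
    have "f v1 \<le> C * exp (K * (?x + 1))" using v1 by (intro f_le) simp
    also have "\<dots> = C * exp K * exp (K * ?x)" by (simp add: exp_add algebra_simps)
    also have "\<dots> \<le> C * exp K * exp ((K + 1) * ?x)" using C by (intro mult_left_mono exp1) auto
    finally have 1: "?l * f v1 \<le> ?l * (C * exp K * exp ((K + 1) * ?x))" using lm by (intro mult_left_mono) auto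
    have "(\<Sum>q\<in>stations i. real (v q) * f (v2 q)) \<le> (\<Sum>q\<in>stations i. real (v q) * (C * exp (K * ?x)))"
      using v2 by (intro sum_mono mult_left_mono f_le) auto
    also have "\<dots> = C * (?x * exp (K * ?x))" by (simp add: class_size_def sum_distrib_right[symmetric])
    also have "\<dots> \<le> C * exp ((K + 1) * ?x)" using C by (intro mult_left_mono exp1) auto
    finally have 2: "?m * (\<Sum>q\<in>stations i. real (v q) * f (v2 q)) \<le> ?m * (C * exp ((K + 1) * ?x))" using lm by (intro mult_left_mono) auto
    show ?thesis using add_mono[OF 1 2] by (simp add: C2_def algebra_simps)
  qed
  have p_le: "p u \<tau> \<le> C2 * exp ((K + 1) * real (class_size i (z i u \<tau>)))" for u \<tau>
    unfolding p_def by (rule bound) simp_all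
  have r_le: "r u \<tau> \<le> C2 * exp ((K + 1) * real (class_size i (z i u \<tau>)))" for u \<tau>
    unfolding r_def nxt_def by (rule bound[OF sz_up sz_down])
  have z_meas: "(\<lambda>p. g (z i (fst p) (snd p))) \<in> borel_measurable time_clocks" for g :: "(nat option \<Rightarrow> nat) \<Rightarrow> real"
    by (rule measurable_compose[OF measurable_z[of "\<lambda>v. v"]]) simp
  have nxt_meas: "(\<lambda>p. f (nxt (fst p) (snd p))) \<in> borel_measurable time_clocks"
  proof -
    have "(\<lambda>p. nxt (fst p) (snd p)) \<in> measurable time_clocks (count_space UNIV)"
      unfolding nxt_def z_def by (rule measurable_state) simp
    from measurable_compose[OF this, of f] show ?thesis by simp
  qed
  have p_meas: "(\<lambda>x. p (fst x) (snd x)) \<in> borel_measurable time_clocks"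
    unfolding p_def by (rule z_meas[of "\<lambda>v. ?l * f v + ?m * (\<Sum>q\<in>stations i. real (v q) * f v)"])
  have r_meas: "(\<lambda>x. r (fst x) (snd x)) \<in> borel_measurable time_clocks"
    unfolding r_def using nxt_meas z_meas[of "\<lambda>v. ?m * (\<Sum>q\<in>stations i. real (v q) * f (v(q := v q - 1)))"]
    by measurable
  have sect: "(\<lambda>\<tau>. g u \<tau>) \<in> borel_measurable Q" if "(\<lambda>x. g (fst x) (snd x)) \<in> borel_measurable time_clocks" for g :: "real \<Rightarrow> (clock \<Rightarrow> real) \<Rightarrow> real" and u
    using measurable_compose[OF measurable_Pair1'[of u borel borel_clocks] that] by (simp cong: measurable_cong_sets)
  obtain B where B: "0 \<le> B" "\<And>u. u \<le> t \<Longrightarrow> (\<integral>\<^sup>+\<tau>. ennreal (exp ((K + 1) * real (class_size i (z i u \<tau>)))) \<partial>Q) \<le> ennreal B"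
    using moment_bound[OF i, of "K + 1" t] K by auto
  have nn_le: "(\<integral>\<^sup>+\<tau>. ennreal (g \<tau>) \<partial>Q) \<le> ennreal (C2 * B)"
    if "u \<le> t" "\<And>\<tau>. g \<tau> \<le> C2 * exp ((K + 1) * real (class_size i (z i u \<tau>)))" for g u
  proof -
    have [measurable]: "(\<lambda>\<tau>. exp ((K + 1) * real (class_size i (z i u \<tau>)))) \<in> borel_measurable Q"
      by (rule sect[OF z_meas])
    have "(\<integral>\<^sup>+\<tau>. ennreal (g \<tau>) \<partial>Q) \<le> (\<integral>\<^sup>+\<tau>. ennreal C2 * ennreal (exp ((K + 1) * real (class_size i (z i u \<tau>)))) \<partial>Q)"
      using that(2) C2 by (intro nn_integral_mono) (simp add: ennreal_mult'[symmetric] ennreal_leI)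
    also have "\<dots> = ennreal C2 * (\<integral>\<^sup>+\<tau>. ennreal (exp ((K + 1) * real (class_size i (z i u \<tau>)))) \<partial>Q)"
      by (rule nn_integral_cmult) measurable
    also have "\<dots> \<le> ennreal C2 * ennreal B" by (intro mult_left_mono B(2) that(1)) simp
    finally show ?thesis using C2 B(1) by (simp add: ennreal_mult'[symmetric])
  qed
  have intg: "integrable Q (g u)" "(\<integral>\<^sup>+\<tau>. ennreal (g u \<tau>) \<partial>Q) = ennreal (\<integral>\<tau>. g u \<tau> \<partial>Q)" "0 \<le> (\<integral>\<tau>. g u \<tau> \<partial>Q)" "(\<integral>\<tau>. g u \<tau> \<partial>Q) \<le> C2 * B"
    if g: "(\<lambda>x. g (fst x) (snd x)) \<in> borel_measurable time_clocks" "\<And>\<tau>. 0 \<le> g u \<tau>" "u \<le> t"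
      "\<And>\<tau>. g u \<tau> \<le> C2 * exp ((K + 1) * real (class_size i (z i u \<tau>)))" for g u
  proof -
    have fin: "(\<integral>\<^sup>+\<tau>. ennreal (g u \<tau>) \<partial>Q) \<le> ennreal (C2 * B)" by (rule nn_le[OF g(3,4)])
    show 1: "integrable Q (g u)"
      using sect[OF g(1)] g(2) fin by (intro integrableI_nonneg) (auto simp: top_unique intro: le_less_trans)
    show 2: "(\<integral>\<^sup>+\<tau>. ennreal (g u \<tau>) \<partial>Q) = ennreal (\<integral>\<tau>. g u \<tau> \<partial>Q)"
      using g(2) by (intro nn_integral_eq_integral[OF 1]) simp
    show 3: "0 \<le> (\<integral>\<tau>. g u \<tau> \<partial>Q)" using g(2) by simp
    show "(\<integral>\<tau>. g u \<tau> \<partial>Q) \<le> C2 * B" using fin C2 B(1) unfolding 2 by simp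
  qed
  note ip = intg[OF p_meas p0 _ p_le] and ir = intg[OF r_meas r0 _ r_le]
  have f_int: "integrable Q (\<lambda>\<tau>. f (z i t \<tau>))"
  proof (rule Bochner_Integration.integrable_bound[OF integrable_mult_right[OF ip(1)[OF order_refl], of "1 / ?l"]])
    show "(\<lambda>\<tau>. f (z i t \<tau>)) \<in> borel_measurable Q" by (rule sect[OF z_meas])
    have "f (z i t \<tau>) \<le> 1 / ?l * p t \<tau>" for \<tau>
      using lm f0 by (simp add: p_def field_simps sum_nonneg)
    then show "AE \<tau> in Q. norm (f (z i t \<tau>)) \<le> norm (1 / ?l * p t \<tau>)"
      using f0 by (intro AE_I2) (simp add: abs_of_nonneg p0 lm less_imp_le)
  qed
  then show "integrable Q (\<lambda>\<tau>. f (z i t \<tau>))" .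
  show "integrable Q (\<lambda>\<tau>. generator i f (dec i (X t \<tau>) (Y t \<tau>)) (z i t \<tau>))"
    unfolding generator by (intro Bochner_Integration.integrable_diff ip(1) ir(1) order_refl)
  assume t: "0 < t"
  have causalz: "f (z i u (\<tau>(c := v))) = f (z i u (\<tau>(c := v')))" "f (after c u (\<tau>(c := v))) = f (after c u (\<tau>(c := v')))"
    if "c \<in> class_clocks i" "good \<tau>" "0 < v" "0 < v'" "start c \<tau> < u"
      "u \<le> start c \<tau> + v" "u \<le> start c \<tau> + v'" for c \<tau> v v' u
    using causal(5,6)[OF that(2,3,4) _ that(5,6,7)] class_clocks_subset[OF i] that(1) by auto
  have "\<exists>S. S \<in> borel_measurable Q \<and> (AE \<tau> in Q. ennreal (\<Sum>c\<in>rung i t \<tau>. f (z i (ring c \<tau>) \<tau>)) = S \<tau>)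
    \<and> (\<integral>\<^sup>+\<tau>. S \<tau> \<partial>Q) = (\<integral>\<^sup>+u. indicator {0<..<t} u * (\<integral>\<^sup>+\<tau>. ennreal (p u \<tau>) \<partial>Q) \<partial>lborel)"
  proof (rule ring_sum[OF i, of "\<lambda>c u \<tau>. f (z i u \<tau>)" "\<lambda>u \<tau>. f (z i u \<tau>)" "\<lambda>q u \<tau>. f (z i u \<tau>)" p t])
    show "(\<lambda>p. f (z i (fst p) (snd p))) \<in> borel_measurable time_clocks" by (rule z_meas)
    show "f (z i u (\<tau>(c := v))) = f (z i u (\<tau>(c := v')))"
      if "c \<in> class_clocks i" "good \<tau>" "0 < v" "0 < v'" "start c \<tau> < u"
        "u \<le> start c \<tau> + v" "u \<le> start c \<tau> + v'" for c \<tau> v v' u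
      by (rule causalz(1)[OF that])
  qed (rule f0 refl p_def | intro exI conjI; assumption)+
  then obtain S1 where S1: "S1 \<in> borel_measurable Q"
    "AE \<tau> in Q. ennreal (\<Sum>c\<in>rung i t \<tau>. f (z i (ring c \<tau>) \<tau>)) = S1 \<tau>"
    "(\<integral>\<^sup>+\<tau>. S1 \<tau> \<partial>Q) = (\<integral>\<^sup>+u. indicator {0<..<t} u * (\<integral>\<^sup>+\<tau>. ennreal (p u \<tau>) \<partial>Q) \<partial>lborel)"
    by blast
  have "\<exists>S. S \<in> borel_measurable Q \<and> (AE \<tau> in Q. ennreal (\<Sum>c\<in>rung i t \<tau>. f (after c (ring c \<tau>) \<tau>)) = S \<tau>)
    \<and> (\<integral>\<^sup>+\<tau>. S \<tau> \<partial>Q) = (\<integral>\<^sup>+u. indicator {0<..<t} u * (\<integral>\<^sup>+\<tau>. ennreal (r u \<tau>) \<partial>Q) \<partial>lborel)"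
  proof (rule ring_sum[OF i, of "\<lambda>c u \<tau>. f (after c u \<tau>)" "\<lambda>u \<tau>. f (nxt u \<tau>)" "\<lambda>q u \<tau>. f ((z i u \<tau>)(q := z i u \<tau> q - 1))" r t])
    show "(\<lambda>p. f (after c (fst p) (snd p))) \<in> borel_measurable time_clocks" if "c \<in> class_clocks i" for c
      using measurable_compose[OF measurable_after[of c "\<lambda>v. v"], of f] class_clocks_subset[OF i] that by auto
    show "f (after (Interarrival i n) u \<tau>) = f (nxt u \<tau>)" for n u \<tau>
      by (simp add: after_def nxt_def Let_def)
    show "f (after c u \<tau>) = f ((z i u \<tau>)(station c \<tau> := z i u \<tau> (station c \<tau>) - 1))" if "c \<in> services i" for c u \<tau>
      by (simp add: after_service[OF that])
    show "f (after c u (\<tau>(c := v))) = f (after c u (\<tau>(c := v')))"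
      if "c \<in> class_clocks i" "good \<tau>" "0 < v" "0 < v'" "start c \<tau> < u"
        "u \<le> start c \<tau> + v" "u \<le> start c \<tau> + v'" for c \<tau> v v' u
      by (rule causalz(2)[OF that])
  qed (rule f0 refl r_def | intro exI conjI; assumption)+
  then obtain S2 where S2: "S2 \<in> borel_measurable Q"
    "AE \<tau> in Q. ennreal (\<Sum>c\<in>rung i t \<tau>. f (after c (ring c \<tau>) \<tau>)) = S2 \<tau>"
    "(\<integral>\<^sup>+\<tau>. S2 \<tau> \<partial>Q) = (\<integral>\<^sup>+u. indicator {0<..<t} u * (\<integral>\<^sup>+\<tau>. ennreal (r u \<tau>) \<partial>Q) \<partial>lborel)"
    by blast
  let ?v0 = "\<lambda>q. if q = None then y0 i else 0"
  have "AE \<tau> in Q. ennreal (f (z i t \<tau>)) + S1 \<tau> = ennreal (f ?v0) + S2 \<tau>"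
    using AE_good AE_distinct_rings[OF i] S1(2) S2(2)
  proof eventually_elim
    fix \<tau> assume *: "good \<tau>" "distinct_rings i \<tau>"
      "ennreal (\<Sum>c\<in>rung i t \<tau>. f (z i (ring c \<tau>) \<tau>)) = S1 \<tau>"
      "ennreal (\<Sum>c\<in>rung i t \<tau>. f (after c (ring c \<tau>) \<tau>)) = S2 \<tau>"
    show "ennreal (f (z i t \<tau>)) + S1 \<tau> = ennreal (f ?v0) + S2 \<tau>"
      using jump_identity[OF *(1) i *(2) t, of f] f0
      unfolding *(3,4)[symmetric] by (simp add: ennreal_plus[symmetric] sum_nonneg del: ennreal_plus)
  qed
  then have "(\<integral>\<^sup>+\<tau>. ennreal (f (z i t \<tau>)) + S1 \<tau> \<partial>Q) = (\<integral>\<^sup>+\<tau>. ennreal (f ?v0) + S2 \<tau> \<partial>Q)"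
    by (rule nn_integral_cong_AE)
  then have eq: "(\<integral>\<^sup>+\<tau>. ennreal (f (z i t \<tau>)) \<partial>Q) + (\<integral>\<^sup>+\<tau>. S1 \<tau> \<partial>Q) = ennreal (f ?v0) + (\<integral>\<^sup>+\<tau>. S2 \<tau> \<partial>Q)"
    using S1(1) S2(1) sect[OF z_meas[of f], of t] by (simp add: nn_integral_add Q.emeasure_space_1)
  have time: "set_integrable lborel {0<..<t} (\<lambda>u. \<integral>\<tau>. g u \<tau> \<partial>Q)"
     "(\<integral>\<^sup>+u. indicator {0<..<t} u * (\<integral>\<^sup>+\<tau>. ennreal (g u \<tau>) \<partial>Q) \<partial>lborel) = ennreal (LBINT u:{0<..<t}. \<integral>\<tau>. g u \<tau> \<partial>Q)"
     "0 \<le> (LBINT u:{0<..<t}. \<integral>\<tau>. g u \<tau> \<partial>Q)"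
    if g: "(\<lambda>x. g (fst x) (snd x)) \<in> borel_measurable time_clocks" "\<And>u \<tau>. 0 \<le> g u \<tau>"
      "\<And>u \<tau>. g u \<tau> \<le> C2 * exp ((K + 1) * real (class_size i (z i u \<tau>)))" for g
  proof -
    let ?g = "\<lambda>u. \<integral>\<tau>. g u \<tau> \<partial>Q"
    note ig = intg[of g, OF g(1,2) _ g(3)]
    have "(\<lambda>x. g (fst x) (snd x)) \<in> borel_measurable (borel \<Otimes>\<^sub>M Q)" using g(1) by (simp cong: measurable_cong_sets)
    then have m: "?g \<in> borel_measurable borel"
      by (intro Q.borel_measurable_lebesgue_integral) (simp add: case_prod_beta')
    then have m': "(\<lambda>u. indicator {0<..<t} u *\<^sub>R ?g u) \<in> borel_measurable lborel" by measurable
    show int: "set_integrable lborel {0<..<t} ?g" unfolding set_integrable_def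
    proof (rule Bochner_Integration.integrable_bound[where f="\<lambda>u. (C2 * B) * indicator {0<..<t} u"])
      show "integrable lborel (\<lambda>u. C2 * B * indicator {0<..<t} u)"
        using t by (intro integrable_mult_right integrable_real_indicator) simp_all
      show "AE u in lborel. norm (indicator {0<..<t} u *\<^sub>R ?g u) \<le> norm (C2 * B * indicator {0<..<t} u)"
      proof (rule AE_I2)
        fix u
        show "norm (indicator {0<..<t} u *\<^sub>R ?g u) \<le> norm (C2 * B * indicator {0<..<t} u)"
          using ig(3)[of u] ig(4)[of u] C2 B(1) by (cases "u \<in> {0<..<t}") auto
      qed
    qed (rule m')
    have "(\<integral>\<^sup>+u. indicator {0<..<t} u * (\<integral>\<^sup>+\<tau>. ennreal (g u \<tau>) \<partial>Q) \<partial>lborel) = (\<integral>\<^sup>+u. ennreal (indicator {0<..<t} u *\<^sub>R ?g u) \<partial>lborel)"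
    proof (rule nn_integral_cong)
      fix u
      show "indicator {0<..<t} u * (\<integral>\<^sup>+\<tau>. ennreal (g u \<tau>) \<partial>Q) = ennreal (indicator {0<..<t} u *\<^sub>R ?g u)"
        using ig(2)[of u] by (cases "u \<in> {0<..<t}") auto
    qed
    also have "\<dots> = ennreal (LBINT u:{0<..<t}. ?g u)" unfolding set_lebesgue_integral_def
      using int g(2) unfolding set_integrable_def by (intro nn_integral_eq_integral) (auto simp: indicator_def)
    finally show "(\<integral>\<^sup>+u. indicator {0<..<t} u * (\<integral>\<^sup>+\<tau>. ennreal (g u \<tau>) \<partial>Q) \<partial>lborel) = ennreal (LBINT u:{0<..<t}. ?g u)" .
    show "0 \<le> (LBINT u:{0<..<t}. ?g u)" unfolding set_lebesgue_integral_def
      using g(2) by (intro integral_nonneg_AE AE_I2) (auto simp: indicator_def)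
  qed
  note tp = time[OF p_meas p0 p_le] and tr = time[OF r_meas r0 r_le]
  have f_nn: "(\<integral>\<^sup>+\<tau>. ennreal (f (z i t \<tau>)) \<partial>Q) = ennreal (\<phi> t)" "0 \<le> \<phi> t"
    unfolding \<phi>_def using f0 by (auto intro!: nn_integral_eq_integral f_int)
  have "ennreal (\<phi> t) + ennreal (LBINT u:{0<..<t}. \<integral>\<tau>. p u \<tau> \<partial>Q) = ennreal (f ?v0) + ennreal (LBINT u:{0<..<t}. \<integral>\<tau>. r u \<tau> \<partial>Q)"
    using eq unfolding S1(3) S2(3) tp(2) tr(2) f_nn(1) .
  then have "\<phi> t + (LBINT u:{0<..<t}. \<integral>\<tau>. p u \<tau> \<partial>Q) = f ?v0 + (LBINT u:{0<..<t}. \<integral>\<tau>. r u \<tau> \<partial>Q)"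
    using f_nn(2) tp(3) tr(3) f0[of ?v0] by (simp add: ennreal_plus[symmetric] del: ennreal_plus)
  moreover have L: "L u = (\<integral>\<tau>. r u \<tau> \<partial>Q) - (\<integral>\<tau>. p u \<tau> \<partial>Q)" if "u \<in> {0<..<t}" for u
    unfolding L_def generator using that by (intro Bochner_Integration.integral_diff ip(1) ir(1)) auto
  moreover have "set_integrable lborel {0<..<t} (\<lambda>u. (\<integral>\<tau>. r u \<tau> \<partial>Q) - (\<integral>\<tau>. p u \<tau> \<partial>Q))"
    by (rule set_integral_diff(1)[OF tr(1) tp(1)])
  then have L_int: "set_integrable lborel {0<..<t} L"
    unfolding set_integrable_def by (rule Bochner_Integration.integrable_cong[THEN iffD1, rotated 2]) (auto simp: indicator_def L)
  moreover have "(LBINT u:{0<..<t}. L u) = (LBINT u:{0<..<t}. \<integral>\<tau>. r u \<tau> \<partial>Q) - (LBINT u:{0<..<t}. \<integral>\<tau>. p u \<tau> \<partial>Q)"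
  proof -
    have "(LBINT u:{0<..<t}. L u) = (LBINT u:{0<..<t}. (\<integral>\<tau>. r u \<tau> \<partial>Q) - (\<integral>\<tau>. p u \<tau> \<partial>Q))"
      using L by (intro set_lebesgue_integral_cong) auto
    then show ?thesis by (simp add: set_integral_diff(2)[OF tr(1) tp(1)])
  qed
  ultimately have "\<phi> t = f ?v0 + (LBINT u:{0<..<t}. L u)" by simp
  note hk = set_borel_integral_eq_integral[OF L_int]
  show "L integrable_on {0..t}" using hk(1) by (simp add: integrable_on_open_interval_real)
  show "\<phi> t = f ?v0 + integral {0..t} L"
    using \<open>\<phi> t = f ?v0 + (LBINT u:{0<..<t}. L u)\<close> hk(2) by (simp add: integral_open_interval_real)
qed

section \<open>Expectation bounds for one class\<close>

lemma z_simps [simp]: "z i u \<tau> (Some j) = X u \<tau> i j" "z i u \<tau> None = Y u \<tau> i"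
  by (simp_all add: z_def)

lemma measurable_XY_set: "{\<tau> \<in> space Q. R (X u \<tau>) (Y u \<tau>)} \<in> sets Q"
proof -
  have "(\<lambda>p. R (X (fst p) (snd p)) (Y (fst p) (snd p))) \<in> measurable time_clocks (count_space UNIV)"
    by (rule measurable_state) simp
  from measurable_compose[OF measurable_Pair1'[of u borel borel_clocks] this]
  have "(\<lambda>\<tau>. R (X u \<tau>) (Y u \<tau>)) \<in> measurable borel_clocks (count_space UNIV)" by simp
  then show ?thesis by (simp add: space_Q pred_def)
qed

lemma dec_stations: "i \<in> classes N \<Longrightarrow> dec i x y \<in> stations i"
  using dec_allocs[of i x y] by (cases "dec i x y") (auto simp: stations_def)

lemma sum_stations: "(\<Sum>q\<in>stations i. g q) = g None + (\<Sum>j\<in>allocs N i. g (Some j))" for g :: "_ \<Rightarrow> 'b :: comm_monoid_add"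
  unfolding stations_def by (subst sum.insert) (auto simp: sum.reindex)

text \<open>
  The bound holds for every probability \<^term>\<open>pb\<close> of being blocked if \<^term>\<open>p = 0\<close>; this is how the
  blocking probability itself gets estimated.
\<close>

lemma class_bound:
  assumes i: "i \<in> classes N"
    and cp: "class_potential (allocs N i) K a A \<epsilon> \<beta>' b1 sg"
    and adm: "\<And>x y. class_potential.admissible (allocs N i) K a b1 sg (x i) (y i) (bl x y) (dec i x y)"
    and th: "class_potential.E1 \<epsilon> * \<beta>' * arrival_rate N i = service_rate N i * (1 - \<epsilon> / 2) * th"
    and th0: "0 \<le> th" "b1 * real (y0 i) \<le> th" and sg0: "\<not> sg \<Longrightarrow> y0 i = 0"
    and pq: "0 \<le> p" "0 \<le> q"
    and pb: "\<And>u. 0 < u \<Longrightarrow> Q.prob {\<tau> \<in> space Q. bl (X u \<tau>) (Y u \<tau>)} \<le> pb"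
    and t: "0 < t"
  defines "hh \<equiv> class_potential.h (allocs N i) K a A \<epsilon> \<beta>' b1 sg p q"
  shows "integrable Q (\<lambda>\<tau>. hh (X t \<tau> i) (Y t \<tau> i))"
    and "(\<integral>\<tau>. hh (X t \<tau> i) (Y t \<tau> i) \<partial>Q) \<le> q * (real (card K) + of_bool sg) * exp th
      + p * arrival_rate N i * pb * (1 - exp (- (service_rate N i * (1 - \<epsilon> / 2)) * t)) / (service_rate N i * (1 - \<epsilon> / 2))"
proof -
  interpret cp: class_potential "allocs N i" K a A \<epsilon> \<beta>' b1 sg by (rule cp)
  let ?l = "arrival_rate N i" and ?m = "service_rate N i"
  have lm: "0 < ?l" "0 < ?m" using rates[OF i] by auto
  define f where "f v = hh (\<lambda>j. v (Some j)) (v None)" for v :: "nat option \<Rightarrow> nat"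
  have f_z: "f (z i u \<tau>) = hh (X u \<tau> i) (Y u \<tau> i)" for u \<tau> by (simp add: f_def)
  have f0: "0 \<le> f v" for v unfolding f_def hh_def by (rule cp.h_nonneg[OF pq])
  have growth: "f v \<le> (p + q * (real (card K) + 1)) * exp (1 * real (class_size i v))" for v
  proof -
    have "real (class_size i v) = real (\<Sum>j\<in>allocs N i. v (Some j)) + real (v None)" by (simp add: class_size_def sum_stations)
    then show ?thesis unfolding f_def hh_def using cp.h_growth[OF pq, of "\<lambda>j. v (Some j)" "v None"] by (simp only: mult_1)
  qed
  have C: "0 \<le> p + q * (real (card K) + 1)" using pq by simp
  note dyn = dynkin[of i f "p + q * (real (card K) + 1)" 1, OF i f0 growth C zero_le_one]
  define B where "B = q * (real (card K) + of_bool sg) * exp th"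
  define c where "c = ?m * (1 - \<epsilon> / 2)"
  have c: "0 < c" using lm cp.eps by (simp add: c_def)
  have gen_le: "generator i f (dec i x y) v \<le> p * ?l * of_bool (bl x y) - c * (f v - B)"
    if x: "\<And>j. v (Some j) = x i j" and y: "v None = y i" for v x y
  proof -
    have upd: "f (v(Some j := n)) = hh ((x i)(j := n)) (y i)" "f (v(None := n)) = hh (x i) n" for j n
      using x y by (auto simp: f_def fun_upd_def intro!: arg_cong2[of _ _ _ _ hh])
    have fv: "f v = hh (x i) (y i)" using x y by (simp add: f_def)
    have "generator i f (dec i x y) v = ?l * ((case dec i x y of None \<Rightarrow> hh (x i) (Suc (y i)) | Some j \<Rightarrow> hh ((x i)(j := Suc (x i j))) (y i)) - hh (x i) (y i))
      + ?m * ((\<Sum>j\<in>allocs N i. real (x i j) * (hh ((x i)(j := x i j - 1)) (y i) - hh (x i) (y i)))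
             + real (y i) * (hh (x i) (y i - 1) - hh (x i) (y i)))"
      unfolding generator_def sum_stations by (simp add: upd fv x y split: option.split)
    also have "\<dots> \<le> p * ?l * of_bool (bl x y) - c * (hh (x i) (y i) - B)"
      unfolding hh_def c_def B_def using cp.drift[OF pq(2,1) adm, of ?l ?m th] lm th by simp
    finally show ?thesis by (simp add: fv)
  qed
  \<comment> \<open>Blocking enters the drift additively, hence only through its probability,
    whatever its correlation with the state of the class.\<close>
  have L_le: "(\<integral>\<tau>. generator i f (dec i (X u \<tau>) (Y u \<tau>)) (z i u \<tau>) \<partial>Q) \<le> p * ?l * pb - c * ((\<integral>\<tau>. f (z i u \<tau>) \<partial>Q) - B)"
    if u: "0 < u" for u
  proof -
    let ?A = "{\<tau> \<in> space Q. bl (X u \<tau>) (Y u \<tau>)}"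
    have A: "?A \<in> sets Q" by (rule measurable_XY_set)
    have "(\<integral>\<tau>. generator i f (dec i (X u \<tau>) (Y u \<tau>)) (z i u \<tau>) \<partial>Q) \<le> (\<integral>\<tau>. p * ?l * indicator ?A \<tau> - c * (f (z i u \<tau>) - B) \<partial>Q)"
    proof (rule integral_mono[OF dyn(2)])
      show "integrable Q (\<lambda>\<tau>. p * ?l * indicator ?A \<tau> - c * (f (z i u \<tau>) - B))"
        using A by (intro Bochner_Integration.integrable_diff integrable_mult_right dyn(1)
          integrable_real_indicator integrable_const) (simp_all add: Q.emeasure_eq_measure)
      fix \<tau> assume "\<tau> \<in> space Q"
      then show "generator i f (dec i (X u \<tau>) (Y u \<tau>)) (z i u \<tau>) \<le> p * ?l * indicator ?A \<tau> - c * (f (z i u \<tau>) - B)"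
        using gen_le[of "z i u \<tau>" "X u \<tau>" "Y u \<tau>"] by (simp add: indicator_def of_bool_def)
    qed
    also have "\<dots> = p * ?l * Q.prob ?A - c * ((\<integral>\<tau>. f (z i u \<tau>) \<partial>Q) - B)"
      using A dyn(1)[of u] by (simp add: Q.prob_space Q.emeasure_eq_measure)
    also have "\<dots> \<le> p * ?l * pb - c * ((\<integral>\<tau>. f (z i u \<tau>) \<partial>Q) - B)"
      using pb[OF u] pq lm by (intro diff_right_mono mult_left_mono) auto
    finally show ?thesis .
  qed
  have init: "f (\<lambda>q. if q = None then y0 i else 0) \<le> B"
    unfolding f_def B_def hh_def using cp.initial[OF pq(2) sg0 th0, of p] by simp
  show "integrable Q (\<lambda>\<tau>. hh (X t \<tau> i) (Y t \<tau> i))" using dyn(1)[of t] by (simp add: f_z)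
  have "(\<integral>\<tau>. f (z i t \<tau>) \<partial>Q) \<le> B + p * ?l * pb * (1 - exp (- c * t)) / c"
    by (rule gronwall_linear[where \<phi>="\<lambda>u. \<integral>\<tau>. f (z i u \<tau>) \<partial>Q", OF dyn(3) dyn(4) L_le c init t])
  then show "(\<integral>\<tau>. hh (X t \<tau> i) (Y t \<tau> i) \<partial>Q) \<le> q * (real (card K) + of_bool sg) * exp th
      + p * arrival_rate N i * pb * (1 - exp (- (service_rate N i * (1 - \<epsilon> / 2)) * t)) / (service_rate N i * (1 - \<epsilon> / 2))"
    unfolding f_z B_def c_def .
qed

text \<open>Accepted or not, every request stays for an exponential time of the same rate, so the
  total number is an M/M/infinity queue regardless of the decisions. Its mean solves a linear
  equation; the lower bound comes from comparing the negated mean.\<close>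

lemma expectation_total_ge:
  assumes i: "i \<in> classes N" and t: "0 < t"
  shows "integrable Q (\<lambda>\<tau>. real (class_size i (z i t \<tau>)))"
    and "real (y0 i) * exp (- service_rate N i * t) + load N i * (1 - exp (- service_rate N i * t))
      \<le> (\<integral>\<tau>. real (class_size i (z i t \<tau>)) \<partial>Q)"
proof -
  let ?l = "arrival_rate N i" and ?m = "service_rate N i"
  have lm: "0 < ?l" "0 < ?m" using rates[OF i] by auto
  let ?f = "\<lambda>v. real (class_size i v)"
  have growth: "?f v \<le> 1 * exp (1 * real (class_size i v))" for v
    using exp_ge_add_one_self[of "real (class_size i v)"] unfolding mult_1 by linarith
  note dyn = dynkin[of i ?f 1 1, OF i of_nat_0_le_iff growth zero_le_one zero_le_one]
  show "integrable Q (\<lambda>\<tau>. real (class_size i (z i t \<tau>)))" by (rule dyn(1))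
  have up: "?f (v(s := Suc (v s))) - ?f v = 1" if "s \<in> stations i" for v s
    using that unfolding class_size_def by (simp add: sum.remove[of _ s])
  have down: "real (v s) * (?f (v(s := v s - 1)) - ?f v) = - real (v s)" if "s \<in> stations i" for v s
    using that unfolding class_size_def by (cases "v s") (simp_all add: sum.remove[of _ s])
  have generator: "generator i ?f (dec i x y) v = ?l - ?m * ?f v" for x y v
  proof -
    have "(\<Sum>q\<in>stations i. real (v q) * (?f (v(q := v q - 1)) - ?f v)) = (\<Sum>q\<in>stations i. - real (v q))"
      by (intro sum.cong refl down)
    also have "\<dots> = - ?f v" by (simp add: class_size_def sum_negf)
    finally show ?thesis unfolding generator_def up[OF dec_stations[OF i]] by simp
  qed
  let ?\<phi> = "\<lambda>u. - (\<integral>\<tau>. ?f (z i u \<tau>) \<partial>Q)"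
  let ?L = "\<lambda>u. \<integral>\<tau>. generator i ?f (dec i (X u \<tau>) (Y u \<tau>)) (z i u \<tau>) \<partial>Q"
  have "?\<phi> t \<le> - real (y0 i) + (?m * real (y0 i) - ?l) * (1 - exp (- ?m * t)) / ?m"
  proof (rule gronwall_linear[where L="\<lambda>u. - ?L u" and ini="- real (y0 i)"])
    show "(\<lambda>u. - ?L u) integrable_on {0..t}" if "0 < t" for t by (intro integrable_neg dyn(3) that)
    show "?\<phi> t = - real (y0 i) + integral {0..t} (\<lambda>u. - ?L u)" if "0 < t" for t
      using dyn(4)[OF that] by (simp add: class_size_def sum_stations)
    show "- ?L u \<le> ?m * real (y0 i) - ?l - ?m * (?\<phi> u - - real (y0 i))" for u
      unfolding generator using dyn(1)[of u] by (simp add: Q.prob_space algebra_simps)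
  qed (use lm t in auto)
  moreover have "(?m * real (y0 i) - ?l) * (1 - exp (- ?m * t)) / ?m
      = real (y0 i) * (1 - exp (- ?m * t)) - load N i * (1 - exp (- ?m * t))"
    using lm by (simp add: load_def field_simps)
  ultimately show "real (y0 i) * exp (- ?m * t) + load N i * (1 - exp (- ?m * t)) \<le> (\<integral>\<tau>. ?f (z i t \<tau>) \<partial>Q)"
    by (simp add: algebra_simps)
qed

end

section \<open>The penalty policy\<close>

locale penalty_network =
  fixes N :: loss_network and \<epsilon> \<beta> :: real and \<alpha> :: "nat \<Rightarrow> nat \<Rightarrow> real" and y0 :: "nat \<Rightarrow> nat"
    and sel :: "nat \<Rightarrow> (nat \<Rightarrow> nat \<Rightarrow> nat) \<Rightarrow> (nat \<Rightarrow> nat) \<Rightarrow> nat"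
  assumes network: "is_loss_network N"
    and eps: "0 < \<epsilon>" "\<epsilon> < 1 / 4"
    and feasible: "lp_feasible N (\<lambda>k. 1 / (1 + 4 * \<epsilon>) * capacity N k) \<alpha>"
    and beta_pos: "0 < \<beta>"
    and beta_c0: "\<forall>i\<in>classes N. \<forall>j\<in>allocs N i. \<forall>k\<in>resources N.
                    0 < alloc N i j k \<longrightarrow> \<beta> \<le> \<epsilon> * (c0 N \<epsilon> \<alpha> i k / alloc N i j k)"
    and beta_c1: "\<forall>i\<in>classes N. class_fraction N \<alpha> i < 1 \<longrightarrow> \<beta> \<le> \<epsilon> * c1 N \<epsilon> \<alpha> i"
    and initial: "\<forall>i\<in>classes N. real (y0 i) = (1 - class_fraction N \<alpha> i) * load N i"
    and ties: "tie_breaking N \<beta> (c0 N \<epsilon> \<alpha>) sel"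
begin

definition dec :: "nat \<Rightarrow> (nat \<Rightarrow> nat \<Rightarrow> nat) \<Rightarrow> (nat \<Rightarrow> nat) \<Rightarrow> nat option" where
  "dec = penalty_decision N \<beta> (c0 N \<epsilon> \<alpha>) (c1 N \<epsilon> \<alpha>) sel"

text \<open>For every other resource the penalty is constant and the scale \<open>c0\<close> is 0,
  so that its slopes would be quotients by 0.\<close>

definition relevant :: "nat \<Rightarrow> nat set" where
  "relevant i = {k \<in> resources N. \<exists>j\<in>allocs N i. alloc N i j k \<noteq> 0}"

definition slope :: "nat \<Rightarrow> nat \<Rightarrow> nat \<Rightarrow> real" where
  "slope i j k = \<beta> * alloc N i j k / c0 N \<epsilon> \<alpha> i k"

definition fslope :: "nat \<Rightarrow> real" where
  "fslope i = \<beta> / c1 N \<epsilon> \<alpha> i"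

text \<open>The constant \<beta>' of the potential: a bound for the \<alpha>-averaged network
  slopes, and equal to (1 - \<alpha>) times the fictitious slope when \<alpha> < 1. Multiplied by
  the load it is \<beta> / (1 + 4 \<epsilon>), independently of the class.\<close>

definition mixed :: "nat \<Rightarrow> real" where
  "mixed i = \<beta> / ((1 + 4 * \<epsilon>) * load N i)"

abbreviation cf :: "nat \<Rightarrow> real" where "cf \<equiv> class_fraction N \<alpha>"
abbreviation C0 where "C0 \<equiv> c0 N \<epsilon> \<alpha>"

lemma alloc_nonneg: "i \<in> classes N \<Longrightarrow> j \<in> allocs N i \<Longrightarrow> k \<in> resources N \<Longrightarrow> 0 \<le> alloc N i j k"
  and capacity_nonneg: "k \<in> resources N \<Longrightarrow> 0 \<le> capacity N k"
  and rates_pos: "i \<in> classes N \<Longrightarrow> 0 < arrival_rate N i" "i \<in> classes N \<Longrightarrow> 0 < service_rate N i"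
  and reward_nonneg: "i \<in> classes N \<Longrightarrow> 0 \<le> reward N i"
  using network by (auto simp: is_loss_network_def)

lemma load_pos: "i \<in> classes N \<Longrightarrow> 0 < load N i"
  using rates_pos by (simp add: load_def)

lemma \<alpha>_nonneg: "i \<in> classes N \<Longrightarrow> j \<in> allocs N i \<Longrightarrow> 0 \<le> \<alpha> i j"
  using feasible by (simp add: lp_feasible_def)

lemma frac_bounds: "i \<in> classes N \<Longrightarrow> 0 \<le> cf i" "i \<in> classes N \<Longrightarrow> cf i \<le> 1"
  using feasible \<alpha>_nonneg by (auto simp: lp_feasible_def class_fraction_def intro!: sum_nonneg)

text \<open>Positivity of the scale is a consequence of the smallness condition, because \<beta>
  itself is positive.\<close>

lemma c0_ge:
  assumes "i \<in> classes N" "j \<in> allocs N i" "k \<in> resources N" "alloc N i j k \<noteq> 0"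
  shows "0 < C0 i k" "\<beta> * alloc N i j k \<le> \<epsilon> * C0 i k"
proof -
  have a: "0 < alloc N i j k" using alloc_nonneg[OF assms(1-3)] assms(4) by simp
  have "\<beta> \<le> \<epsilon> * (C0 i k / alloc N i j k)" using beta_c0 assms a by blast
  then show le: "\<beta> * alloc N i j k \<le> \<epsilon> * C0 i k" using a by (simp add: field_simps)
  have "0 < \<epsilon> * C0 i k" using mult_pos_pos[OF beta_pos a] le by linarith
  then show "0 < C0 i k" using eps by (simp add: zero_less_mult_iff)
qed

lemma C0_relevant:
  assumes "i \<in> classes N" "k \<in> relevant i"
  shows "0 < C0 i k"
  using assms c0_ge(1) unfolding relevant_def by blast

lemma C0_irrelevant: "k \<in> resources N \<Longrightarrow> k \<notin> relevant i \<Longrightarrow> C0 i k = 0"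
  by (simp add: relevant_def c0_def)

lemma C0_nonneg: "i \<in> classes N \<Longrightarrow> k \<in> resources N \<Longrightarrow> 0 \<le> C0 i k"
  using C0_relevant C0_irrelevant by (cases "k \<in> relevant i") (auto intro: less_imp_le)

definition demand :: "nat \<Rightarrow> real" where
  "demand k = (\<Sum>i\<in>classes N. \<Sum>j\<in>allocs N i. \<alpha> i j * load N i * alloc N i j k)"

text \<open>The perturbed program leaves a demand of at most b(k) / (1 + 4 \<epsilon>), and
  \<open>nu\<close> is the factor up to this bound. Positivity of \<open>c0\<close> excludes a zero
  denominator.\<close>

lemma nu_ge_1:
  assumes i: "i \<in> classes N" and k: "k \<in> relevant i"
  shows "1 \<le> nu N \<epsilon> \<alpha> k" "0 < demand k" "0 < (\<Sum>j\<in>allocs N i. \<alpha> i j * alloc N i j k)"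
proof -
  have kr: "k \<in> resources N" using k by (simp add: relevant_def)
  have "0 \<le> demand k" unfolding demand_def
    using \<alpha>_nonneg alloc_nonneg kr load_pos by (intro sum_nonneg mult_nonneg_nonneg) (auto intro: less_imp_le)
  have pos: "0 < C0 i k" by (rule C0_relevant[OF i k])
  then have "nu N \<epsilon> \<alpha> k \<noteq> 0" and ne: "(\<Sum>j\<in>allocs N i. \<alpha> i j * alloc N i j k) \<noteq> 0" by (auto simp: c0_def)
  then show d: "0 < demand k" using \<open>0 \<le> demand k\<close> unfolding nu_def demand_def by (auto simp: less_le)
  have "0 \<le> (\<Sum>j\<in>allocs N i. \<alpha> i j * alloc N i j k)"
    using \<alpha>_nonneg alloc_nonneg kr i by (intro sum_nonneg mult_nonneg_nonneg) auto
  then show "0 < (\<Sum>j\<in>allocs N i. \<alpha> i j * alloc N i j k)" using ne by simp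
  have "demand k = (\<Sum>i\<in>classes N. load N i * (\<Sum>j\<in>allocs N i. alloc N i j k * \<alpha> i j))"
    unfolding demand_def sum_distrib_left by (simp add: mult_ac)
  also have "\<dots> \<le> 1 / (1 + 4 * \<epsilon>) * capacity N k" using feasible kr by (simp add: lp_feasible_def)
  finally show "1 \<le> nu N \<epsilon> \<alpha> k" using d unfolding nu_def demand_def[symmetric] by (simp only: le_divide_eq_1_pos)
qed

text \<open>The purpose of \<open>nu\<close>: the scales of the classes share the capacity of the
  resource exactly, hence can serve as convex weights.\<close>

lemma sum_C0:
  assumes i: "i \<in> classes N" and k: "k \<in> relevant i"
  shows "(\<Sum>i'\<in>classes N. C0 i' k) = capacity N k" "0 < capacity N k"
proof -
  note d = nu_ge_1[OF i k]
  have "(\<Sum>i'\<in>classes N. C0 i' k) = (1 + 4 * \<epsilon>) * nu N \<epsilon> \<alpha> k * demand k"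
    unfolding c0_def demand_def sum_distrib_left sum_distrib_right by (simp add: mult_ac)
  also have "\<dots> = capacity N k"
  proof -
    have "g * (1 / g * b / x) * x = b" if "0 < g" "0 < x" for g b x :: real using that by simp
    from this[of "1 + 4 * \<epsilon>" "demand k"] show ?thesis
      using d(2) eps unfolding nu_def demand_def[symmetric] by simp
  qed
  finally show eq: "(\<Sum>i'\<in>classes N. C0 i' k) = capacity N k" .
  have kr: "k \<in> resources N" using k by (simp add: relevant_def)
  have "0 < (\<Sum>i'\<in>classes N. C0 i' k)"
    using C0_relevant[OF i k] C0_nonneg kr i by (intro sum_pos2) auto
  then show "0 < capacity N k" by (simp add: eq)
qed

lemma class_potential:
  assumes i: "i \<in> classes N"
  shows "class_potential (allocs N i) (relevant i) (slope i) (\<alpha> i) \<epsilon> (mixed i) (fslope i) (cf i \<noteq> 1)"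
proof
  have l: "0 < load N i" by (rule load_pos[OF i])
  show "finite (allocs N i)" "finite (relevant i)" by (simp_all add: relevant_def)
  show "0 < \<epsilon>" "\<epsilon> < 1 / 4" by (rule eps)+
  show "0 \<le> slope i j k \<and> slope i j k \<le> \<epsilon>" if "j \<in> allocs N i" "k \<in> relevant i" for j k
  proof -
    have k: "k \<in> resources N" using that by (simp add: relevant_def)
    have c: "0 < C0 i k" by (rule C0_relevant[OF i that(2)])
    have "0 \<le> alloc N i j k" by (rule alloc_nonneg[OF i that(1) k])
    then show ?thesis using c beta_pos eps c0_ge(2)[OF i that(1) k]
      by (cases "alloc N i j k = 0") (auto simp: slope_def divide_le_eq)
  qed
  show "0 \<le> \<alpha> i j" if "j \<in> allocs N i" for j by (rule \<alpha>_nonneg[OF i that])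
  show "sum (\<alpha> i) (allocs N i) \<le> 1" using frac_bounds[OF i] by (simp add: class_fraction_def)
  show "0 \<le> mixed i" using beta_pos eps l by (simp add: mixed_def)
  show "(\<Sum>j\<in>allocs N i. \<alpha> i j * slope i j k) \<le> mixed i" if k: "k \<in> relevant i" for k
  proof -
    note d = nu_ge_1[OF i k]
    have "(\<Sum>j\<in>allocs N i. \<alpha> i j * slope i j k) = \<beta> / C0 i k * (\<Sum>j\<in>allocs N i. \<alpha> i j * alloc N i j k)"
      unfolding slope_def sum_distrib_left by (simp add: mult_ac)
    \<comment> \<open>The scale \<open>c0\<close> contains the same \<alpha>-average of the
      allocations, which cancels.\<close>
    also have "\<dots> = mixed i / nu N \<epsilon> \<alpha> k" using d(3) by (simp add: c0_def mixed_def)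
    also have "\<dots> \<le> mixed i / 1" using d(1) \<open>0 \<le> mixed i\<close> by (intro divide_left_mono) auto
    finally show ?thesis by simp
  qed
  show "0 < sum (\<alpha> i) (allocs N i)" if ne: "relevant i \<noteq> {}"
  proof -
    obtain k where "k \<in> relevant i" using ne by blast
    from nu_ge_1(3)[OF i this] have "\<exists>j\<in>allocs N i. \<alpha> i j \<noteq> 0"
      by (metis (no_types, lifting) less_irrefl mult_zero_left sum.neutral)
    then show ?thesis using \<alpha>_nonneg[OF i] by (metis finite_allocs less_le sum_pos2)
  qed
  show "0 \<le> fslope i" "fslope i \<le> \<epsilon>"
  proof -
    have "0 \<le> fslope i \<and> fslope i \<le> \<epsilon>"
    proof (cases "cf i = 1")
      \<comment> \<open>Here \<open>c1\<close> is 0, and the quotient \<beta> / 0 is 0 by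
        convention.\<close>
      case True then show ?thesis using eps by (simp add: fslope_def c1_def)
    next
      case False
      then have "cf i < 1" using frac_bounds[OF i] by simp
      then have "0 < c1 N \<epsilon> \<alpha> i" "\<beta> \<le> \<epsilon> * c1 N \<epsilon> \<alpha> i" using l eps beta_c1 i by (auto simp: c1_def)
      then show ?thesis using beta_pos by (simp add: fslope_def divide_le_eq)
    qed
    then show "0 \<le> fslope i" "fslope i \<le> \<epsilon>" by auto
  qed
  show "(1 - sum (\<alpha> i) (allocs N i)) * fslope i \<le> mixed i" if "cf i \<noteq> 1"
    using that l eps by (simp add: fslope_def c1_def mixed_def class_fraction_def)
  show "sum (\<alpha> i) (allocs N i) = 1" if "\<not> cf i \<noteq> 1" using that by (simp add: class_fraction_def)
qed

section \<open>The decisions of the policy are admissible for the potential\<close>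

lemma net_price_eq:
  assumes i: "i \<in> classes N" and j: "j \<in> allocs N i"
  shows "net_price N \<beta> C0 i j (\<lambda>j'. real (x j')) = class_potential.price (allocs N i) (relevant i) (slope i) x j"
proof -
  interpret cp: class_potential "allocs N i" "relevant i" "slope i" "\<alpha> i" \<epsilon> "mixed i" "fslope i" "cf i \<noteq> 1"
    by (rule class_potential[OF i])
  let ?v = "\<lambda>j'. real (x j')"
  have "deriv (\<lambda>u. net_penalty N \<beta> C0 i k (?v(j := u))) (?v j) = (if k \<in> relevant i then cp.\<Psi> x k * slope i j k else 0)"
    if k: "k \<in> resources N" for k
  proof (cases "k \<in> relevant i")
    case False
    then have "net_penalty N \<beta> C0 i k = (\<lambda>_. 1)" using k by (auto simp: relevant_def net_penalty_def fun_eq_iff)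
    then show ?thesis using False by simp
  next
    case True
    then have pen: "net_penalty N \<beta> C0 i k v = exp (\<beta> * ((\<Sum>j\<in>allocs N i. v j * alloc N i j k) / C0 i k))" for v
      by (auto simp: relevant_def net_penalty_def)
    define R where "R = (\<Sum>j'\<in>allocs N i - {j}. ?v j' * alloc N i j' k)"
    have split: "(\<Sum>j'\<in>allocs N i. (?v(j := u)) j' * alloc N i j' k) = u * alloc N i j k + R" for u
      unfolding R_def using j by (subst sum.remove[of _ j]) (auto intro!: sum.cong)
    have "((\<lambda>u. exp (\<beta> * ((u * alloc N i j k + R) / C0 i k))) has_real_derivative
        exp (\<beta> * ((?v j * alloc N i j k + R) / C0 i k)) * slope i j k) (at (?v j))"
      unfolding slope_def using C0_relevant[OF i True] by (auto intro!: derivative_eq_intros)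
    then have "deriv (\<lambda>u. net_penalty N \<beta> C0 i k (?v(j := u))) (?v j)
        = exp (\<beta> * ((?v j * alloc N i j k + R) / C0 i k)) * slope i j k"
      unfolding pen split by (rule DERIV_imp_deriv)
    also have "?v j * alloc N i j k + R = (\<Sum>j'\<in>allocs N i. ?v j' * alloc N i j' k)"
      unfolding R_def using j by (subst (2) sum.remove[of _ j]) auto
    also have "exp (\<beta> * ((\<Sum>j'\<in>allocs N i. ?v j' * alloc N i j' k) / C0 i k)) = cp.\<Psi> x k"
      unfolding cp.\<Psi>_def slope_def by (simp add: sum_distrib_left sum_divide_distrib mult_ac)
    finally show ?thesis using True by (simp only: if_True)
  qed
  then have "net_price N \<beta> C0 i j ?v = (\<Sum>k\<in>resources N. if k \<in> relevant i then cp.\<Psi> x k * slope i j k else 0)"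
    unfolding net_price_def by (intro sum.cong) simp_all
  also have "\<dots> = (\<Sum>k\<in>relevant i. cp.\<Psi> x k * slope i j k)"
    by (intro sum.mono_neutral_cong_right) (auto simp: relevant_def)
  finally show ?thesis by (simp add: cp.price_def)
qed

lemma fict_price_eq: "fict_price \<beta> (c1 N \<epsilon> \<alpha>) i (real n) = fslope i * exp (fslope i * real n)"
proof -
  have "((\<lambda>u. exp (fslope i * u)) has_real_derivative exp (fslope i * real n) * fslope i) (at (real n))"
    by (auto intro!: derivative_eq_intros)
  moreover have "(\<lambda>u. exp (fslope i * u)) = (\<lambda>u. exp (\<beta> * (u / c1 N \<epsilon> \<alpha> i)))"
    by (simp add: fslope_def)
  ultimately have "((\<lambda>u. exp (\<beta> * (u / c1 N \<epsilon> \<alpha> i))) has_real_derivative exp (fslope i * real n) * fslope i) (at (real n))"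
    by simp
  then show ?thesis unfolding fict_price_def fict_penalty_def[abs_def] by (simp add: DERIV_imp_deriv mult.commute)
qed

lemma sel_arg_min:
  assumes i: "i \<in> classes N" and ne: "allocs N i \<noteq> {}"
  shows "sel i x y \<in> allocs N i"
    "j \<in> allocs N i \<Longrightarrow> net_price N \<beta> C0 i (sel i x y) (\<lambda>j'. real (x i j')) \<le> net_price N \<beta> C0 i j (\<lambda>j'. real (x i j'))"
proof -
  have am: "is_arg_min (\<lambda>j. net_price N \<beta> C0 i j (\<lambda>j'. real (x i j'))) (\<lambda>j. j \<in> allocs N i) (sel i x y)"
    using ties i ne unfolding tie_breaking_def by blast
  then show "sel i x y \<in> allocs N i" by (simp add: is_arg_min_def)
  show "j \<in> allocs N i \<Longrightarrow> net_price N \<beta> C0 i (sel i x y) (\<lambda>j'. real (x i j')) \<le> net_price N \<beta> C0 i j (\<lambda>j'. real (x i j'))"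
    using am by (auto simp: is_arg_min_linorder)
qed

text \<open>Ignores whether the request would be conditionally accepted. This larger event is a
  statement about the occupation of the resources alone.\<close>

definition blocked :: "nat \<Rightarrow> (nat \<Rightarrow> nat \<Rightarrow> nat) \<Rightarrow> (nat \<Rightarrow> nat) \<Rightarrow> bool" where
  "blocked i x y \<longleftrightarrow> allocs N i \<noteq> {} \<and> \<not> adequate_capacity N i (sel i x y) x"

lemma c1_eq_0:
  assumes "i \<in> classes N"
  shows "c1 N \<epsilon> \<alpha> i = 0 \<longleftrightarrow> cf i = 1"
proof -
  have "load N i \<noteq> 0" "1 + 4 * \<epsilon> \<noteq> 0" using load_pos[OF assms] eps by auto
  then show ?thesis unfolding c1_def by simp
qed

lemma admissible:
  assumes i: "i \<in> classes N"
  shows "class_potential.admissible (allocs N i) (relevant i) (slope i) (fslope i) (cf i \<noteq> 1) (x i) (y i) (blocked i x y) (dec i x y)"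
proof -
  interpret cp: class_potential "allocs N i" "relevant i" "slope i" "\<alpha> i" \<epsilon> "mixed i" "fslope i" "cf i \<noteq> 1"
    by (rule class_potential[OF i])
  let ?p = "\<lambda>j. net_price N \<beta> C0 i j (\<lambda>j'. real (x i j'))"
  let ?acc = "conditionally_accepted N \<beta> C0 (c1 N \<epsilon> \<alpha>) i x y"
  have price: "?p j = cp.price (x i) j" if "j \<in> allocs N i" for j by (rule net_price_eq[OF i that])
  have acc: "?acc \<longleftrightarrow> allocs N i \<noteq> {} \<and> (cf i = 1 \<or> Min (?p ` allocs N i) \<le> fslope i * exp (fslope i * real (y i)))"
    unfolding conditionally_accepted_def c1_eq_0[OF i] fict_price_eq ..
  show ?thesis
  proof (cases "?acc \<and> adequate_capacity N i (sel i x y) x")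
    case True
    then have d: "dec i x y = Some (sel i x y)" by (simp add: dec_def penalty_decision_def)
    have ne: "allocs N i \<noteq> {}" using True acc by blast
    note s = sel_arg_min[OF i ne, where x=x and y=y]
    have "Min (?p ` allocs N i) = ?p (sel i x y)"
      using s ne by (intro Min_eqI) auto
    then show ?thesis unfolding cp.admissible_def d
      using s True acc price by auto
  next
    case False
    then have d: "dec i x y = None" by (auto simp: dec_def penalty_decision_def)
    show ?thesis
    proof (cases "?acc")
      case True
      then show ?thesis using False acc unfolding cp.admissible_def d blocked_def by simp
    next
      case rejected: False
      show ?thesis
      proof (cases "allocs N i = {}")
        case True
        then have "cf i = 0" by (simp add: class_fraction_def)
        then show ?thesis using True unfolding cp.admissible_def d by simp
      next
        case False
        then have "cf i \<noteq> 1" and gt: "\<not> Min (?p ` allocs N i) \<le> fslope i * exp (fslope i * real (y i))"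
          using rejected acc by blast+
        have "fslope i * exp (fslope i * real (y i)) < cp.price (x i) j" if j: "j \<in> allocs N i" for j
        proof -
          have "Min (?p ` allocs N i) \<le> ?p j" using j by (intro Min_le) auto
          then show ?thesis using gt price[OF j] by linarith
        qed
        then show ?thesis using \<open>cf i \<noteq> 1\<close> unfolding cp.admissible_def d by simp
      qed
    qed
  qed
qed

lemma dec_allocs: "i \<in> classes N \<Longrightarrow> dec i x y = Some j \<Longrightarrow> j \<in> allocs N i"
  using sel_arg_min(1)[of i, where x=x and y=y]
  by (auto simp: dec_def penalty_decision_def conditionally_accepted_def split: if_splits)

sublocale loss_dynamics N y0 dec
  by unfold_locales (rule network, rule dec_allocs)

section \<open>Expected penalties and the blocking probability\<close>

text \<open>The solution of the balance equation in \<open>drift\<close>. It does not depend on the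
  class, since \<open>mixed i\<close> is inversely proportional to the load.\<close>

definition th :: real where
  "th = (exp \<epsilon> - 1) / \<epsilon> * \<beta> / ((1 + 4 * \<epsilon>) * (1 - \<epsilon> / 2))"

text \<open>A bound for the expected total penalty of a class: at most s network penalties and one
  fictitious penalty, each bounded via exp \<open>th\<close>.\<close>

definition mass :: real where
  "mass = (real (n_resources N) + 1) * exp (\<beta> * (1 - \<epsilon> / 2))"

text \<open>The upper bound for \<open>th\<close> is where the slack 1 + 4 \<epsilon> is spent. The
  lower bound covers the initial fictitious load, whose logarithmic penalty is \<beta> / (1 + 4
  \<epsilon>) or 0.\<close>

lemma th_facts: "0 \<le> th" "th \<le> \<beta> * (1 - \<epsilon> / 2)" "\<beta> / (1 + 4 * \<epsilon>) \<le> th"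
  "i \<in> classes N \<Longrightarrow> class_potential.E1 \<epsilon> * mixed i * arrival_rate N i = service_rate N i * (1 - \<epsilon> / 2) * th"
proof -
  define E where "E = (exp \<epsilon> - 1) / \<epsilon>"
  have "1 + \<epsilon> \<le> exp \<epsilon>" by (rule exp_ge_add_one_self)
  then have E1: "1 \<le> E" using eps by (simp add: E_def field_simps)
  have "exp \<epsilon> \<le> 1 + \<epsilon> + \<epsilon>\<^sup>2" using eps by (intro exp_bound) auto
  then have E2: "E \<le> 1 + \<epsilon>" using eps by (simp add: E_def field_simps power2_eq_square)
  have th: "th = E * \<beta> / ((1 + 4 * \<epsilon>) * (1 - \<epsilon> / 2))" by (simp add: th_def E_def)
  have pos: "0 < 1 + 4 * \<epsilon>" "0 < 1 - \<epsilon> / 2" using eps by auto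
  show "0 \<le> th" using E1 beta_pos pos by (simp add: th)
  have "\<epsilon> * \<epsilon> \<le> \<epsilon> * (1 / 4)" using eps by (intro mult_left_mono) auto
  have "0 \<le> \<epsilon> * \<epsilon> * \<epsilon>" using eps by simp
  \<comment> \<open>The arrival error is at most 1 + \<epsilon>. One factor 1 - \<epsilon>/2 is the
    departure error, the other one is the gain which makes blocking improbable.\<close>
  have "1 + \<epsilon> \<le> (1 + 4 * \<epsilon>) * (1 - \<epsilon> / 2) * (1 - \<epsilon> / 2)"
  proof -
    have "(1 + 4 * \<epsilon>) * (1 - \<epsilon> / 2) * (1 - \<epsilon> / 2) = 1 + 3 * \<epsilon> - 15 / 4 * (\<epsilon> * \<epsilon>) + \<epsilon> * \<epsilon> * \<epsilon>"
      by (simp add: field_simps)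
    then show ?thesis using eps \<open>\<epsilon> * \<epsilon> \<le> \<epsilon> * (1 / 4)\<close> \<open>0 \<le> \<epsilon> * \<epsilon> * \<epsilon>\<close> by linarith
  qed
  then have "E * \<beta> \<le> ((1 + 4 * \<epsilon>) * (1 - \<epsilon> / 2) * (1 - \<epsilon> / 2)) * \<beta>"
    using E2 beta_pos by (intro mult_right_mono) auto
  then show "th \<le> \<beta> * (1 - \<epsilon> / 2)" using pos by (simp add: th divide_le_eq mult_ac)
  have "\<beta> * (1 - \<epsilon> / 2) \<le> E * \<beta> * 1"
    using mult_mono[of "1 - \<epsilon> / 2" E \<beta> \<beta>] E1 beta_pos eps by (simp add: mult.commute)
  then have "\<beta> * (1 - \<epsilon> / 2) / ((1 + 4 * \<epsilon>) * (1 - \<epsilon> / 2)) \<le> th"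
    unfolding th mult_1_right using pos by (intro divide_right_mono) auto
  then show "\<beta> / (1 + 4 * \<epsilon>) \<le> th" using pos by simp
  show "class_potential.E1 \<epsilon> * mixed i * arrival_rate N i = service_rate N i * (1 - \<epsilon> / 2) * th" if i: "i \<in> classes N"
  proof -
    interpret cp: class_potential "allocs N i" "relevant i" "slope i" "\<alpha> i" \<epsilon> "mixed i" "fslope i" "cf i \<noteq> 1"
      by (rule class_potential[OF i])
    have "E * (\<beta> / (g * (l / m))) * l = m * r * (E * \<beta> / (g * r))" if "0 < g" "0 < r" "0 < l" "0 < m" for g r l m :: real
      using that by simp
    from this[OF pos rates_pos[OF i]] show ?thesis
      unfolding cp.E1_def E_def[symmetric] th mixed_def load_def .
  qed
qed

lemma card_relevant: "card (relevant i) \<le> n_resources N"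
proof -
  have "card (relevant i) \<le> card (resources N)" by (intro card_mono) (auto simp: relevant_def)
  then show ?thesis by (simp add: resources_def)
qed

lemma mass_ge: "(real (card (relevant i)) + of_bool sg) * exp th \<le> mass"
  unfolding mass_def using th_facts(2) card_relevant[of i]
  by (intro mult_mono add_mono) auto

lemma init_facts:
  assumes i: "i \<in> classes N"
  shows "fslope i * real (y0 i) \<le> th" "\<not> cf i \<noteq> 1 \<Longrightarrow> y0 i = 0"
proof -
  have y: "real (y0 i) = (1 - cf i) * load N i" using initial i by blast
  show "\<not> cf i \<noteq> 1 \<Longrightarrow> y0 i = 0" using y by simp
  show "fslope i * real (y0 i) \<le> th"
  proof (cases "cf i = 1")
    case False
    then have "fslope i * real (y0 i) = \<beta> / (1 + 4 * \<epsilon>)"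
      unfolding y fslope_def c1_def using load_pos[OF i] eps by simp
    then show ?thesis using th_facts(3) by simp
  qed (use y th_facts(1) in simp)
qed

abbreviation load_factor :: "nat \<Rightarrow> nat \<Rightarrow> (nat \<Rightarrow> nat) \<Rightarrow> real" where
  "load_factor i k x \<equiv> class_potential.\<Psi> (allocs N i) (slope i) x k"

lemma mass_pos: "0 < mass"
  by (simp add: mass_def add_nonneg_pos)

text \<open>\<open>class_bound\<close> with p = 0, q = 1 and the trivial bound 1 for the blocking
  probability: phantoms are free of charge, and they never bring the potential below
  \<open>S\<close>.\<close>

lemma load_factor_expectation:
  assumes i: "i \<in> classes N" and k: "k \<in> relevant i" and u: "0 < u"
  shows "integrable Q (\<lambda>\<tau>. load_factor i k (X u \<tau> i))"
    and "(\<integral>\<tau>. load_factor i k (X u \<tau> i) \<partial>Q) \<le> mass"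
proof -
  interpret cp: class_potential "allocs N i" "relevant i" "slope i" "\<alpha> i" \<epsilon> "mixed i" "fslope i" "cf i \<noteq> 1"
    by (rule class_potential[OF i])
  note cb = class_bound[OF i class_potential[OF i] admissible[OF i] th_facts(4)[OF i] th_facts(1) init_facts[OF i]
      order_refl zero_le_one Q.prob_le_1 u]
  have le: "load_factor i k x \<le> cp.h 0 1 x y" for x y
  proof -
    have "load_factor i k x \<le> cp.S x" unfolding cp.S_def
      using k cp.finK by (intro member_le_sum) (auto intro: less_imp_le)
    then show ?thesis using cp.S_le_h[of x y] by simp
  qed
  have "(\<lambda>p. load_factor i k (X (fst p) (snd p) i)) \<in> borel_measurable time_clocks"
    by (rule measurable_state) simp
  from measurable_compose[OF measurable_Pair1'[of u borel borel_clocks] this]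
  have m: "(\<lambda>\<tau>. load_factor i k (X u \<tau> i)) \<in> borel_measurable Q" by (simp cong: measurable_cong_sets)
  show int: "integrable Q (\<lambda>\<tau>. load_factor i k (X u \<tau> i))"
  proof (rule Bochner_Integration.integrable_bound[OF cb(1) m])
    show "AE \<tau> in Q. norm (load_factor i k (X u \<tau> i)) \<le> norm (cp.h 0 1 (X u \<tau> i) (Y u \<tau> i))"
      using le by (intro AE_I2) (simp add: cp.h_nonneg less_imp_le[OF cp.\<Psi>_pos])
  qed
  have "(\<integral>\<tau>. load_factor i k (X u \<tau> i) \<partial>Q) \<le> (\<integral>\<tau>. cp.h 0 1 (X u \<tau> i) (Y u \<tau> i) \<partial>Q)"
    by (rule integral_mono[OF int cb(1) le])
  also have "\<dots> \<le> (real (card (relevant i)) + of_bool (cf i \<noteq> 1)) * exp th" using cb(2) by simp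
  also have "\<dots> \<le> mass" by (rule mass_ge)
  finally show "(\<integral>\<tau>. load_factor i k (X u \<tau> i) \<partial>Q) \<le> mass" .
qed

text \<open>
  The weights sum to 1, so by convexity this bounds $\exp(\beta X / b(k))$, where $X$ is the total
  occupation of resource \<^term>\<open>k\<close>.
\<close>

definition overload :: "nat \<Rightarrow> (nat \<Rightarrow> nat \<Rightarrow> nat) \<Rightarrow> real" where
  "overload k x = (\<Sum>i | i \<in> classes N \<and> k \<in> relevant i. C0 i k / capacity N k * load_factor i k (x i))"

lemma overload_nonneg: "k \<in> resources N \<Longrightarrow> 0 \<le> overload k x"
  unfolding overload_def
  by (intro sum_nonneg mult_nonneg_nonneg divide_nonneg_nonneg)
    (auto simp: capacity_nonneg C0_nonneg class_potential.\<Psi>_pos[OF class_potential] less_imp_le)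

text \<open>If the selected allocation does not fit, the occupation of some resource exceeds its
  capacity minus this allocation, so \<beta> times the relative occupation is at least \<beta> -
  \<epsilon>. This number is the weighted mean of the classes' exponents, and exp is convex.\<close>

lemma blocked_overload:
  assumes i: "i \<in> classes N" and bl: "blocked i x y"
  obtains k where "k \<in> resources N" "exp (\<beta> - \<epsilon>) \<le> overload k x"
proof -
  have ne: "allocs N i \<noteq> {}" using bl by (simp add: blocked_def)
  let ?j = "sel i x y"
  have j: "?j \<in> allocs N i" by (rule sel_arg_min(1)[OF i ne])
  define W where "W i' k = (\<Sum>j'\<in>allocs N i'. alloc N i' j' k * real (x i' j'))" for i' k
  obtain k where k: "k \<in> resources N" and over: "capacity N k < (\<Sum>i'\<in>classes N. W i' k) + alloc N i ?j k"
    using bl unfolding blocked_def adequate_capacity_def W_def by (auto simp: not_le)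
  let ?I = "{i \<in> classes N. k \<in> relevant i}"
  have W0: "W i' k = 0" if "i' \<in> classes N" "k \<notin> relevant i'" for i'
    using that k unfolding W_def relevant_def by (intro sum.neutral) auto
  have sumW: "(\<Sum>i'\<in>classes N. W i' k) = (\<Sum>i'\<in>?I. W i' k)"
    using W0 by (intro sum.mono_neutral_right) auto
  have "?I \<noteq> {}"
  proof
    assume e: "?I = {}"
    then have "alloc N i ?j k = 0" using i j k unfolding relevant_def by auto
    then show False using over sumW e capacity_nonneg[OF k] by simp
  qed
  then obtain i0 where i0: "i0 \<in> classes N" "k \<in> relevant i0" by auto
  note cap = sum_C0[OF i0]
  have C0I: "0 < C0 i' k" if "i' \<in> ?I" for i' using C0_relevant that by auto
  have sum1: "(\<Sum>i'\<in>?I. C0 i' k / capacity N k) = 1"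
  proof -
    have "(\<Sum>i'\<in>classes N. C0 i' k) = (\<Sum>i'\<in>?I. C0 i' k)"
      using C0_irrelevant[OF k] by (intro sum.mono_neutral_right) auto
    then show ?thesis using cap by (simp add: sum_divide_distrib[symmetric])
  qed
  have lf: "load_factor i' k (x i') = exp (\<beta> * W i' k / C0 i' k)" if "i' \<in> ?I" for i'
  proof -
    interpret cp: class_potential "allocs N i'" "relevant i'" "slope i'" "\<alpha> i'" \<epsilon> "mixed i'" "fslope i'" "cf i' \<noteq> 1"
      using class_potential that by auto
    show ?thesis unfolding cp.\<Psi>_def slope_def W_def by (simp add: sum_distrib_left sum_divide_distrib mult_ac)
  qed
  \<comment> \<open>A single allocation is small even relative to the share of its own class in the
    capacity; this is the overshoot \<epsilon>.\<close>
  have small: "\<beta> * alloc N i ?j k \<le> \<epsilon> * capacity N k"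
  proof (cases "alloc N i ?j k = 0")
    case True then show ?thesis using cap eps by simp
  next
    case False
    have "\<beta> * alloc N i ?j k \<le> \<epsilon> * C0 i k" by (rule c0_ge(2)[OF i j k False])
    also have "C0 i k \<le> capacity N k" unfolding cap(1)[symmetric]
      using i C0_nonneg k by (intro member_le_sum) auto
    finally show ?thesis using eps by (simp add: mult_left_mono)
  qed
  have "\<beta> * capacity N k \<le> \<beta> * ((\<Sum>i'\<in>?I. W i' k) + alloc N i ?j k)"
    using over sumW beta_pos by (intro mult_left_mono) auto
  then have "(\<beta> - \<epsilon>) * capacity N k \<le> \<beta> * (\<Sum>i'\<in>?I. W i' k)"
    using small by (simp add: algebra_simps)
  then have "\<beta> - \<epsilon> \<le> \<beta> * (\<Sum>i'\<in>?I. W i' k) / capacity N k" using cap(2) by (simp add: le_divide_eq)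
  also have "\<dots> = (\<Sum>i'\<in>?I. C0 i' k / capacity N k * (\<beta> * W i' k / C0 i' k))"
    unfolding sum_distrib_left sum_divide_distrib using C0I by (intro sum.cong) (auto simp: less_imp_neq[symmetric])
  finally have "exp (\<beta> - \<epsilon>) \<le> exp (\<Sum>i'\<in>?I. C0 i' k / capacity N k * (\<beta> * W i' k / C0 i' k))" by simp
  also have "\<dots> \<le> (\<Sum>i'\<in>?I. C0 i' k / capacity N k * exp (\<beta> * W i' k / C0 i' k))"
    using convex_on_sum[of ?I UNIV exp "\<lambda>i'. C0 i' k / capacity N k" "\<lambda>i'. \<beta> * W i' k / C0 i' k"]
      exp_convex sum1 C0I cap \<open>?I \<noteq> {}\<close> by (simp add: less_imp_le)
  also have "\<dots> = overload k x" unfolding overload_def using lf by (intro sum.cong) auto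
  finally show ?thesis using k by (intro that)
qed

lemma overload_expectation:
  assumes k: "k \<in> resources N" and u: "0 < u"
  shows "integrable Q (\<lambda>\<tau>. overload k (X u \<tau>))" "(\<integral>\<tau>. overload k (X u \<tau>) \<partial>Q) \<le> mass"
proof -
  let ?I = "{i \<in> classes N. k \<in> relevant i}"
  have int: "integrable Q (\<lambda>\<tau>. C0 i k / capacity N k * load_factor i k (X u \<tau> i))" if "i \<in> ?I" for i
    using that load_factor_expectation(1)[of i k u] u by (intro integrable_mult_right) auto
  then show "integrable Q (\<lambda>\<tau>. overload k (X u \<tau>))"
    unfolding overload_def by (intro Bochner_Integration.integrable_sum)
  have "(\<integral>\<tau>. overload k (X u \<tau>) \<partial>Q) = (\<Sum>i\<in>?I. C0 i k / capacity N k * (\<integral>\<tau>. load_factor i k (X u \<tau> i) \<partial>Q))"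
    unfolding overload_def using int by (subst Bochner_Integration.integral_sum) auto
  also have "\<dots> \<le> (\<Sum>i\<in>?I. C0 i k / capacity N k * mass)"
    using load_factor_expectation(2) u C0_nonneg k capacity_nonneg[OF k] by (intro sum_mono mult_left_mono) auto
  also have "\<dots> = (\<Sum>i\<in>?I. C0 i k) / capacity N k * mass"
    by (simp add: sum_distrib_right sum_divide_distrib)
  also have "\<dots> \<le> mass"
  proof (cases "?I = {}")
    case False
    then obtain i0 where i0: "i0 \<in> classes N" "k \<in> relevant i0" by auto
    have "(\<Sum>i'\<in>classes N. C0 i' k) = (\<Sum>i'\<in>?I. C0 i' k)"
      using C0_irrelevant[OF k] by (intro sum.mono_neutral_right) auto
    then show ?thesis using sum_C0[OF i0] by simp
  next
    case True
    show ?thesis unfolding True using mass_pos by simp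
  qed
  finally show "(\<integral>\<tau>. overload k (X u \<tau>) \<partial>Q) \<le> mass" .
qed

definition block_bound :: real where
  "block_bound = real (n_resources N) * mass / exp (\<beta> - \<epsilon>)"

text \<open>The union bound over the resources and Markov's inequality in one step: the indicator is
  dominated by the sum of the overloads divided by exp(\<beta> - \<epsilon>).\<close>

lemma prob_blocked:
  assumes i: "i \<in> classes N" and u: "0 < u"
  shows "Q.prob {\<tau> \<in> space Q. blocked i (X u \<tau>) (Y u \<tau>)} \<le> block_bound"
proof -
  let ?A = "{\<tau> \<in> space Q. blocked i (X u \<tau>) (Y u \<tau>)}"
  have A: "?A \<in> sets Q" by (rule measurable_XY_set)
  have "Q.prob ?A = (\<integral>\<tau>. indicator ?A \<tau> \<partial>Q)" using A by simp
  also have "\<dots> \<le> (\<integral>\<tau>. (\<Sum>k\<in>resources N. overload k (X u \<tau>)) / exp (\<beta> - \<epsilon>) \<partial>Q)"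
  proof (rule integral_mono)
    show "integrable Q (indicator ?A :: _ \<Rightarrow> real)" using A by (simp add: Q.emeasure_eq_measure)
    show "integrable Q (\<lambda>\<tau>. (\<Sum>k\<in>resources N. overload k (X u \<tau>)) / exp (\<beta> - \<epsilon>))"
      by (intro integrable_divide_zero Bochner_Integration.integrable_sum overload_expectation(1) u)
    fix \<tau>
    show "indicator ?A \<tau> \<le> (\<Sum>k\<in>resources N. overload k (X u \<tau>)) / exp (\<beta> - \<epsilon>)"
    proof (cases "blocked i (X u \<tau>) (Y u \<tau>)")
      case True
      then obtain k where k: "k \<in> resources N" "exp (\<beta> - \<epsilon>) \<le> overload k (X u \<tau>)" by (rule blocked_overload[OF i])
      have "overload k (X u \<tau>) \<le> (\<Sum>k\<in>resources N. overload k (X u \<tau>))"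
        using k overload_nonneg by (intro member_le_sum) auto
      then have "1 \<le> (\<Sum>k\<in>resources N. overload k (X u \<tau>)) / exp (\<beta> - \<epsilon>)" using k by (simp add: le_divide_eq)
      moreover have "indicator ?A \<tau> \<le> (1 :: real)" by (simp add: indicator_def)
      ultimately show ?thesis by linarith
    next
      case False
      then have "indicator ?A \<tau> = (0 :: real)" by (simp add: indicator_def)
      moreover have "0 \<le> (\<Sum>k\<in>resources N. overload k (X u \<tau>)) / exp (\<beta> - \<epsilon>)"
        by (intro divide_nonneg_pos sum_nonneg overload_nonneg) auto
      ultimately show ?thesis by linarith
    qed
  qed
  also have "\<dots> = (\<Sum>k\<in>resources N. \<integral>\<tau>. overload k (X u \<tau>) \<partial>Q) / exp (\<beta> - \<epsilon>)"
    using overload_expectation(1) u by simp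
  also have "\<dots> \<le> (\<Sum>k\<in>resources N. mass) / exp (\<beta> - \<epsilon>)"
    using overload_expectation(2) u by (intro divide_right_mono sum_mono) auto
  finally show ?thesis by (simp add: block_bound_def resources_def)
qed

definition \<zeta> :: real where
  "\<zeta> = (ln (real (n_resources N) + 1) / \<beta> + 1 - \<epsilon> / 2) * (1 + 4 * \<epsilon>) - 1"

definition block_loss :: real where
  "block_loss = (real (n_resources N) + 1) ^ 2 * exp (- (\<epsilon> / 2) * (\<beta> - 4))"

lemma \<zeta>_nonneg: "0 \<le> \<zeta>"
proof -
  have "0 \<le> ln (real (n_resources N) + 1) / \<beta>" using beta_pos by simp
  then have "(1 - \<epsilon> / 2) * (1 + 4 * \<epsilon>) \<le> (ln (real (n_resources N) + 1) / \<beta> + 1 - \<epsilon> / 2) * (1 + 4 * \<epsilon>)"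
    using eps by (intro mult_right_mono) auto
  moreover have "\<epsilon> * \<epsilon> \<le> \<epsilon> * (1 / 4)" using eps by (intro mult_left_mono) auto
  then have "1 \<le> (1 - \<epsilon> / 2) * (1 + 4 * \<epsilon>)" using eps by (simp add: algebra_simps)
  ultimately show ?thesis by (simp add: \<zeta>_def)
qed

text \<open>The quotient of \<open>mass\<close> and exp(\<beta> - \<epsilon>) decays like
  exp(\<epsilon> - \<epsilon> \<beta> / 2), and dividing by 1 - \<epsilon>/2 costs at most another
  exp \<epsilon>. Together they give exp(-(\<epsilon>/2) (\<beta> - 4)).\<close>

lemma block_bound_le: "0 \<le> block_bound" "block_bound / (1 - \<epsilon> / 2) \<le> block_loss"
proof -
  let ?s = "real (n_resources N)"
  show "0 \<le> block_bound" using mass_pos by (simp add: block_bound_def less_imp_le)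
  have "block_bound = ?s * (?s + 1) * exp (\<epsilon> - \<epsilon> / 2 * \<beta>)"
  proof -
    have "exp (\<beta> * (1 - \<epsilon> / 2)) / exp (\<beta> - \<epsilon>) = exp (\<epsilon> - \<epsilon> / 2 * \<beta>)"
      by (simp add: exp_diff[symmetric] algebra_simps)
    then show ?thesis unfolding block_bound_def mass_def by (metis mult.assoc times_divide_eq_right)
  qed
  also have "\<dots> \<le> (?s + 1) ^ 2 * exp (\<epsilon> - \<epsilon> / 2 * \<beta>)" by (intro mult_right_mono) (auto simp: power2_eq_square)
  also have "\<dots> \<le> (?s + 1) ^ 2 * (exp (- (\<epsilon> / 2) * (\<beta> - 4)) * (1 - \<epsilon> / 2))"
  proof (intro mult_left_mono)
    have "\<epsilon> * \<epsilon> \<le> \<epsilon> * 1" using eps by (intro mult_left_mono) auto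
    then have "1 \<le> (1 + \<epsilon>) * (1 - \<epsilon> / 2)" by (simp add: algebra_simps)
    also have "\<dots> \<le> exp \<epsilon> * (1 - \<epsilon> / 2)" using eps exp_ge_add_one_self[of \<epsilon>] by (intro mult_right_mono) auto
    finally have "exp (\<epsilon> - \<epsilon> / 2 * \<beta>) * 1 \<le> exp (\<epsilon> - \<epsilon> / 2 * \<beta>) * (exp \<epsilon> * (1 - \<epsilon> / 2))" by (intro mult_left_mono) auto
    also have "\<dots> = exp (- (\<epsilon> / 2) * (\<beta> - 4)) * (1 - \<epsilon> / 2)"
      unfolding mult.assoc[symmetric] exp_add[symmetric] by (simp add: algebra_simps)
    finally show "exp (\<epsilon> - \<epsilon> / 2 * \<beta>) \<le> exp (- (\<epsilon> / 2) * (\<beta> - 4)) * (1 - \<epsilon> / 2)" by simp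
  qed simp
  finally show "block_bound / (1 - \<epsilon> / 2) \<le> block_loss" using eps by (simp add: divide_le_eq block_loss_def mult.assoc)
qed

section \<open>Expected numbers of requests\<close>

text \<open>\<open>class_bound\<close> with p = 1 and the blocking probability now known. The
  tangent of the logarithm at \<open>mass\<close> turns the penalty bound into ln
  \<open>mass\<close> divided by the fictitious slope, which is (1 + \<zeta>) (1 - \<alpha>) times
  the load.\<close>

lemma fictitious_expectation:
  assumes i: "i \<in> classes N" and t: "0 < t"
  shows "integrable Q (\<lambda>\<tau>. real (Y t \<tau> i))"
    and "(\<integral>\<tau>. real (Y t \<tau> i) \<partial>Q) \<le> (1 + \<zeta>) * (1 - cf i) * load N i
      + block_loss * load N i * (1 - exp (- service_rate N i * t))"
proof -
  interpret cp: class_potential "allocs N i" "relevant i" "slope i" "\<alpha> i" \<epsilon> "mixed i" "fslope i" "cf i \<noteq> 1"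
    by (rule class_potential[OF i])
  let ?l = "arrival_rate N i" and ?m = "service_rate N i"
  have lm: "0 < ?l" "0 < ?m" using rates_pos[OF i] by auto
  have r: "0 < 1 - \<epsilon> / 2" "1 - \<epsilon> / 2 \<le> 1" using eps by auto
  have b1: "0 < fslope i" if "cf i \<noteq> 1"
    using that load_pos[OF i] beta_pos eps frac_bounds[OF i] by (simp add: fslope_def c1_def)
  \<comment> \<open>The weight required by \<open>y_le_h\<close> at m = \<open>mass\<close>. If
    there is no fictitious penalty, all fictitious requests are phantoms and the charge p = 1 counts
    them already.\<close>
  define q where "q = (if cf i = 1 then 0 else 1 / (fslope i * mass))"
  define B where "B = (if cf i = 1 then 0 else (ln mass - 1) / fslope i)"
  have q: "0 \<le> q" using b1 mass_pos by (simp add: q_def less_imp_le)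
  note cb = class_bound[OF i class_potential[OF i] admissible[OF i] th_facts(4)[OF i] th_facts(1) init_facts[OF i]
      zero_le_one q prob_blocked[OF i] t]
  have y_le: "real y \<le> cp.h 1 q x y + B" for x y
  proof (cases "cf i = 1")
    case True
    then show ?thesis using cp.y_le_h0[of y x] by (simp add: q_def B_def)
  next
    case False
    then have "0 < q" "q * fslope i * mass = 1" using b1 mass_pos by (simp_all add: q_def)
    from cp.y_le_h[OF this(1) mass_pos this(2) False] show ?thesis using False by (simp add: B_def)
  qed
  have "(\<lambda>p. real (Y (fst p) (snd p) i)) \<in> borel_measurable time_clocks"
    by (rule measurable_state) simp
  from measurable_compose[OF measurable_Pair1'[of t borel borel_clocks] this]
  have m: "(\<lambda>\<tau>. real (Y t \<tau> i)) \<in> borel_measurable Q" by (simp cong: measurable_cong_sets)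
  have intB: "integrable Q (\<lambda>\<tau>. cp.h 1 q (X t \<tau> i) (Y t \<tau> i) + B)"
    using cb(1) by (intro Bochner_Integration.integrable_add) simp_all
  show int: "integrable Q (\<lambda>\<tau>. real (Y t \<tau> i))"
  proof (rule Bochner_Integration.integrable_bound[OF intB m])
    show "AE \<tau> in Q. norm (real (Y t \<tau> i)) \<le> norm (cp.h 1 q (X t \<tau> i) (Y t \<tau> i) + B)"
    proof (rule AE_I2)
      fix \<tau>
      show "norm (real (Y t \<tau> i)) \<le> norm (cp.h 1 q (X t \<tau> i) (Y t \<tau> i) + B)"
        using y_le[of "Y t \<tau> i" "X t \<tau> i"] by simp
    qed
  qed
  have "(\<integral>\<tau>. real (Y t \<tau> i) \<partial>Q) \<le> (\<integral>\<tau>. cp.h 1 q (X t \<tau> i) (Y t \<tau> i) + B \<partial>Q)"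
    by (rule integral_mono[OF int intB y_le])
  also have "\<dots> = (\<integral>\<tau>. cp.h 1 q (X t \<tau> i) (Y t \<tau> i) \<partial>Q) + B" using cb(1) by (simp add: Q.prob_space)
  also have "\<dots> \<le> q * (real (card (relevant i)) + of_bool (cf i \<noteq> 1)) * exp th + B
      + 1 * ?l * block_bound * (1 - exp (- (?m * (1 - \<epsilon> / 2)) * t)) / (?m * (1 - \<epsilon> / 2))" using cb(2) by simp
  also have "\<dots> \<le> (1 + \<zeta>) * (1 - cf i) * load N i + block_loss * load N i * (1 - exp (- ?m * t))"
  proof (rule add_mono)
    show "q * (real (card (relevant i)) + of_bool (cf i \<noteq> 1)) * exp th + B \<le> (1 + \<zeta>) * (1 - cf i) * load N i"
    proof (cases "cf i = 1")
      case False
      have "q * ((real (card (relevant i)) + of_bool (cf i \<noteq> 1)) * exp th) \<le> q * mass"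
        by (rule mult_left_mono[OF mass_ge q])
      then have "q * (real (card (relevant i)) + of_bool (cf i \<noteq> 1)) * exp th + B \<le> 1 / fslope i + (ln mass - 1) / fslope i"
        using False b1 mass_pos by (simp add: q_def B_def mult.assoc)
      also have "\<dots> = ln mass / fslope i" by (simp add: add_divide_distrib[symmetric])
      also have "ln mass = ln (real (n_resources N) + 1) + \<beta> * (1 - \<epsilon> / 2)"
        unfolding mass_def by (simp add: ln_mult_pos add_nonneg_pos)
      also have "(ln (real (n_resources N) + 1) + \<beta> * (1 - \<epsilon> / 2)) / fslope i
          = (ln (real (n_resources N) + 1) / \<beta> + 1 - \<epsilon> / 2) * c1 N \<epsilon> \<alpha> i"
        unfolding fslope_def using beta_pos by (simp add: field_simps)
      also have "\<dots> = (1 + \<zeta>) * (1 - cf i) * load N i" by (simp add: \<zeta>_def c1_def)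
      finally show ?thesis .
    qed (simp add: q_def B_def)
    \<comment> \<open>The reduced relaxation rate only makes the transient factor smaller.\<close>
    have e: "1 - exp (- (?m * (1 - \<epsilon> / 2)) * t) \<le> 1 - exp (- ?m * t)"
      using lm t r by (simp add: mult_le_cancel_left1)
    have "1 * ?l * block_bound * (1 - exp (- (?m * (1 - \<epsilon> / 2)) * t)) / (?m * (1 - \<epsilon> / 2))
        = block_bound / (1 - \<epsilon> / 2) * load N i * (1 - exp (- (?m * (1 - \<epsilon> / 2)) * t))"
      by (simp add: load_def mult_ac)
    also have "\<dots> \<le> block_loss * load N i * (1 - exp (- ?m * t))"
      using block_bound_le load_pos[OF i] lm t r e
      by (intro mult_mono mult_nonneg_nonneg) (auto simp: block_loss_def intro: less_imp_le)
    finally show "1 * ?l * block_bound * (1 - exp (- (?m * (1 - \<epsilon> / 2)) * t)) / (?m * (1 - \<epsilon> / 2))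
        \<le> block_loss * load N i * (1 - exp (- ?m * t))" .
  qed
  finally show "(\<integral>\<tau>. real (Y t \<tau> i) \<partial>Q) \<le> (1 + \<zeta>) * (1 - cf i) * load N i
      + block_loss * load N i * (1 - exp (- ?m * t))" .
qed

text \<open>The number in the network is the total minus the fictitious number. The initial load is
  (1 - \<alpha>) \<rho>, so the leading terms combine to \<rho> - \<alpha> \<rho> exp(-\<mu> t) - (1
  - \<alpha>) \<rho> = \<alpha> \<rho> (1 - exp(-\<mu> t)).\<close>

lemma network_expectation:
  assumes i: "i \<in> classes N" and t: "0 < t"
  shows "integrable Q (\<lambda>\<tau>. \<Sum>j\<in>allocs N i. real (X t \<tau> i j))"
    and "cf i * load N i * (1 - exp (- service_rate N i * t)) - \<zeta> * ((1 - cf i) * load N i)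
        - block_loss * (load N i * (1 - exp (- service_rate N i * t)))
      \<le> (\<integral>\<tau>. (\<Sum>j\<in>allocs N i. real (X t \<tau> i j)) \<partial>Q)"
proof -
  note tot = expectation_total_ge[OF i t] and fic = fictitious_expectation[OF i t]
  have eq: "(\<Sum>j\<in>allocs N i. real (X t \<tau> i j)) = real (class_size i (z i t \<tau>)) - real (Y t \<tau> i)" for \<tau>
    by (simp add: class_size_def sum_stations)
  show "integrable Q (\<lambda>\<tau>. \<Sum>j\<in>allocs N i. real (X t \<tau> i j))"
    unfolding eq by (rule Bochner_Integration.integrable_diff[OF tot(1) fic(1)])
  have y: "real (y0 i) = (1 - cf i) * load N i" using initial i by blast
  have "(\<integral>\<tau>. (\<Sum>j\<in>allocs N i. real (X t \<tau> i j)) \<partial>Q) = (\<integral>\<tau>. real (class_size i (z i t \<tau>)) \<partial>Q) - (\<integral>\<tau>. real (Y t \<tau> i) \<partial>Q)"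
    unfolding eq by (rule Bochner_Integration.integral_diff[OF tot(1) fic(1)])
  then show "cf i * load N i * (1 - exp (- service_rate N i * t)) - \<zeta> * ((1 - cf i) * load N i)
        - block_loss * (load N i * (1 - exp (- service_rate N i * t)))
      \<le> (\<integral>\<tau>. (\<Sum>j\<in>allocs N i. real (X t \<tau> i j)) \<partial>Q)"
    using tot(2) fic(2) unfolding y by (simp add: algebra_simps)
qed

section \<open>Transfer to the given probability space\<close>

lemma distr_driving_clocks:
  assumes clocks: "driving_clocks M N y0 T" and ne: "classes N \<noteq> {}"
  shows "(\<lambda>\<omega>. \<lambda>c\<in>clocks N y0. T c \<omega>) \<in> measurable M borel_clocks"
    and "distr M borel_clocks (\<lambda>\<omega>. \<lambda>c\<in>clocks N y0. T c \<omega>) = Q"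
proof -
  interpret M: prob_space M using clocks by (simp add: driving_clocks_def)
  have rv: "T c \<in> borel_measurable M" if "c \<in> clocks N y0" for c
    using clocks that distributed_measurable[of M lborel "T c"] by (auto simp: driving_clocks_def)
  show "(\<lambda>\<omega>. \<lambda>c\<in>clocks N y0. T c \<omega>) \<in> measurable M borel_clocks"
    by (intro measurable_restrict rv)
  have "clocks N y0 \<noteq> {}" using ne in_clocks(1)[of _ 0 N y0] by blast
  then have "distr M borel_clocks (\<lambda>\<omega>. \<lambda>c\<in>clocks N y0. T c \<omega>) = PiM (clocks N y0) (\<lambda>c. distr M borel (T c))"
    using M.indep_vars_iff_distr_eq_PiM'[where I="clocks N y0" and M'="\<lambda>_. borel" and X=T] rv clocks by (simp add: driving_clocks_def)
  also have "\<dots> = Q" unfolding Q_def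
  proof (rule PiM_cong[OF refl])
    fix c assume c: "c \<in> clocks N y0"
    have "distr M borel (T c) = distr M lborel (T c)" by (rule distr_cong) simp_all
    also have "\<dots> = density lborel (\<lambda>x. ennreal (exponential_density (clock_rate N c) x))"
      using clocks c by (intro distributed_distr_eq_density) (simp add: driving_clocks_def)
    finally show "distr M borel (T c) = clock_law c" by (simp add: clock_law_eq[OF c])
  qed
  finally show "distr M borel_clocks (\<lambda>\<omega>. \<lambda>c\<in>clocks N y0. T c \<omega>) = Q" .
qed

lemma AE_ring_neq:
  assumes i: "i \<in> classes N"
  shows "AE \<tau> in Q. \<forall>c\<in>class_clocks i. ring c \<tau> \<noteq> t"
proof (rule AE_ball_countable')
  show "countable (class_clocks i)" unfolding class_clocks_def services_def by auto
  fix c assume "c \<in> class_clocks i"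
  then have c: "c \<in> clocks N y0" using class_clocks_subset[OF i] by blast
  have "AE \<tau> in Q. \<tau> c \<noteq> t - start c \<tau>"
    using measurable_start[OF c] by (intro AE_clock_neq[OF c]) simp_all
  then show "AE \<tau> in Q. ring c \<tau> \<noteq> t" by eventually_elim (auto simp: ring_def)
qed

text \<open>Three identifications at once: the given decisions are the constructed ones by
  uniqueness, the clocks may be restricted to their index set, and the right-continuous count equals
  the left limit because no clock of the class rings at \<open>t\<close>.\<close>

lemma net_count_eq_X:
  fixes T :: "clock \<Rightarrow> 'a \<Rightarrow> real" and \<omega> :: 'a
  defines "\<tau> \<equiv> \<lambda>c\<in>clocks N y0. T c \<omega>"
  assumes fp: "fixpt T D \<omega>" and good: "good \<tau>" and i: "i \<in> classes N"
    and no: "\<And>c. c \<in> class_clocks i \<Longrightarrow> ring c \<tau> \<noteq> t"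
  shows "net_count N T D (present t) \<omega> i j = X t \<tau> i j"
proof -
  have clock: "\<tau> c = T c \<omega>" if "c \<in> clocks N y0" for c using that by (simp add: \<tau>_def)
  have arr: "arrival_time T k n \<omega> = arr k n \<tau>" if "k \<in> classes N" for k n
    unfolding arrival_time_def using clock that by (simp add: in_clocks)
  have lf: "locally_finite T \<omega>" using goodD(2)[OF good] by (simp add: locally_finite_def arr)
  have ag: "agree u T \<omega> cval \<tau>" for u
    unfolding agree_def using clock by (auto simp: arr in_clocks)
  have D: "D i n \<omega> = decision i n \<tau>" for n
    by (rule fixpt_unique[OF fp fixpt_decision[OF goodD(2)[OF good]] lf ag i, of n "arrival_time T i n \<omega> + 1"]) simp
  have "present t (arrival_time T i n \<omega>) (T (Net_Service i n) \<omega>)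
      \<longleftrightarrow> present_before t (arr i n \<tau>) (\<tau> (Net_Service i n))" for n
  proof -
    have "arr i n \<tau> \<noteq> t"
      using no[of "Interarrival i n"] by (simp add: ring_Interarrival class_clocks_def)
    moreover have "arr i n \<tau> + \<tau> (Net_Service i n) \<noteq> t"
      using no[of "Net_Service i n"] by (simp add: ring_def class_clocks_def services_def)
    moreover have "\<tau> (Net_Service i n) = T (Net_Service i n) \<omega>" using clock i by (simp add: in_clocks)
    ultimately show ?thesis unfolding arr[OF i] by (auto simp: present_def present_before_def)
  qed
  then show ?thesis by (simp add: net_count_def D)
qed

end

theorem theorem7:
  fixes M :: "'a measure" and N :: loss_network
    and \<epsilon> \<beta> :: real and \<alpha> :: "nat \<Rightarrow> nat \<Rightarrow> real" and y0 :: "nat \<Rightarrow> nat"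
    and sel :: "nat \<Rightarrow> (nat \<Rightarrow> nat \<Rightarrow> nat) \<Rightarrow> (nat \<Rightarrow> nat) \<Rightarrow> nat"
    and T :: "clock \<Rightarrow> 'a \<Rightarrow> real" and D :: "nat \<Rightarrow> nat \<Rightarrow> 'a \<Rightarrow> nat option"
  assumes network: "is_loss_network N"
    and allocations_needed:
      "\<exists>\<alpha>opt. lp_optimal N (capacity N) \<alpha>opt \<and>
              (\<forall>i\<in>classes N. \<forall>j\<in>allocs N i. \<alpha>opt i j \<noteq> 0)"
    and eps: "0 < \<epsilon>" "\<epsilon> < 1 / 4"
    and optimal: "lp_optimal N (\<lambda>k. 1 / (1 + 4 * \<epsilon>) * capacity N k) \<alpha>"
    and beta_pos: "0 < \<beta>"
    and beta_c0: "\<forall>i\<in>classes N. \<forall>j\<in>allocs N i. \<forall>k\<in>resources N.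
                    0 < alloc N i j k \<longrightarrow> \<beta> \<le> \<epsilon> * (c0 N \<epsilon> \<alpha> i k / alloc N i j k)"
    and beta_c1: "\<forall>i\<in>classes N. class_fraction N \<alpha> i < 1 \<longrightarrow> \<beta> \<le> \<epsilon> * c1 N \<epsilon> \<alpha> i"
    and initial: "\<forall>i\<in>classes N. real (y0 i) = (1 - class_fraction N \<alpha> i) * load N i"
    and clocks: "driving_clocks M N y0 T"
    and ties: "tie_breaking N \<beta> (c0 N \<epsilon> \<alpha>) sel"
    and policy: "follows_penalty_policy M N y0 \<beta> (c0 N \<epsilon> \<alpha>) (c1 N \<epsilon> \<alpha>) sel T D"
  defines "\<zeta> \<equiv> (ln (real (n_resources N) + 1) / \<beta> + 1 - \<epsilon> / 2) * (1 + 4 * \<epsilon>) - 1"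
  shows "\<forall>t\<ge>0.
    integrable M (reward_rate N T D t) \<and>
    prob_space.expectation M (reward_rate N T D t) \<ge>
      (\<Sum>i\<in>classes N. class_fraction N \<alpha> i * reward N i * load N i
                        * (1 - exp (- service_rate N i * t)))
      - \<zeta> * (\<Sum>i\<in>classes N. (1 - class_fraction N \<alpha> i) * reward N i * load N i)
      - (real (n_resources N) + 1) ^ 2 * exp (- (\<epsilon> / 2) * (\<beta> - 4))
          * (\<Sum>i\<in>classes N. reward N i * load N i * (1 - exp (- service_rate N i * t)))"
proof -
  interpret M: prob_space M using clocks by (simp add: driving_clocks_def)
  show ?thesis
  \<comment> \<open>Without classes there are no clocks; the product characterisation of
    independence is applied to a nonempty index set.\<close>
  proof (cases "classes N = {}")
    case True
    then have "reward_rate N T D t = (\<lambda>_. 0)" for t by (simp add: reward_rate_def fun_eq_iff)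
    then show ?thesis using True by simp
  next
    case False
    interpret penalty_network N \<epsilon> \<beta> \<alpha> y0 sel
      using network eps optimal beta_pos beta_c0 beta_c1 initial ties
      by unfold_locales (simp_all add: lp_optimal_def)
    have \<zeta>: "\<zeta> = local.\<zeta>" unfolding assms(13) local.\<zeta>_def ..
    define \<tau> where "\<tau> \<omega> = (\<lambda>c\<in>clocks N y0. T c \<omega>)" for \<omega>
    note distr = distr_driving_clocks[OF clocks False, folded \<tau>_def]
    have T: "T c \<in> borel_measurable M" if "c \<in> clocks N y0" for c
      using clocks that distributed_measurable[of M lborel "T c"] by (auto simp: driving_clocks_def)
    have D: "D i n \<in> measurable M (count_space UNIV)" if "i \<in> classes N" for i n
      using policy that by (simp add: follows_penalty_policy_def)
    have AE_M: "AE \<omega> in M. R (\<tau> \<omega>)" if "AE \<tau> in Q. R \<tau>" for R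
      by (rule AE_distrD[OF distr(1), of R, unfolded distr(2), OF that])
    have fp: "AE \<omega> in M. fixpt T D \<omega>"
      using policy unfolding follows_penalty_policy_def fixpt_def Let_def by (simp add: dec_def)
    have meas: "reward_rate N T D t \<in> borel_measurable M" for t
    proof -
      have P: "{\<omega> \<in> space M. present t (f \<omega>) (g \<omega>)} \<in> sets M"
        if [measurable]: "f \<in> borel_measurable M" "g \<in> borel_measurable M" for f g
        unfolding present_def by measurable
      have "(\<lambda>\<omega>. net_count N T D (present t) \<omega>) \<in> measurable M (count_space (net_states N))"
        by (rule measurable_counts(1)[OF D, where ?y0.0 = y0])
          (auto intro!: P T measurable_arrival_time[OF T] simp: in_clocks)
      from measurable_compose[OF this, of "\<lambda>x. \<Sum>i\<in>classes N. reward N i * (\<Sum>j\<in>allocs N i. real (x i j))" borel]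
      show ?thesis unfolding reward_rate_def by simp
    qed
    show ?thesis
    proof (intro allI impI)
      fix t :: real assume "0 \<le> t"
      define rhs where "rhs = (\<Sum>i\<in>classes N. class_fraction N \<alpha> i * reward N i * load N i
                        * (1 - exp (- service_rate N i * t)))
        - \<zeta> * (\<Sum>i\<in>classes N. (1 - class_fraction N \<alpha> i) * reward N i * load N i)
        - (real (n_resources N) + 1) ^ 2 * exp (- (\<epsilon> / 2) * (\<beta> - 4))
          * (\<Sum>i\<in>classes N. reward N i * load N i * (1 - exp (- service_rate N i * t)))"
      have "integrable M (reward_rate N T D t) \<and> rhs \<le> M.expectation (reward_rate N T D t)"
      \<comment> \<open>The expectation bounds are for left limits at positive times. At time 0 the
        network is almost surely empty, and the claim reduces to \<zeta> \<ge> 0.\<close>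
      proof (cases "t = 0")
        case True
        have "AE \<omega> in M. reward_rate N T D 0 \<omega> = 0"
          using AE_M[OF AE_good]
        proof eventually_elim
          fix \<omega> assume g: "good (\<tau> \<omega>)"
          have pos: "0 < arrival_time T i n \<omega>" if i: "i \<in> classes N" for i n
            using start_pos[OF g i, of n] i by (simp add: arrival_time_def \<tau>_def in_clocks)
          then have "\<not> present 0 (arrival_time T i n \<omega>) s" if "i \<in> classes N" for i n s
            using pos[OF that, of n] by (simp add: present_def)
          then show "reward_rate N T D 0 \<omega> = 0" by (simp add: reward_rate_def net_count_def)
        qed
        then have "integrable M (reward_rate N T D 0)" "M.expectation (reward_rate N T D 0) = 0"
          using meas[of 0] by (auto simp: integrable_cong_AE[where g="\<lambda>_. 0"] integral_cong_AE[where g="\<lambda>_. 0"])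
        moreover have "0 \<le> \<zeta> * (\<Sum>i\<in>classes N. (1 - class_fraction N \<alpha> i) * reward N i * load N i)"
          unfolding \<zeta> using frac_bounds reward_nonneg load_pos
          by (intro mult_nonneg_nonneg \<zeta>_nonneg sum_nonneg) (auto intro: less_imp_le)
        ultimately show ?thesis by (simp add: True rhs_def)
      next
        case False
        then have t: "0 < t" using \<open>0 \<le> t\<close> by simp
        define R where "R \<tau> = (\<Sum>i\<in>classes N. reward N i * (\<Sum>j\<in>allocs N i. real (X t \<tau> i j)))" for \<tau>
        note ne = network_expectation[OF _ t]
        have R_int: "integrable Q R"
          unfolding R_def by (intro Bochner_Integration.integrable_sum integrable_mult_right ne(1))
        have eq: "AE \<omega> in M. R (\<tau> \<omega>) = reward_rate N T D t \<omega>"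
        proof -
          have "AE \<tau> in Q. \<forall>i\<in>classes N. \<forall>c\<in>class_clocks i. ring c \<tau> \<noteq> t"
            by (intro AE_finite_allI AE_ring_neq) simp_all
          from AE_M[OF this] AE_M[OF AE_good] fp show ?thesis
          proof eventually_elim
            fix \<omega> assume *: "\<forall>i\<in>classes N. \<forall>c\<in>class_clocks i. ring c (\<tau> \<omega>) \<noteq> t" "good (\<tau> \<omega>)" "fixpt T D \<omega>"
            have "net_count N T D (present t) \<omega> i j = X t (\<tau> \<omega>) i j" if "i \<in> classes N" for i j
              unfolding \<tau>_def by (rule net_count_eq_X[OF *(3) *(2)[unfolded \<tau>_def] that]) (use * that in \<open>auto simp: \<tau>_def\<close>)
            then show "R (\<tau> \<omega>) = reward_rate N T D t \<omega>" by (simp add: R_def reward_rate_def)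
          qed
        qed
        have R_meas: "R \<in> borel_measurable (distr M borel_clocks \<tau>)"
          using borel_measurable_integrable[OF R_int] by (simp add: distr(2))
        have M_int: "integrable M (\<lambda>\<omega>. R (\<tau> \<omega>))"
          using integrable_distr[OF distr(1), of R] R_int by (simp add: distr(2))
        have "integrable M (reward_rate N T D t)"
          using integrable_cong_AE[OF borel_measurable_integrable[OF M_int] meas eq] M_int by simp
        moreover have "M.expectation (reward_rate N T D t) = (\<integral>\<tau>. R \<tau> \<partial>Q)"
        proof -
          have "M.expectation (reward_rate N T D t) = (\<integral>\<omega>. R (\<tau> \<omega>) \<partial>M)"
            using integral_cong_AE[OF borel_measurable_integrable[OF M_int] meas eq] by simp
          also have "\<dots> = (\<integral>\<tau>. R \<tau> \<partial>distr M borel_clocks \<tau>)"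
            using R_meas by (intro integral_distr[OF distr(1), symmetric]) simp
          finally show ?thesis by (simp add: distr(2))
        qed
        moreover have "(\<integral>\<tau>. R \<tau> \<partial>Q) = (\<Sum>i\<in>classes N. reward N i * (\<integral>\<tau>. (\<Sum>j\<in>allocs N i. real (X t \<tau> i j)) \<partial>Q))"
          unfolding R_def using ne(1) by (subst Bochner_Integration.integral_sum) auto
        moreover have "rhs \<le> \<dots>"
        proof -
          have "rhs = (\<Sum>i\<in>classes N. reward N i * (cf i * load N i * (1 - exp (- service_rate N i * t))
              - local.\<zeta> * ((1 - cf i) * load N i) - block_loss * (load N i * (1 - exp (- service_rate N i * t)))))"
            unfolding rhs_def \<zeta> block_loss_def[symmetric] sum_distrib_left sum_subtractf[symmetric]
            by (intro sum.cong refl) (simp add: algebra_simps)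
          also have "\<dots> \<le> (\<Sum>i\<in>classes N. reward N i * (\<integral>\<tau>. (\<Sum>j\<in>allocs N i. real (X t \<tau> i j)) \<partial>Q))"
            using ne(2) reward_nonneg by (intro sum_mono mult_left_mono) auto
          finally show ?thesis .
        qed
        ultimately show ?thesis by simp
      qed
      then show "integrable M (reward_rate N T D t) \<and>
          M.expectation (reward_rate N T D t) \<ge>
      (\<Sum>i\<in>classes N. class_fraction N \<alpha> i * reward N i * load N i
                        * (1 - exp (- service_rate N i * t)))
      - \<zeta> * (\<Sum>i\<in>classes N. (1 - class_fraction N \<alpha> i) * reward N i * load N i)
      - (real (n_resources N) + 1) ^ 2 * exp (- (\<epsilon> / 2) * (\<beta> - 4))
          * (\<Sum>i\<in>classes N. reward N i * load N i * (1 - exp (- service_rate N i * t)))"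
        unfolding rhs_def .
    qed
  qed
qed

end
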